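(* Consider a three-node relay channel with in-block memory of block length $L$ that is physically degraded, i.e., $X_1^L-\mathbf{A}_2^LY_2^L-Y_3^L$ forms a Markov chain (for every $P_{X_1^L\mathbf{A}_2^L}$). Its capacity $C$ is $$C=\frac1L\max_{P_{X_1^L\mathbf{A}_2^L}}\min\left(I(X_1^L;Y_2^L\mid\mathbf{A}_2^L),\ I(X_1^L\mathbf{A}_2^L;Y_3^L)\right),$$ where the joint distribution factors as $P(x_1^L,\mathbf{a}_2^L)\,1(x_2^L\,\|\,\mathbf{a}_2^L,0y_2^{L-1})\,P(y_2^L,y_3^L\,\|\,x_1^L,x_2^L)$.
   Context: Model. The source (node 1) has a message $W$, uniformly distributed with entropy $nR$ bits, and sends $X_1^n$, a function of $W$ (no feedback). The relay (node 2) has no message and sends $X_{2,i}$ as a function of its past outputs $Y_2^{i-1}$. The destination (node 3) decodes $W$ from $Y_3^n$. $n=mL$. The channel has memory inside blocks of length $L$ and none across blocks: at position $i$ of a block, $(Y_{2,i},Y_{3,i})$ is a fixed function $f_i$ of $(X_{1}^i,X_{2}^i)$ (the first $i$ inputs of that block) and a noise variable $Z$ that is i.i.d. across blocks and independent of $W$. All alphabets are finite. $C$ is the supremum of rates $R$ (bits per channel use) such that for every $\epsilon>0$ there are an $n$ (a multiple of $L$) and a code with error probability at most $\epsilon$. Notation. A relay block code function $\mathbf{a}_2^L=(\mathbf{a}_{2,1},\dots,\mathbf{a}_{2,L})$ is a tuple of functions $\mathbf{a}_{2,i}:\mathcal{Y}_{2,1}\times\cdots\times\mathcal{Y}_{2,i-1}\to\mathcal{X}_{2,i}$;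 $1(x_2^L\|\mathbf{a}_2^L,0y_2^{L-1})$ is $1$ if $x_{2,i}=\mathbf{a}_{2,i}(y_2^{i-1})$ for all $i$, else $0$. $P(y_2^L,y_3^L\|x_1^L,x_2^L)=\prod_{i=1}^LP(y_{2,i},y_{3,i}\mid y_2^{i-1},y_3^{i-1},x_1^i,x_2^i)$ is the block channel law. *)

theory Defs
  imports "HOL-Probability.Probability"
begin

text \<open>Block positions and times are counted from 0, so at position i the past has length i and
  the inputs up to and including the current one form a list of length i + 1.\<close>

record ('x1, 'x2, 'y2, 'y3, 'z) relay_channel =
  block_len :: nat
  X1_alph :: "nat \<Rightarrow> 'x1 set"
  X2_alph :: "nat \<Rightarrow> 'x2 set"
  Y2_alph :: "nat \<Rightarrow> 'y2 set"
  Y3_alph :: "nat \<Rightarrow> 'y3 set"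
  noise :: "'z pmf"
  Y2_fun :: "nat \<Rightarrow> 'x1 list \<Rightarrow> 'x2 list \<Rightarrow> 'z \<Rightarrow> 'y2"
  Y3_fun :: "nat \<Rightarrow> 'x1 list \<Rightarrow> 'x2 list \<Rightarrow> 'z \<Rightarrow> 'y3"

definition words :: "(nat \<Rightarrow> 'a set) \<Rightarrow> nat \<Rightarrow> 'a list set" where
  "words A k = {xs. length xs = k \<and> (\<forall>i<k. xs ! i \<in> A i)}"

definition valid_channel :: "('x1, 'x2, 'y2, 'y3, 'z) relay_channel \<Rightarrow> bool" where
  "valid_channel ch \<longleftrightarrow>
     block_len ch \<ge> 1 \<and> finite (set_pmf (noise ch)) \<and>
     (\<forall>i<block_len ch.
        finite (X1_alph ch i) \<and> X1_alph ch i \<noteq> {} \<and>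
        finite (X2_alph ch i) \<and> X2_alph ch i \<noteq> {} \<and>
        finite (Y2_alph ch i) \<and> finite (Y3_alph ch i) \<and>
        (\<forall>x1\<in>words (X1_alph ch) (Suc i). \<forall>x2\<in>words (X2_alph ch) (Suc i). \<forall>z\<in>set_pmf (noise ch).
           Y2_fun ch i x1 x2 z \<in> Y2_alph ch i \<and> Y3_fun ch i x1 x2 z \<in> Y3_alph ch i))"


section \<open>Codes and capacity\<close>

text \<open>The inputs of the block containing time t, up to and including time t.\<close>
definition block_history :: "nat \<Rightarrow> nat \<Rightarrow> 'a list \<Rightarrow> 'a list" where
  "block_history L t xs = drop (L * (t div L)) (take (Suc t) xs)"

text \<open>The relay's strategy is one function \<open>g\<close> of the list of all its past outputs (in the
  current and in earlier blocks); the time is the length of that list.\<close>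
definition relay_inputs :: "('y2 list \<Rightarrow> 'x2) \<Rightarrow> 'y2 list \<Rightarrow> nat \<Rightarrow> 'x2 list" where
  "relay_inputs g ys k = map (\<lambda>s. g (take s ys)) [0..<k]"

text \<open>In the next two definitions \<open>zs\<close> lists the noise values, one for each block.\<close>
primrec relay_outputs ::
  "('x1, 'x2, 'y2, 'y3, 'z) relay_channel \<Rightarrow> 'x1 list \<Rightarrow> ('y2 list \<Rightarrow> 'x2) \<Rightarrow> 'z list \<Rightarrow> nat \<Rightarrow> 'y2 list"
where
  "relay_outputs ch x1 g zs 0 = []"
| "relay_outputs ch x1 g zs (Suc t) =
     (let L = block_len ch; ys = relay_outputs ch x1 g zs t in
      ys @ [Y2_fun ch (t mod L) (block_history L t x1)
              (block_history L t (relay_inputs g ys (Suc t))) (zs ! (t div L))])"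

definition dest_outputs ::
  "('x1, 'x2, 'y2, 'y3, 'z) relay_channel \<Rightarrow> 'x1 list \<Rightarrow> ('y2 list \<Rightarrow> 'x2) \<Rightarrow> 'z list \<Rightarrow> nat \<Rightarrow> 'y3 list"
where
  "dest_outputs ch x1 g zs n =
     map (\<lambda>t. let L = block_len ch; ys = relay_outputs ch x1 g zs t in
            Y3_fun ch (t mod L) (block_history L t x1)
              (block_history L t (relay_inputs g ys (Suc t))) (zs ! (t div L))) [0..<n]"

text \<open>A code with m blocks and messages 0, ..., M - 1: source encoder, relay strategy and decoder.\<close>
definition is_code ::
  "('x1, 'x2, 'y2, 'y3, 'z) relay_channel \<Rightarrow> nat \<Rightarrow> nat \<Rightarrow>
   (nat \<Rightarrow> 'x1 list) \<Rightarrow> ('y2 list \<Rightarrow> 'x2) \<Rightarrow> ('y3 list \<Rightarrow> nat) \<Rightarrow> bool"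
where
  "is_code ch m M enc g dec \<longleftrightarrow>
     (let L = block_len ch; n = m * L in
      (\<forall>w<M. enc w \<in> words (\<lambda>t. X1_alph ch (t mod L)) n) \<and>
      (\<forall>t<n. \<forall>ys\<in>words (\<lambda>s. Y2_alph ch (s mod L)) t. g ys \<in> X2_alph ch (t mod L)) \<and>
      (\<forall>ys\<in>words (\<lambda>t. Y3_alph ch (t mod L)) n. dec ys < M))"

definition error_prob ::
  "('x1, 'x2, 'y2, 'y3, 'z) relay_channel \<Rightarrow> nat \<Rightarrow> nat \<Rightarrow>
   (nat \<Rightarrow> 'x1 list) \<Rightarrow> ('y2 list \<Rightarrow> 'x2) \<Rightarrow> ('y3 list \<Rightarrow> nat) \<Rightarrow> real"
where
  "error_prob ch m M enc g dec =
     measure_pmf.prob (pair_pmf (pmf_of_set {..<M}) (replicate_pmf m (noise ch)))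
       {(w, zs). dec (dest_outputs ch (enc w) g zs (m * block_len ch)) \<noteq> w}"

text \<open>The condition on \<open>log 2 M\<close> says that the uniform message has entropy n R bits.\<close>
definition achievable :: "('x1, 'x2, 'y2, 'y3, 'z) relay_channel \<Rightarrow> real \<Rightarrow> bool" where
  "achievable ch R \<longleftrightarrow>
     (\<forall>\<epsilon>>0. \<exists>m M enc g dec. m \<ge> 1 \<and> M \<ge> 1 \<and>
        log 2 (real M) = real (m * block_len ch) * R \<and>
        is_code ch m M enc g dec \<and> error_prob ch m M enc g dec \<le> \<epsilon>)"

text \<open>The supremum is taken in the extended reals, where it always exists.\<close>
definition capacity :: "('x1, 'x2, 'y2, 'y3, 'z) relay_channel \<Rightarrow> ereal" where
  "capacity ch = (SUP R\<in>{R. achievable ch R}. ereal R)"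


section \<open>The joint distribution in one block\<close>

text \<open>Extensional functions, so that there are finitely many tuples.\<close>
definition code_functions ::
  "('x1, 'x2, 'y2, 'y3, 'z) relay_channel \<Rightarrow> (nat \<Rightarrow> 'y2 list \<Rightarrow> 'x2) set" where
  "code_functions ch =
     (\<Pi>\<^sub>E i\<in>{..<block_len ch}. \<Pi>\<^sub>E ys\<in>words (Y2_alph ch) i. X2_alph ch i)"

text \<open>The indicator \<open>1(x\<^sub>2\<^sup>L \<parallel> a\<^sub>2\<^sup>L, 0 y\<^sub>2\<^sup>L\<^sup>-\<^sup>1)\<close>.\<close>
definition relay_indicator :: "nat \<Rightarrow> 'x2 list \<Rightarrow> (nat \<Rightarrow> 'y2 list \<Rightarrow> 'x2) \<Rightarrow> 'y2 list \<Rightarrow> real" where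
  "relay_indicator L x2 a y2 = of_bool (\<forall>i<L. x2 ! i = a i (take i y2))"

definition outputs_agree ::
  "('x1, 'x2, 'y2, 'y3, 'z) relay_channel \<Rightarrow> 'x1 list \<Rightarrow> 'x2 list \<Rightarrow> 'y2 list \<Rightarrow> 'y3 list \<Rightarrow>
   nat \<Rightarrow> 'z \<Rightarrow> bool"
where
  "outputs_agree ch x1 x2 y2 y3 i z \<longleftrightarrow>
     Y2_fun ch i (take (Suc i) x1) (take (Suc i) x2) z = y2 ! i \<and>
     Y3_fun ch i (take (Suc i) x1) (take (Suc i) x2) z = y3 ! i"

text \<open>The factor for position i is the conditional probability of the i-th outputs given the
  past outputs, with all inputs fixed. If the condition has probability 0, that factor is 0
  (division by 0); an earlier factor then vanishes as well.\<close>
definition block_law ::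
  "('x1, 'x2, 'y2, 'y3, 'z) relay_channel \<Rightarrow> 'x1 list \<Rightarrow> 'x2 list \<Rightarrow> 'y2 list \<Rightarrow> 'y3 list \<Rightarrow> real"
where
  "block_law ch x1 x2 y2 y3 =
     (\<Prod>i<block_len ch.
        \<P>(z in measure_pmf (noise ch). outputs_agree ch x1 x2 y2 y3 i z
             \<bar> \<forall>j<i. outputs_agree ch x1 x2 y2 y3 j z))"

definition input_dists ::
  "('x1, 'x2, 'y2, 'y3, 'z) relay_channel \<Rightarrow> ('x1 list \<times> (nat \<Rightarrow> 'y2 list \<Rightarrow> 'x2)) pmf set" where
  "input_dists ch = {P. set_pmf P \<subseteq> words (X1_alph ch) (block_len ch) \<times> code_functions ch}"

definition block_space ::
  "('x1, 'x2, 'y2, 'y3, 'z) relay_channel \<Rightarrow> ('x1 list \<times> (nat \<Rightarrow> 'y2 list \<Rightarrow> 'x2)) pmf \<Rightarrow>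
   ('x1 list \<times> (nat \<Rightarrow> 'y2 list \<Rightarrow> 'x2) \<times> 'x2 list \<times> 'y2 list \<times> 'y3 list) measure"
where
  "block_space ch P =
     (let L = block_len ch in
      point_measure
        (words (X1_alph ch) L \<times> code_functions ch \<times> words (X2_alph ch) L \<times>
         words (Y2_alph ch) L \<times> words (Y3_alph ch) L)
        (\<lambda>(x1, a, x2, y2, y3).
           ennreal (pmf P (x1, a) * relay_indicator L x2 a y2 * block_law ch x1 x2 y2 y3)))"

definition rv_X1 :: "'x1 \<times> 'a \<times> 'x2 \<times> 'y2 \<times> 'y3 \<Rightarrow> 'x1" where
  "rv_X1 = (\<lambda>(x1, a, x2, y2, y3). x1)"

definition rv_A2 :: "'x1 \<times> 'a \<times> 'x2 \<times> 'y2 \<times> 'y3 \<Rightarrow> 'a" where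
  "rv_A2 = (\<lambda>(x1, a, x2, y2, y3). a)"

definition rv_Y2 :: "'x1 \<times> 'a \<times> 'x2 \<times> 'y2 \<times> 'y3 \<Rightarrow> 'y2" where
  "rv_Y2 = (\<lambda>(x1, a, x2, y2, y3). y2)"

definition rv_Y3 :: "'x1 \<times> 'a \<times> 'x2 \<times> 'y2 \<times> 'y3 \<Rightarrow> 'y3" where
  "rv_Y3 = (\<lambda>(x1, a, x2, y2, y3). y3)"


section \<open>Information quantities and degradedness\<close>

text \<open>The library's mutual informations in bits, for random variables with finite range. They
  agree with the notation \<open>\<I>(X ; Y)\<close> and \<open>\<I>(X ; Y | Z)\<close> of the locale \<open>information_space\<close>.\<close>
definition mutual_info :: "'w measure \<Rightarrow> ('w \<Rightarrow> 'a) \<Rightarrow> ('w \<Rightarrow> 'b) \<Rightarrow> real" where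
  "mutual_info M X Y =
     prob_space.mutual_information M 2 (count_space (X ` space M)) (count_space (Y ` space M)) X Y"

definition cond_mutual_info ::
  "'w measure \<Rightarrow> ('w \<Rightarrow> 'a) \<Rightarrow> ('w \<Rightarrow> 'b) \<Rightarrow> ('w \<Rightarrow> 'c) \<Rightarrow> real" where
  "cond_mutual_info M X Y Z =
     prob_space.conditional_mutual_information M 2
       (count_space (X ` space M)) (count_space (Y ` space M)) (count_space (Z ` space M)) X Y Z"

definition markov_chain :: "'w measure \<Rightarrow> ('w \<Rightarrow> 'a) \<Rightarrow> ('w \<Rightarrow> 'b) \<Rightarrow> ('w \<Rightarrow> 'c) \<Rightarrow> bool" where
  "markov_chain M X Y Z \<longleftrightarrow>
     (\<forall>x y z. \<P>(\<omega> in M. X \<omega> = x \<and> Y \<omega> = y) > 0 \<longrightarrow>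
        \<P>(\<omega> in M. Z \<omega> = z \<bar> X \<omega> = x \<and> Y \<omega> = y) = \<P>(\<omega> in M. Z \<omega> = z \<bar> Y \<omega> = y))"

definition physically_degraded :: "('x1, 'x2, 'y2, 'y3, 'z) relay_channel \<Rightarrow> bool" where
  "physically_degraded ch \<longleftrightarrow>
     (\<forall>P\<in>input_dists ch.
        markov_chain (block_space ch P) rv_X1 (\<lambda>\<omega>. (rv_A2 \<omega>, rv_Y2 \<omega>)) rv_Y3)"

definition degraded_objective ::
  "('x1, 'x2, 'y2, 'y3, 'z) relay_channel \<Rightarrow> ('x1 list \<times> (nat \<Rightarrow> 'y2 list \<Rightarrow> 'x2)) pmf \<Rightarrow> real" where
  "degraded_objective ch P =
     min (cond_mutual_info (block_space ch P) rv_X1 rv_Y2 rv_A2)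
         (mutual_info (block_space ch P) (\<lambda>\<omega>. (rv_X1 \<omega>, rv_A2 \<omega>)) rv_Y3)"

end

theory Submission
  imports Defs
begin

text \<open>Used with one code function per block, the channel is a memoryless relay channel with input
  letters \<open>(x\<^sub>1\<^sup>L, a\<^sub>2\<^sup>L)\<close>, and degradedness makes \<open>y\<^sub>3\<^sup>L\<close> a random function of \<open>(a\<^sub>2\<^sup>L, y\<^sub>2\<^sup>L)\<close>
  alone.

  Achievability is decode-and-forward with block Markov superposition coding: in each block of a
  regular code the relay decodes the new message and the destination, working backwards from the
  last block, decodes the previous one. Both use threshold tests on information densities. A wrong
  codeword has mean density ratio at most 1, so Markov's inequality bounds false alarms, and a
  Chernoff bound handles the true codeword.

  For the converse, both cut-set bounds are changes of measure. The law of the outputs is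
  compared with a law under which what the destination sees is independent of the message: i.i.d.
  outputs for one cut, and for the other the relay outputs drawn given only the code
  function. The reference laws come from the time average \<open>P\<close> of the laws of the letters, so that
  the expected log-likelihood ratio is exactly the number of blocks times the information at \<open>P\<close>.\<close>

text \<open>Since \<open>achievable\<close> asks for \<open>log 2 M\<close> to equal n R exactly,
  codes are built only at rates p B / (q (B + 1) L) with natural p, q, B, where message counts are
  powers of two; such rates come arbitrarily close to every nonnegative number below the optimum.
  The factor B / (B + 1) pays for a last block with a message known in advance, from which backward
  decoding starts. No typical sequences occur: the bound on wrong codewords holds for every fixed
  received word, so only the density of the true codeword has to concentrate. In the converse the
  relay's letters depend on past noise in an unknown way. What saves additivity is that the noise of
  a block is independent of the letter used in it. The changes of measure take the place of chain
  rules and of Fano's inequality, and their additive constants do not grow with the number of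
  blocks. That the maximum is attained needs continuity up to the boundary of the simplex, where the
  conditional laws inside the information density break down; rewriting the information through
  entropies of joint laws removes them.\<close>

section \<open>Integrals over product distributions\<close>

lemma nn_integral_replicate_prod_list:
  "(\<integral>\<^sup>+cs. \<integral>\<^sup>+zs. prod_list (map2 f cs zs) \<partial>replicate_pmf n q \<partial>replicate_pmf n p) =
     (\<integral>\<^sup>+c. \<integral>\<^sup>+z. f c z \<partial>measure_pmf q \<partial>measure_pmf p) ^ n"
proof (induction n)
  case 0
  show ?case by simp
next
  case (Suc n)
  have "(\<integral>\<^sup>+cs. \<integral>\<^sup>+zs. prod_list (map2 f cs zs) \<partial>replicate_pmf (Suc n) q \<partial>replicate_pmf (Suc n) p)
     = (\<integral>\<^sup>+c. \<integral>\<^sup>+cs. \<integral>\<^sup>+z. \<integral>\<^sup>+zs. f c z * prod_list (map2 f cs zs)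
          \<partial>replicate_pmf n q \<partial>q \<partial>replicate_pmf n p \<partial>p)"
    by simp
  also have "\<dots> = (\<integral>\<^sup>+c. \<integral>\<^sup>+z. f c z * (\<integral>\<^sup>+cs. \<integral>\<^sup>+zs. prod_list (map2 f cs zs)
          \<partial>replicate_pmf n q \<partial>replicate_pmf n p) \<partial>q \<partial>p)"
    by (simp add: nn_integral_cmult nn_integral_multc)
  also have "\<dots> = (\<integral>\<^sup>+c. \<integral>\<^sup>+z. f c z \<partial>q \<partial>p) ^ Suc n"
    by (simp add: Suc nn_integral_multc)
  finally show ?case .
qed

lemma map_pmf_Pi_pmf_pair:
  assumes "finite A" "i \<in> A" "j \<in> A" "i \<noteq> j"
  shows "map_pmf (\<lambda>f. (f i, f j)) (Pi_pmf A d p) = pair_pmf (p i) (p j)"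
proof -
  have A: "A = insert i (insert j (A - {i, j}))" using assms by auto
  show ?thesis
    by (subst A, subst Pi_pmf_insert')
       (use assms in \<open>auto simp: Pi_pmf_insert' map_bind_pmf pair_pmf_def map_pmf_def bind_assoc_pmf
          bind_return_pmf simp del: insert_Diff_single intro!: bind_pmf_cong\<close>)
qed

lemma nn_integral_Pi_pmf_component:
  assumes "finite A" "i \<in> A"
  shows "(\<integral>\<^sup>+f. g (f i) \<partial>Pi_pmf A d p) = (\<integral>\<^sup>+x. g x \<partial>p i)"
proof -
  have "(\<integral>\<^sup>+f. g (f i) \<partial>Pi_pmf A d p) = (\<integral>\<^sup>+x. g x \<partial>map_pmf (\<lambda>f. f i) (Pi_pmf A d p))"
    by simp
  also have "map_pmf (\<lambda>f. f i) (Pi_pmf A d p) = p i"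
    using assms by (simp add: Pi_pmf_component)
  finally show ?thesis .
qed

lemma nn_integral_Pi_pmf_pair:
  assumes "finite A" "i \<in> A" "j \<in> A" "i \<noteq> j"
  shows "(\<integral>\<^sup>+f. g (f i) (f j) \<partial>Pi_pmf A d p) = (\<integral>\<^sup>+x. \<integral>\<^sup>+y. g x y \<partial>p j \<partial>p i)"
proof -
  have "(\<integral>\<^sup>+f. g (f i) (f j) \<partial>Pi_pmf A d p)
      = (\<integral>\<^sup>+xy. g (fst xy) (snd xy) \<partial>map_pmf (\<lambda>f. (f i, f j)) (Pi_pmf A d p))"
    by simp
  also have "\<dots> = (\<integral>\<^sup>+x. \<integral>\<^sup>+y. g x y \<partial>p j \<partial>p i)"
    by (subst map_pmf_Pi_pmf_pair[OF assms]) (simp add: nn_integral_pair_pmf')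
  finally show ?thesis .
qed

text \<open>Disintegration of \<open>p\<close> along \<open>h\<close>. The random superposition code
  is sampled in this order: first the fibre (the relay letter), then points in it (the source
  letters).\<close>

lemma bind_pmf_cond_fibre:
  "bind_pmf (map_pmf h p) (\<lambda>c. cond_pmf p {u. h u = c}) = p"
proof -
  have "bind_pmf (map_pmf h p) (\<lambda>c. cond_pmf p {u. c = h u}) = p"
    by (rule bind_cond_pmf_cancel) (auto simp: pmf_map measure_map_pmf vimage_def eq_commute)
  then show ?thesis by (simp add: eq_commute)
qed

section \<open>Information densities\<close>

text \<open>The output law given the value \<open>c\<close> of \<open>\<kappa>\<close>. For
  \<open>c\<close> outside the image of the support, \<open>cond_pmf\<close> is unspecified, but the
  result is still some pmf.\<close>

definition ref_law :: "('u \<Rightarrow> 'c) \<Rightarrow> ('u \<Rightarrow> 'y pmf) \<Rightarrow> 'u pmf \<Rightarrow> 'c \<Rightarrow> 'y pmf" where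
  "ref_law \<kappa> K P c = bind_pmf (cond_pmf P {u. \<kappa> u = c}) K"

definition dens :: "('u \<Rightarrow> 'c) \<Rightarrow> ('u \<Rightarrow> 'y pmf) \<Rightarrow> 'u pmf \<Rightarrow> 'u \<Rightarrow> 'y \<Rightarrow> real" where
  "dens \<kappa> K P u y = pmf (K u) y / pmf (ref_law \<kappa> K P (\<kappa> u)) y"

text \<open>For \<open>\<kappa> = snd\<close> on pairs this is \<open>I(X; Y | A)\<close>, for constant \<open>\<kappa>\<close> it is \<open>I(X A; Y)\<close>.\<close>
definition info :: "('u \<Rightarrow> 'c) \<Rightarrow> ('u \<Rightarrow> 'y pmf) \<Rightarrow> 'u pmf \<Rightarrow> real" where
  "info \<kappa> K P = measure_pmf.expectation (bind_pmf P (\<lambda>u. map_pmf (Pair u) (K u)))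
                   (\<lambda>(u, y). log 2 (dens \<kappa> K P u y))"

lemma dens_nonneg: "0 \<le> dens \<kappa> K P u y"
  by (simp add: dens_def)

lemma fibre_ne: "u \<in> set_pmf P \<Longrightarrow> set_pmf P \<inter> {v. \<kappa> v = \<kappa> u} \<noteq> {}"
  by auto

lemma dens_pos:
  assumes "u \<in> set_pmf P" "y \<in> set_pmf (K u)"
  shows "0 < dens \<kappa> K P u y"
proof -
  have "y \<in> set_pmf (ref_law \<kappa> K P (\<kappa> u))"
    unfolding ref_law_def using assms by (auto simp: set_cond_pmf[OF fibre_ne])
  then show ?thesis
    using assms by (simp add: dens_def pmf_positive)
qed

text \<open>The mean of \<open>pmf (K u) y\<close> over the fibre is the denominator of
  \<open>dens\<close>, so the ratio averages to 1, or to 0 where the denominator vanishes. As this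
  holds for each fixed \<open>y\<close>, it also applies when \<open>y\<close> was caused by another
  codeword, which is the situation of a false alarm.\<close>

lemma nn_integral_dens_le_1:
  assumes "c \<in> \<kappa> ` set_pmf P"
  shows "(\<integral>\<^sup>+u. ennreal (dens \<kappa> K P u y) \<partial>cond_pmf P {u. \<kappa> u = c}) \<le> 1"
proof -
  have ne: "set_pmf P \<inter> {v. \<kappa> v = c} \<noteq> {}" using assms by auto
  let ?q = "pmf (ref_law \<kappa> K P c) y"
  have "(\<integral>\<^sup>+u. ennreal (dens \<kappa> K P u y) \<partial>cond_pmf P {u. \<kappa> u = c})
      = (\<integral>\<^sup>+u. ennreal (pmf (K u) y) * ennreal (1 / ?q) \<partial>cond_pmf P {u. \<kappa> u = c})"
    by (rule nn_integral_cong_AE)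
       (auto simp: AE_measure_pmf_iff set_cond_pmf[OF ne] dens_def ennreal_mult'[symmetric])
  also have "\<dots> = ennreal ?q * ennreal (1 / ?q)"
    by (simp add: nn_integral_multc ref_law_def ennreal_pmf_bind)
  also have "\<dots> \<le> 1"
    by (simp add: ennreal_mult'[symmetric])
  finally show ?thesis .
qed

text \<open>The weight turns \<open>K u\<close> back into the reference law. Mass of the reference
  law outside the support of \<open>K u\<close> is lost, hence only an inequality; where the
  reference mass is 0, division by zero makes the weight 0, so the bound holds for every
  \<open>u\<close>.\<close>

lemma nn_integral_inverse_dens_le:
  fixes k :: "'y \<Rightarrow> ennreal"
  shows "(\<integral>\<^sup>+y. k y * ennreal (1 / dens \<kappa> K P u y) \<partial>measure_pmf (K u)) \<le> (\<integral>\<^sup>+y. k y \<partial>ref_law \<kappa> K P (\<kappa> u))"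
proof -
  have "ennreal (pmf (K u) y) * (k y * ennreal (1 / dens \<kappa> K P u y))
      \<le> ennreal (pmf (ref_law \<kappa> K P (\<kappa> u)) y) * k y" for y
  proof -
    have "ennreal (pmf (K u) y) * ennreal (1 / dens \<kappa> K P u y) \<le> ennreal (pmf (ref_law \<kappa> K P (\<kappa> u)) y)"
      by (subst ennreal_mult'[symmetric]) (auto simp: dens_def)
    then have "ennreal (pmf (K u) y) * ennreal (1 / dens \<kappa> K P u y) * k y
        \<le> ennreal (pmf (ref_law \<kappa> K P (\<kappa> u)) y) * k y"
      by (rule mult_right_mono) simp
    then show ?thesis by (simp add: mult_ac)
  qed
  then show ?thesis
    unfolding nn_integral_measure_pmf by (intro nn_integral_mono) auto
qed

text \<open>As a function of \<open>s\<close> the expectation is 1 at \<open>s = 0\<close> and has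
  there the derivative \<open>ln 2\<close> times \<open>T\<close> minus the mean of
  \<open>l\<close>, which is negative; so it drops below 1 just to the right of 0.\<close>

lemma chernoff_exponent:
  fixes p :: "'b pmf" and l :: "'b \<Rightarrow> real"
  assumes fin: "finite (set_pmf p)" and T: "T < measure_pmf.expectation p l"
  shows "\<exists>s>0. measure_pmf.expectation p (\<lambda>x. 2 powr (s * (T - l x))) < 1"
proof -
  define g where "g s = (\<Sum>x\<in>set_pmf p. pmf p x * 2 powr (s * (T - l x)))" for s
  have g: "measure_pmf.expectation p (\<lambda>x. 2 powr (s * (T - l x))) = g s" for s
    unfolding g_def by (subst integral_measure_pmf[OF fin]) auto
  have "(g has_real_derivative (\<Sum>x\<in>set_pmf p. pmf p x * (ln 2 * (T - l x)))) (at 0)"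
    unfolding g_def by (auto intro!: derivative_eq_intros sum.cong)
  moreover have "(\<Sum>x\<in>set_pmf p. pmf p x * (ln 2 * (T - l x))) = ln 2 * (T - measure_pmf.expectation p l)"
  proof -
    have E: "measure_pmf.expectation p l = (\<Sum>x\<in>set_pmf p. pmf p x * l x)"
      by (subst integral_measure_pmf[OF fin]) auto
    have one: "(\<Sum>x\<in>set_pmf p. pmf p x) = 1"
      by (rule sum_pmf_eq_1[OF fin]) simp
    have "(\<Sum>x\<in>set_pmf p. pmf p x * (ln 2 * (T - l x)))
        = ln 2 * ((\<Sum>x\<in>set_pmf p. pmf p x) * T - (\<Sum>x\<in>set_pmf p. pmf p x * l x))"
      by (simp add: sum_distrib_left sum_distrib_right sum_subtractf[symmetric] algebra_simps)
    then show ?thesis by (simp add: E one)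
  qed
  moreover have "ln 2 * (T - measure_pmf.expectation p l) < 0"
    using T by (simp add: mult_pos_neg)
  ultimately obtain e where e: "e > 0" "\<And>h. 0 < h \<Longrightarrow> h < e \<Longrightarrow> g (0 + h) < g 0"
    using DERIV_neg_dec_right[of g _ 0] by metis
  have "g 0 = 1"
    by (simp add: g_def sum_pmf_eq_1[OF fin])
  then have "g (e / 2) < 1"
    using e(2)[of "e / 2"] e(1) by simp
  then have "0 < e / 2 \<and> measure_pmf.expectation p (\<lambda>x. 2 powr (e / 2 * (T - l x))) < 1"
    using e(1) unfolding g by simp
  then show ?thesis by blast
qed

lemma nn_integral_pmf_less_imp_ex:
  assumes "(\<integral>\<^sup>+x. f x \<partial>measure_pmf p) < e"
  shows "\<exists>x\<in>set_pmf p. f x < e"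
proof (rule ccontr)
  assume "\<not> ?thesis"
  then have "(\<integral>\<^sup>+x. e \<partial>measure_pmf p) \<le> (\<integral>\<^sup>+x. f x \<partial>measure_pmf p)"
    by (intro nn_integral_mono_AE) (auto simp: AE_measure_pmf_iff not_less)
  then show False using assms by simp
qed

lemma nn_integral_pmf_swap:
  "(\<integral>\<^sup>+x. \<integral>\<^sup>+y. f x y \<partial>measure_pmf q \<partial>measure_pmf p) = (\<integral>\<^sup>+y. \<integral>\<^sup>+x. f x y \<partial>measure_pmf p \<partial>measure_pmf q)"
proof -
  have "(\<integral>\<^sup>+x. \<integral>\<^sup>+y. f x y \<partial>measure_pmf q \<partial>measure_pmf p)
      = (\<integral>\<^sup>+xy. f (fst xy) (snd xy) \<partial>map_pmf (\<lambda>(x, y). (y, x)) (pair_pmf q p))"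
    by (subst pair_commute_pmf[symmetric]) (simp add: nn_integral_pair_pmf')
  then show ?thesis
    by (simp add: nn_integral_pair_pmf' case_prod_unfold)
qed

section \<open>Threshold decoding of a random code\<close>

text \<open>Any index that passes the test will do, because the analysis counts ambiguity as an
  error. The default 0 keeps the result a message.\<close>

definition pick :: "nat \<Rightarrow> (nat \<Rightarrow> bool) \<Rightarrow> nat" where
  "pick M S = (if \<exists>i<M. S i then SOME i. i < M \<and> S i else 0)"

lemma pick_less: "0 < M \<Longrightarrow> pick M S < M"
  unfolding pick_def using someI_ex[of "\<lambda>i. i < M \<and> S i"] by auto

lemma pick_unique:
  assumes "t < M" "S t" "\<And>i. i < M \<Longrightarrow> i \<noteq> t \<Longrightarrow> \<not> S i"
  shows "pick M S = t"
  unfolding pick_def using assms someI_ex[of "\<lambda>i. i < M \<and> S i"] by (metis (mono_tags, lifting))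

lemma pick_error:
  assumes "t < M"
  shows "(of_bool (pick M S \<noteq> t) :: ennreal) \<le> of_bool (\<not> S t) + (\<Sum>i\<in>{..<M} - {t}. of_bool (S i))"
proof (cases "pick M S = t \<or> \<not> S t")
  case False
  then obtain i where i: "i < M" "i \<noteq> t" "S i"
    using pick_unique[of t M S] assms by auto
  have "(1 :: ennreal) = of_bool (S i)" using i by simp
  also have "\<dots> \<le> (\<Sum>i\<in>{..<M} - {t}. of_bool (S i))"
    using i by (intro member_le_sum) auto
  also have "\<dots> \<le> of_bool (\<not> S t) + (\<Sum>i\<in>{..<M} - {t}. of_bool (S i))"
    by simp
  finally show ?thesis using False by simp
qed auto

lemma prod_list_map2_nonneg:
  fixes d :: "'c \<Rightarrow> 'z \<Rightarrow> real"
  assumes "\<And>c z. 0 \<le> d c z"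
  shows "0 \<le> prod_list (map2 d cs zs)"
  by (rule prod_list_nonneg) (use assms in auto)

lemma ennreal_prod_list_map2:
  fixes d :: "'c \<Rightarrow> 'z \<Rightarrow> real"
  assumes "\<And>c z. 0 \<le> d c z"
  shows "ennreal (prod_list (map2 d cs zs)) = prod_list (map2 (\<lambda>c z. ennreal (d c z)) cs zs)"
proof (induction cs arbitrary: zs)
  case (Cons c cs)
  then show ?case
    using assms by (cases zs) (auto simp: ennreal_mult prod_list_map2_nonneg)
qed simp

lemma false_alarm_bound:
  fixes d :: "'c \<Rightarrow> 'z \<Rightarrow> real"
  assumes nonneg: "\<And>c z. 0 \<le> d c z"
    and mean: "(\<integral>\<^sup>+c. \<integral>\<^sup>+z. ennreal (d c z) \<partial>measure_pmf q \<partial>measure_pmf p) \<le> 1"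
  shows "(\<integral>\<^sup>+cs. \<integral>\<^sup>+zs. of_bool (2 powr (real n * T) \<le> prod_list (map2 d cs zs))
            \<partial>replicate_pmf n q \<partial>replicate_pmf n p) \<le> ennreal (2 powr (- real n * T))"
proof -
  have pt: "(of_bool (2 powr (real n * T) \<le> prod_list (map2 d cs zs)) :: ennreal)
      \<le> ennreal (2 powr (- real n * T)) * prod_list (map2 (\<lambda>c z. ennreal (d c z)) cs zs)" for cs zs
  proof (cases "2 powr (real n * T) \<le> prod_list (map2 d cs zs)")
    case True
    have "(1::real) = 2 powr (- real n * T) * 2 powr (real n * T)"
      by (simp add: powr_add[symmetric])
    also have "\<dots> \<le> 2 powr (- real n * T) * prod_list (map2 d cs zs)"
      using True by (intro mult_left_mono) auto
    finally show ?thesis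
      using True by (simp add: ennreal_prod_list_map2[OF nonneg, symmetric] ennreal_mult'[symmetric]
          prod_list_map2_nonneg[OF nonneg] del: ennreal_1 flip: ennreal_1)
  qed simp
  have "(\<integral>\<^sup>+cs. \<integral>\<^sup>+zs. of_bool (2 powr (real n * T) \<le> prod_list (map2 d cs zs))
            \<partial>replicate_pmf n q \<partial>replicate_pmf n p)
      \<le> (\<integral>\<^sup>+cs. \<integral>\<^sup>+zs. ennreal (2 powr (- real n * T)) * prod_list (map2 (\<lambda>c z. ennreal (d c z)) cs zs)
            \<partial>replicate_pmf n q \<partial>replicate_pmf n p)"
    by (intro nn_integral_mono pt)
  also have "\<dots> = ennreal (2 powr (- real n * T)) *
      (\<integral>\<^sup>+c. \<integral>\<^sup>+z. ennreal (d c z) \<partial>measure_pmf q \<partial>measure_pmf p) ^ n"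
    by (simp add: nn_integral_cmult nn_integral_replicate_prod_list)
  also have "\<dots> \<le> ennreal (2 powr (- real n * T)) * 1"
    by (intro mult_left_mono power_le_one mean) auto
  finally show ?thesis by simp
qed

text \<open>If the product of the ratios stays below \<open>2 powr (n * T)\<close>, the quotient of
  the two raised to the power \<open>s\<close> is at least 1. This quotient factors over the
  positions, so its mean is an \<open>n\<close>-th power.\<close>

lemma missed_detection_bound:
  fixes d :: "'c \<Rightarrow> 'z \<Rightarrow> real"
  assumes nonneg: "\<And>c z. 0 \<le> d c z"
    and pos: "\<And>c z. c \<in> set_pmf p \<Longrightarrow> z \<in> set_pmf q \<Longrightarrow> 0 < d c z"
    and s: "0 < s"
    and mean: "(\<integral>\<^sup>+c. \<integral>\<^sup>+z. ennreal (2 powr (s * (T - log 2 (d c z)))) \<partial>measure_pmf q \<partial>measure_pmf p)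
                \<le> ennreal \<rho>" and \<rho>: "0 \<le> \<rho>"
  shows "(\<integral>\<^sup>+cs. \<integral>\<^sup>+zs. of_bool (\<not> 2 powr (real n * T) \<le> prod_list (map2 d cs zs))
            \<partial>replicate_pmf n q \<partial>replicate_pmf n p) \<le> ennreal (\<rho> ^ n)"
proof -
  have prod: "prod_list (map2 (\<lambda>c z. 2 powr (s * (T - log 2 (d c z)))) cs zs)
        = (2 powr (real k * T) / prod_list (map2 d cs zs)) powr s \<and> 0 < prod_list (map2 d cs zs)"
    if "length cs = k" "length zs = k" "set cs \<subseteq> set_pmf p" "set zs \<subseteq> set_pmf q" for cs zs k
    using that
  proof (induction cs arbitrary: zs k)
    case (Cons c cs)
    from Cons.prems obtain z zs' k' where zs: "zs = z # zs'" and k: "k = Suc k'"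
      by (cases zs) auto
    have IH: "prod_list (map2 (\<lambda>c z. 2 powr (s * (T - log 2 (d c z)))) cs zs')
        = (2 powr (real k' * T) / prod_list (map2 d cs zs')) powr s" "0 < prod_list (map2 d cs zs')"
      using Cons.IH[of k' zs'] Cons.prems by (auto simp: zs k)
    have dp: "0 < d c z" using Cons.prems pos by (auto simp: zs)
    have "2 powr (s * (T - log 2 (d c z))) = (2 powr (T - log 2 (d c z))) powr s"
      by (simp add: powr_powr mult.commute)
    also have "2 powr (T - log 2 (d c z)) = 2 powr T / d c z"
      using dp by (simp add: powr_diff)
    finally have 1: "2 powr (s * (T - log 2 (d c z))) = (2 powr T / d c z) powr s" .
    have "(2 powr T / d c z) powr s * (2 powr (real k' * T) / prod_list (map2 d cs zs')) powr s
       = (2 powr T / d c z * (2 powr (real k' * T) / prod_list (map2 d cs zs'))) powr s"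
      by (rule powr_mult[symmetric])
    also have "2 powr T / d c z * (2 powr (real k' * T) / prod_list (map2 d cs zs'))
       = 2 powr (real k * T) / (d c z * prod_list (map2 d cs zs'))"
      by (simp add: k powr_add[symmetric] algebra_simps)
    finally show ?case using 1 IH dp by (simp add: zs)
  qed auto
  have pt: "(of_bool (\<not> 2 powr (real n * T) \<le> prod_list (map2 d cs zs)) :: ennreal)
      \<le> prod_list (map2 (\<lambda>c z. ennreal (2 powr (s * (T - log 2 (d c z))))) cs zs)"
    if "cs \<in> set_pmf (replicate_pmf n p)" "zs \<in> set_pmf (replicate_pmf n q)" for cs zs
  proof (cases "2 powr (real n * T) \<le> prod_list (map2 d cs zs)")
    case False
    have P: "prod_list (map2 (\<lambda>c z. 2 powr (s * (T - log 2 (d c z)))) cs zs)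
        = (2 powr (real n * T) / prod_list (map2 d cs zs)) powr s" "0 < prod_list (map2 d cs zs)"
      using prod[of cs n zs] that by (auto simp: set_replicate_pmf lists_eq_set)
    have "1 \<le> (2 powr (real n * T) / prod_list (map2 d cs zs)) powr s"
      using False P(2) s by (intro ge_one_powr_ge_zero) (auto simp: field_simps)
    then show ?thesis
      using False by (simp add: ennreal_prod_list_map2[symmetric] P(1) del: ennreal_1 flip: ennreal_1)
  qed simp
  have "(\<integral>\<^sup>+cs. \<integral>\<^sup>+zs. of_bool (\<not> 2 powr (real n * T) \<le> prod_list (map2 d cs zs))
            \<partial>replicate_pmf n q \<partial>replicate_pmf n p)
      \<le> (\<integral>\<^sup>+cs. \<integral>\<^sup>+zs. prod_list (map2 (\<lambda>c z. ennreal (2 powr (s * (T - log 2 (d c z))))) cs zs)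
            \<partial>replicate_pmf n q \<partial>replicate_pmf n p)"
    by (intro nn_integral_mono_AE AE_pmfI pt)
  also have "\<dots> = (\<integral>\<^sup>+c. \<integral>\<^sup>+z. ennreal (2 powr (s * (T - log 2 (d c z)))) \<partial>measure_pmf q \<partial>measure_pmf p) ^ n"
    by (simp add: nn_integral_replicate_prod_list)
  also have "\<dots> \<le> ennreal \<rho> ^ n"
    by (intro power_mono mean) auto
  finally show ?thesis using \<rho> by (simp add: ennreal_power)
qed

text \<open>Here \<open>c\<close> holds all codebook letters at one time, and \<open>d i c z\<close>
  is the ratio of hypothesis \<open>i\<close> at the output caused by the true index
  \<open>t\<close>. The codebook is part of the randomness, so the bound is an average over
  codebooks and noise.\<close>

lemma random_decoding_error:
  fixes d :: "nat \<Rightarrow> 'c \<Rightarrow> 'z \<Rightarrow> real"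
  assumes nonneg: "\<And>i c z. 0 \<le> d i c z"
    and pos: "\<And>c z. c \<in> set_pmf p \<Longrightarrow> z \<in> set_pmf q \<Longrightarrow> 0 < d t c z"
    and t: "t < M" and s: "0 < s" and \<rho>: "0 \<le> \<rho>"
    and true: "(\<integral>\<^sup>+c. \<integral>\<^sup>+z. ennreal (2 powr (s * (T - log 2 (d t c z)))) \<partial>measure_pmf q \<partial>measure_pmf p)
                \<le> ennreal \<rho>"
    and false: "\<And>i. i < M \<Longrightarrow> i \<noteq> t \<Longrightarrow>
                 (\<integral>\<^sup>+c. \<integral>\<^sup>+z. ennreal (d i c z) \<partial>measure_pmf q \<partial>measure_pmf p) \<le> 1"
  shows "(\<integral>\<^sup>+cs. \<integral>\<^sup>+zs. of_bool (pick M (\<lambda>i. 2 powr (real n * T) \<le> prod_list (map2 (d i) cs zs)) \<noteq> t)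
            \<partial>replicate_pmf n q \<partial>replicate_pmf n p)
         \<le> ennreal (\<rho> ^ n + real M * 2 powr (- real n * T))"
proof -
  let ?S = "\<lambda>cs zs i. 2 powr (real n * T) \<le> prod_list (map2 (d i) cs zs)"
  have "(\<integral>\<^sup>+cs. \<integral>\<^sup>+zs. of_bool (pick M (?S cs zs) \<noteq> t) \<partial>replicate_pmf n q \<partial>replicate_pmf n p)
    \<le> (\<integral>\<^sup>+cs. \<integral>\<^sup>+zs. (of_bool (\<not> ?S cs zs t) + (\<Sum>i\<in>{..<M} - {t}. of_bool (?S cs zs i)))
         \<partial>replicate_pmf n q \<partial>replicate_pmf n p)"
    by (intro nn_integral_mono pick_error t)
  also have "\<dots> = (\<integral>\<^sup>+cs. \<integral>\<^sup>+zs. of_bool (\<not> ?S cs zs t) \<partial>replicate_pmf n q \<partial>replicate_pmf n p)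
      + (\<Sum>i\<in>{..<M} - {t}. \<integral>\<^sup>+cs. \<integral>\<^sup>+zs. of_bool (?S cs zs i) \<partial>replicate_pmf n q \<partial>replicate_pmf n p)"
    by (simp add: nn_integral_add nn_integral_sum del: sum_of_bool_eq sum_of_bool_mult_eq)
  also have "\<dots> \<le> ennreal (\<rho> ^ n) + (\<Sum>i\<in>{..<M} - {t}. ennreal (2 powr (- real n * T)))"
    by (intro add_mono sum_mono missed_detection_bound[OF nonneg pos s true \<rho>]
         false_alarm_bound[OF nonneg] false) auto
  also have "\<dots> \<le> ennreal (\<rho> ^ n) + (\<Sum>i\<in>{..<M}. ennreal (2 powr (- real n * T)))"
    by (intro add_left_mono sum_mono2) auto
  also have "\<dots> = ennreal (\<rho> ^ n + real M * 2 powr (- real n * T))"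
    using \<rho> by (simp add: sum_constant ennreal_mult ennreal_of_nat_eq_real_of_nat)
  finally show ?thesis .
qed

section \<open>The random code\<close>

text \<open>Superposition at a single time: the relay letter \<open>a\<close> is the cloud centre,
  and the \<open>M\<close> source letters are drawn independently given it. A codebook is a list of
  columns over time instead of a family of codewords, so that its law is a
  \<open>replicate_pmf\<close>.\<close>

definition code_row :: "nat \<Rightarrow> ('x \<times> 'a) pmf \<Rightarrow> ('a \<times> (nat \<Rightarrow> 'x)) pmf" where
  "code_row M P = bind_pmf (map_pmf snd P) (\<lambda>a. map_pmf (Pair a)
     (Pi_pmf {..<M} undefined (\<lambda>_. map_pmf fst (cond_pmf P {u. snd u = a}))))"

definition code_col :: "nat \<Rightarrow> ('x \<times> 'a) pmf \<Rightarrow> (nat \<Rightarrow> 'a \<times> (nat \<Rightarrow> 'x)) pmf" where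
  "code_col M P = Pi_pmf {..<M} undefined (\<lambda>_. code_row M P)"

text \<open>Here \<open>w\<close> is the previous message, which the relay sends, and \<open>w'\<close> the new message of the source.\<close>
definition letter :: "nat \<Rightarrow> nat \<Rightarrow> (nat \<Rightarrow> 'a \<times> (nat \<Rightarrow> 'x)) \<Rightarrow> 'x \<times> 'a" where
  "letter w w' c = (snd (c w) w', fst (c w))"

lemma nn_integral_fst_cond:
  assumes "a \<in> snd ` set_pmf P"
  shows "(\<integral>\<^sup>+x. f (x, a) \<partial>map_pmf fst (cond_pmf P {u. snd u = a})) = (\<integral>\<^sup>+u. f u \<partial>cond_pmf P {u. snd u = a})"
proof -
  have ne: "set_pmf P \<inter> {u. snd u = a} \<noteq> {}" using assms by auto
  show ?thesis
    by (simp, rule nn_integral_cong_AE) (auto simp: AE_measure_pmf_iff set_cond_pmf[OF ne])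
qed

lemma nn_integral_cond_fibre:
  "(\<integral>\<^sup>+a. \<integral>\<^sup>+u. f u \<partial>cond_pmf P {u. h u = a} \<partial>map_pmf h P) = (\<integral>\<^sup>+u. f u \<partial>measure_pmf P)"
  by (subst (2) bind_pmf_cond_fibre[of h P, symmetric], subst nn_integral_bind_pmf) simp

lemma nn_integral_row_letter:
  assumes "i < M"
  shows "(\<integral>\<^sup>+r. f (snd r i, fst r) \<partial>code_row M P) = (\<integral>\<^sup>+u. f u \<partial>measure_pmf P)"
proof -
  have "(\<integral>\<^sup>+r. f (snd r i, fst r) \<partial>code_row M P)
      = (\<integral>\<^sup>+a. \<integral>\<^sup>+x. f (x, a) \<partial>map_pmf fst (cond_pmf P {u. snd u = a}) \<partial>map_pmf snd P)"
    unfolding code_row_def nn_integral_bind_pmf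
    by (subst nn_integral_map_pmf, simp only: fst_conv snd_conv,
        subst nn_integral_Pi_pmf_component) (use assms in auto)
  also have "\<dots> = (\<integral>\<^sup>+a. \<integral>\<^sup>+u. f u \<partial>cond_pmf P {u. snd u = a} \<partial>map_pmf snd P)"
    by (intro nn_integral_cong_AE AE_pmfI nn_integral_fst_cond) auto
  finally show ?thesis by (simp only: nn_integral_cond_fibre)
qed

text \<open>Distinct source letters of one row share only \<open>a\<close> and are independent given
  it, so they are two draws from the same fibre of \<open>P\<close>.\<close>

lemma nn_integral_row_letter_pair:
  assumes "i < M" "j < M" "i \<noteq> j"
  shows "(\<integral>\<^sup>+r. f (snd r i, fst r) (snd r j, fst r) \<partial>code_row M P)
       = (\<integral>\<^sup>+a. \<integral>\<^sup>+u. \<integral>\<^sup>+v. f u v \<partial>cond_pmf P {u. snd u = a} \<partial>cond_pmf P {u. snd u = a} \<partial>map_pmf snd P)"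
proof -
  have "(\<integral>\<^sup>+r. f (snd r i, fst r) (snd r j, fst r) \<partial>code_row M P)
      = (\<integral>\<^sup>+a. \<integral>\<^sup>+x. \<integral>\<^sup>+y. f (x, a) (y, a) \<partial>map_pmf fst (cond_pmf P {u. snd u = a})
           \<partial>map_pmf fst (cond_pmf P {u. snd u = a}) \<partial>map_pmf snd P)"
    unfolding code_row_def nn_integral_bind_pmf
    by (subst nn_integral_map_pmf, simp only: fst_conv snd_conv,
        subst nn_integral_Pi_pmf_pair[where i = i and j = j]) (use assms in auto)
  also have "\<dots> = (\<integral>\<^sup>+a. \<integral>\<^sup>+u. \<integral>\<^sup>+v. f u v \<partial>cond_pmf P {u. snd u = a} \<partial>cond_pmf P {u. snd u = a} \<partial>map_pmf snd P)"
  proof (intro nn_integral_cong_AE AE_pmfI)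
    fix a assume "a \<in> set_pmf (map_pmf snd P)"
    then have a: "a \<in> snd ` set_pmf P" by simp
    show "(\<integral>\<^sup>+x. \<integral>\<^sup>+y. f (x, a) (y, a) \<partial>map_pmf fst (cond_pmf P {u. snd u = a})
           \<partial>map_pmf fst (cond_pmf P {u. snd u = a}))
        = (\<integral>\<^sup>+u. \<integral>\<^sup>+v. f u v \<partial>cond_pmf P {u. snd u = a} \<partial>cond_pmf P {u. snd u = a})"
      by (simp only: nn_integral_fst_cond[OF a, of "\<lambda>u. f _ u"]
           nn_integral_fst_cond[OF a, of "\<lambda>u. \<integral>\<^sup>+v. f u v \<partial>cond_pmf P {u. snd u = a}"])
  qed
  finally show ?thesis .
qed

lemma nn_integral_letter:
  assumes "w < M" "w' < M"
  shows "(\<integral>\<^sup>+c. f (letter w w' c) \<partial>code_col M P) = (\<integral>\<^sup>+u. f u \<partial>measure_pmf P)"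
  unfolding code_col_def letter_def
  by (subst nn_integral_Pi_pmf_component[where g = "\<lambda>r. f (snd r w', fst r)"])
     (use assms in \<open>auto simp: nn_integral_row_letter\<close>)

text \<open>The letter has law \<open>P\<close>, so the indicator of the complement of the support
  integrates to 0.\<close>

lemma letter_in_set:
  assumes "w < M" "w' < M" "c \<in> set_pmf (code_col M P)"
  shows "letter w w' c \<in> set_pmf P"
proof -
  have "(\<integral>\<^sup>+c. indicator (- set_pmf P) (letter w w' c) \<partial>code_col M P) = 0"
    by (subst nn_integral_letter[OF assms(1,2)]) (subst nn_integral_0_iff_AE, auto simp: AE_measure_pmf_iff)
  then have "AE c in measure_pmf (code_col M P). indicator (- set_pmf P) (letter w w' c) = (0 :: ennreal)"
    by (subst (asm) nn_integral_0_iff_AE) auto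
  then show ?thesis using assms(3) by (auto simp: AE_measure_pmf_iff indicator_eq_0_iff)
qed

text \<open>The relay knows \<open>w\<close> and tests \<open>i\<close> in place of
  \<open>w'\<close>. Both letters lie in one row; given the relay letter, the wrong one is a fresh
  draw independent of the output, so the bound for a fixed output applies.\<close>

lemma nn_integral_dens_same_row:
  assumes "w < M" "w' < M" "i < M" "i \<noteq> w'"
  shows "(\<integral>\<^sup>+c. \<integral>\<^sup>+z. ennreal (dens snd K P (letter w i c) (F (letter w w' c) z))
            \<partial>measure_pmf Z \<partial>code_col M P) \<le> 1"
proof -
  let ?c = "\<lambda>a. measure_pmf (cond_pmf P {u. snd u = a})"
  let ?f = "\<lambda>u v. \<integral>\<^sup>+z. ennreal (dens snd K P v (F u z)) \<partial>measure_pmf Z"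
  have "(\<integral>\<^sup>+c. ?f (letter w w' c) (letter w i c) \<partial>code_col M P)
      = (\<integral>\<^sup>+r. ?f (snd r w', fst r) (snd r i, fst r) \<partial>code_row M P)"
    unfolding code_col_def letter_def
    by (subst nn_integral_Pi_pmf_component[where g = "\<lambda>r. ?f (snd r w', fst r) (snd r i, fst r)"])
       (use assms in auto)
  also have "\<dots> = (\<integral>\<^sup>+a. \<integral>\<^sup>+u. \<integral>\<^sup>+v. ?f u v \<partial>?c a \<partial>?c a \<partial>map_pmf snd P)"
    by (rule nn_integral_row_letter_pair[where f = ?f]) (use assms in auto)
  also have "\<dots> = (\<integral>\<^sup>+a. \<integral>\<^sup>+u. \<integral>\<^sup>+z. \<integral>\<^sup>+v. ennreal (dens snd K P v (F u z)) \<partial>?c a \<partial>measure_pmf Z \<partial>?c a \<partial>map_pmf snd P)"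
    by (subst nn_integral_pmf_swap) simp
  also have "\<dots> \<le> (\<integral>\<^sup>+a. \<integral>\<^sup>+u. \<integral>\<^sup>+z. 1 \<partial>measure_pmf Z \<partial>?c a \<partial>map_pmf snd P)"
    by (rule nn_integral_mono_AE, rule AE_pmfI, intro nn_integral_mono nn_integral_dens_le_1) auto
  also have "\<dots> = 1" by simp
  finally show ?thesis .
qed

text \<open>The destination knows \<open>w'\<close> and tests \<open>i\<close> in place of
  \<open>w\<close>. Rows are independent, relay letter included, so the whole wrong pair is a fresh
  draw from \<open>P\<close> and the unconditional density is the right one.\<close>

lemma nn_integral_dens_other_row:
  assumes "w < M" "w' < M" "i < M" "i \<noteq> w"
  shows "(\<integral>\<^sup>+c. \<integral>\<^sup>+z. ennreal (dens (\<lambda>_. ()) K P (letter i w' c) (F (letter w w' c) z))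
            \<partial>measure_pmf Z \<partial>code_col M P) \<le> 1"
proof -
  let ?d = "dens (\<lambda>_. ()) K P"
  let ?f = "\<lambda>u v. \<integral>\<^sup>+z. ennreal (?d v (F u z)) \<partial>measure_pmf Z"
  have cP: "cond_pmf P UNIV = P"
    by (rule pmf_eqI) (simp add: pmf_cond set_pmf_not_empty)
  have "(\<integral>\<^sup>+c. ?f (letter w w' c) (letter i w' c) \<partial>code_col M P)
      = (\<integral>\<^sup>+r. \<integral>\<^sup>+r'. ?f (snd r w', fst r) (snd r' w', fst r') \<partial>code_row M P \<partial>code_row M P)"
    unfolding code_col_def letter_def
    by (subst nn_integral_Pi_pmf_pair[where g = "\<lambda>r r'. ?f (snd r w', fst r) (snd r' w', fst r')"])
       (use assms in auto)
  also have "\<dots> = (\<integral>\<^sup>+r. \<integral>\<^sup>+v. ?f (snd r w', fst r) v \<partial>measure_pmf P \<partial>code_row M P)"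
    using assms by (intro nn_integral_cong nn_integral_row_letter) auto
  also have "\<dots> = (\<integral>\<^sup>+u. \<integral>\<^sup>+v. ?f u v \<partial>measure_pmf P \<partial>measure_pmf P)"
    using assms by (intro nn_integral_row_letter) auto
  also have "\<dots> = (\<integral>\<^sup>+u. \<integral>\<^sup>+z. \<integral>\<^sup>+v. ennreal (?d v (F u z)) \<partial>measure_pmf P \<partial>measure_pmf Z \<partial>measure_pmf P)"
    by (subst nn_integral_pmf_swap) simp
  also have "\<dots> \<le> (\<integral>\<^sup>+u. \<integral>\<^sup>+z. 1 \<partial>measure_pmf Z \<partial>measure_pmf P)"
    using nn_integral_dens_le_1[of "()" "\<lambda>_. ()" P K] set_pmf_not_empty[of P]
    by (intro nn_integral_mono) (auto simp: cP)
  also have "\<dots> = 1" by simp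
  finally show ?thesis .
qed

section \<open>Memoryless relaying and block Markov coding\<close>

text \<open>After one step the strategy is replaced by the one that has the first output already fed
  in. Recording inputs with noise instead of outputs lets the outputs of both receivers be read off
  from one run by \<open>map (case_prod F)\<close>.\<close>

fun relay_run :: "('x \<times> 'a \<Rightarrow> 'z \<Rightarrow> 'y) \<Rightarrow> ('y list \<Rightarrow> 'a) \<Rightarrow> 'x list \<Rightarrow> 'z list \<Rightarrow> (('x \<times> 'a) \<times> 'z) list" where
  "relay_run F r (x # xs) (z # zs) =
     ((x, r []), z) # relay_run F (\<lambda>ys. r (F (x, r []) z # ys)) xs zs"
| "relay_run F r xs zs = []"

lemma length_relay_run [simp]: "length (relay_run F r xs zs) = min (length xs) (length zs)"
  by (induction F r xs zs rule: relay_run.induct) auto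

lemma relay_run_append:
  assumes "length xs = length zs"
  shows "relay_run F r (xs @ xs') (zs @ zs') = relay_run F r xs zs @
           relay_run F (\<lambda>ys. r (map (case_prod F) (relay_run F r xs zs) @ ys)) xs' zs'"
  using assms
proof (induction xs arbitrary: zs r)
  case (Cons x xs)
  then show ?case by (cases zs) auto
qed auto

lemma relay_run_prescribed:
  assumes "length xs = n" "length as = n" "length zs = n"
    and "\<And>ys. length ys < n \<Longrightarrow> r ys = as ! length ys"
  shows "relay_run F r xs zs = zip (zip xs as) zs"
  using assms
proof (induction xs arbitrary: as zs r n)
  case (Cons x xs)
  then obtain a as' z zs' n' where [simp]: "as = a # as'" "zs = z # zs'" "n = Suc n'"
    by (cases as; cases zs; cases n) auto
  have "r [] = a" using Cons.prems(4)[of "[]"] by simp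
  moreover have "relay_run F (\<lambda>ys. r (F (x, a) z # ys)) xs zs' = zip (zip xs as') zs'"
    using Cons.prems by (intro Cons.IH[of n']) auto
  ultimately show ?case by simp
qed auto

definition map_channel :: "('x \<times> 'a \<Rightarrow> 'z \<Rightarrow> 'y) \<Rightarrow> 'x list \<times> 'a list \<Rightarrow> 'z list \<Rightarrow> 'y list" where
  "map_channel F u zs = map2 F (zip (fst u) (snd u)) zs"

text \<open>A relay that fixes its next \<open>n\<close> letters at the start of a block, from
  completed blocks only, runs a relay channel whose letters are codewords. This lifts the analysis
  from single letters to blocks of \<open>n\<close> letters.\<close>

lemma relay_run_concat:
  fixes F :: "'x \<times> 'a \<Rightarrow> 'z \<Rightarrow> 'y"
  assumes "length xss = length zss"
    and "\<And>xs. xs \<in> set xss \<Longrightarrow> length xs = n" "\<And>zs. zs \<in> set zss \<Longrightarrow> length zs = n"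
    and "\<And>yss. length (R yss) = n"
    and "\<And>yss ys. (\<And>y. y \<in> set yss \<Longrightarrow> length y = n) \<Longrightarrow> length ys < n \<Longrightarrow>
           r (concat yss @ ys) = R yss ! length ys"
  shows "relay_run F r (concat xss) (concat zss) =
     concat (map (\<lambda>((xs, as), zs). zip (zip xs as) zs) (relay_run (map_channel F) R xss zss))"
  using assms
proof (induction xss arbitrary: zss r R)
  case (Cons xs xss)
  then obtain zs zss' where [simp]: "zss = zs # zss'" by (cases zss) auto
  have len: "length xs = n" "length zs = n" "length (R []) = n"
    using Cons.prems by auto
  have first: "relay_run F r xs zs = zip (zip xs (R [])) zs"
    using Cons.prems(5)[of "[]"] len by (intro relay_run_prescribed[of _ n]) auto
  have out: "map (case_prod F) (relay_run F r xs zs) = map_channel F (xs, R []) zs"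
    by (simp add: first map_channel_def)
  have "relay_run F (\<lambda>ys. r (map_channel F (xs, R []) zs @ ys)) (concat xss) (concat zss')
      = concat (map (\<lambda>((xs, as), zs). zip (zip xs as) zs)
          (relay_run (map_channel F) (\<lambda>yss. R (map_channel F (xs, R []) zs # yss)) xss zss'))"
  proof (rule Cons.IH)
    fix yss :: "'y list list" and ys :: "'y list"
    assume *: "\<And>y. y \<in> set yss \<Longrightarrow> length y = n" "length ys < n"
    show "r (map_channel F (xs, R []) zs @ concat yss @ ys) = R (map_channel F (xs, R []) zs # yss) ! length ys"
    proof -
      have "length y = n" if "y \<in> set (map_channel F (xs, R []) zs # yss)" for y
        using that * len by (auto simp: map_channel_def)
      from Cons.prems(5)[of "map_channel F (xs, R []) zs # yss" ys, OF this *(2)] show ?thesis by simp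
    qed
  qed (use Cons.prems in auto)
  then show ?case
    by (simp add: relay_run_append len first[symmetric] out)
qed auto

text \<open>An incomplete trailing block is dropped, so in the middle of a block the relay still
  sees only the earlier ones.\<close>

definition chunks :: "nat \<Rightarrow> 'b list \<Rightarrow> 'b list list" where
  "chunks n ys = map (\<lambda>b. take n (drop (b * n) ys)) [0..<length ys div n]"

lemma chunks_append:
  assumes "\<And>y. y \<in> set yss \<Longrightarrow> length y = n" "length ys < n"
  shows "chunks n (concat yss @ ys) = yss" "length (concat yss @ ys) mod n = length ys"
    "drop (n * length yss) (concat yss @ ys) = ys"
proof -
  have len: "length (concat yss) = length yss * n"
    using assms(1) by (induction yss) auto
  have n: "0 < n" using assms(2) by simp
  show "length (concat yss @ ys) mod n = length ys"
    using assms(2) by (simp add: len)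
  show "drop (n * length yss) (concat yss @ ys) = ys"
    by (simp add: len mult.commute)
  have "take n (drop (b * n) (concat yss @ ys)) = yss ! b" if "b < length yss" for b
    using that assms(1)
  proof (induction yss arbitrary: b)
    case (Cons y yss)
    then show ?case by (cases b) auto
  qed simp
  then have "map (\<lambda>b. take n (drop (b * n) (concat yss @ ys))) [0..<length yss] = yss"
    by (intro nth_equalityI) auto
  then show "chunks n (concat yss @ ys) = yss"
    using assms(2) n by (simp add: chunks_def len)
qed

section \<open>Backward decoding over a sequence of blocks\<close>

fun markov_inputs :: "(nat \<Rightarrow> nat \<Rightarrow> 'x) \<Rightarrow> nat \<Rightarrow> nat list \<Rightarrow> 'x list" where
  "markov_inputs \<xi> w (w' # ws) = \<xi> w w' # markov_inputs \<xi> w' ws"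
| "markov_inputs \<xi> w [] = []"

lemma length_markov_inputs [simp]: "length (markov_inputs \<xi> w ws) = length ws"
  by (induction ws arbitrary: w) auto

text \<open>Each test is judged with the true neighbouring message, as if a genie supplied
  \<open>w\<close> to the relay and \<open>w'\<close> to the destination. For fixed messages the
  event of one block then depends on the noise of that block only, and errors cannot
  propagate.\<close>

fun all_decoded :: "(nat \<Rightarrow> nat \<Rightarrow> 'z \<Rightarrow> bool) \<Rightarrow> nat \<Rightarrow> nat list \<Rightarrow> 'z list \<Rightarrow> bool" where
  "all_decoded ok w (w' # ws) (z # zs) \<longleftrightarrow> ok w w' z \<and> all_decoded ok w' ws zs"
| "all_decoded ok w ws zs \<longleftrightarrow> True"

text \<open>\<open>hd acc\<close> is the message just decoded from the following block, and the seed
  \<open>e\<close> is the new message of the last block. The result is one longer than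
  \<open>vs\<close>, because it also contains the message before the first block.\<close>

definition backward_decode :: "(nat \<Rightarrow> 'v \<Rightarrow> nat) \<Rightarrow> nat \<Rightarrow> 'v list \<Rightarrow> nat list" where
  "backward_decode \<delta> e vs = foldr (\<lambda>v acc. \<delta> (hd acc) v # acc) vs [e]"

text \<open>When all genie-aided tests succeed, the genie can be dismissed: the running decision
  \<open>foldl \<delta>2 w ys\<close> of the relay is the true message forward in time, and the head
  of the destination's list is the true one backward in time.\<close>

lemma backward_decode_correct:
  assumes "length ws = length zs"
    and "all_decoded (\<lambda>w w' z. \<delta>2 w (G2 (\<xi> w w', \<alpha> w) z) = w' \<and> \<delta>3 w' (G3 (\<xi> w w', \<alpha> w) z) = w) w ws zs"
  shows "backward_decode \<delta>3 (last (w # ws))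
      (map (case_prod G3) (relay_run G2 (\<lambda>ys. \<alpha> (foldl \<delta>2 w ys)) (markov_inputs \<xi> w ws) zs)) = w # ws"
  using assms
proof (induction ws arbitrary: w zs)
  case (Cons w' ws)
  then obtain z zs' where [simp]: "zs = z # zs'" by (cases zs) auto
  show ?case using Cons by (simp add: backward_decode_def split: if_splits)
qed (auto simp: backward_decode_def)

text \<open>Union bound over the blocks. One codebook \<open>c\<close> serves all of them, so their
  error events are dependent, which a union bound tolerates.\<close>

lemma nn_integral_not_all_decoded:
  assumes "\<And>w w'. w < M \<Longrightarrow> w' < M \<Longrightarrow>
      (\<integral>\<^sup>+c. \<integral>\<^sup>+z. of_bool (\<not> ok c w w' z) \<partial>measure_pmf Z \<partial>measure_pmf p) \<le> \<beta>"
    and "w < M" "set ws \<subseteq> {..<M}"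
  shows "(\<integral>\<^sup>+c. \<integral>\<^sup>+zs. of_bool (\<not> all_decoded (ok c) w ws zs) \<partial>replicate_pmf (length ws) Z \<partial>measure_pmf p)
           \<le> of_nat (length ws) * \<beta>"
  using assms(2,3)
proof (induction ws arbitrary: w)
  case (Cons w' ws)
  have "(\<integral>\<^sup>+c. \<integral>\<^sup>+zs. of_bool (\<not> all_decoded (ok c) w (w' # ws) zs)
          \<partial>replicate_pmf (length (w' # ws)) Z \<partial>measure_pmf p)
      = (\<integral>\<^sup>+c. \<integral>\<^sup>+z. \<integral>\<^sup>+zs. of_bool (\<not> all_decoded (ok c) w (w' # ws) (z # zs))
          \<partial>replicate_pmf (length ws) Z \<partial>measure_pmf Z \<partial>measure_pmf p)"
    by simp
  also have "\<dots> \<le> (\<integral>\<^sup>+c. \<integral>\<^sup>+z. \<integral>\<^sup>+zs. (of_bool (\<not> ok c w w' z) + of_bool (\<not> all_decoded (ok c) w' ws zs))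
          \<partial>replicate_pmf (length ws) Z \<partial>measure_pmf Z \<partial>measure_pmf p)"
    by (intro nn_integral_mono) auto
  also have "\<dots> = (\<integral>\<^sup>+c. \<integral>\<^sup>+z. of_bool (\<not> ok c w w' z) \<partial>measure_pmf Z \<partial>measure_pmf p)
      + (\<integral>\<^sup>+c. \<integral>\<^sup>+zs. of_bool (\<not> all_decoded (ok c) w' ws zs) \<partial>replicate_pmf (length ws) Z \<partial>measure_pmf p)"
    by (simp add: nn_integral_add)
  also have "\<dots> \<le> \<beta> + of_nat (length ws) * \<beta>"
    using Cons by (intro add_mono assms(1)) auto
  finally show ?case by (simp add: algebra_simps)
qed simp

lemma replicate_pmf_mult:
  "replicate_pmf (B * n) p = map_pmf concat (replicate_pmf B (replicate_pmf n p))"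
proof (induction B)
  case (Suc B)
  have "replicate_pmf (Suc B * n) p
      = bind_pmf (replicate_pmf n p) (\<lambda>xs. bind_pmf (replicate_pmf (B * n) p) (\<lambda>ys. return_pmf (xs @ ys)))"
    by (simp add: replicate_pmf_distrib[symmetric])
  then show ?case
    by (simp add: Suc map_bind_pmf bind_map_pmf)
qed simp

section \<open>Achievability\<close>

text \<open>The codeword letters at all times form one i.i.d. sequence of columns, so every
  expectation over the random code factors over time.\<close>

lemma ex_block_code:
  fixes P :: "('x \<times> 'a) pmf" and Z :: "'z pmf"
    and F2 :: "'x \<times> 'a \<Rightarrow> 'z \<Rightarrow> 'y" and F3 :: "'x \<times> 'a \<Rightarrow> 'z \<Rightarrow> 'v"
  defines "K2 \<equiv> \<lambda>u. map_pmf (F2 u) Z" and "K3 \<equiv> \<lambda>u. map_pmf (F3 u) Z"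
  assumes M: "0 < M" and \<rho>: "0 \<le> \<rho>" and s: "0 < s"
    and r2: "(\<integral>\<^sup>+u. \<integral>\<^sup>+z. ennreal (2 powr (s * (T - log 2 (dens snd K2 P u (F2 u z))))) \<partial>measure_pmf Z \<partial>measure_pmf P) \<le> ennreal \<rho>"
    and s': "0 < s'"
    and r3: "(\<integral>\<^sup>+u. \<integral>\<^sup>+z. ennreal (2 powr (s' * (T - log 2 (dens (\<lambda>_. ()) K3 P u (F3 u z))))) \<partial>measure_pmf Z \<partial>measure_pmf P) \<le> ennreal \<rho>"
    and small: "2 * real B * (\<rho> ^ n + real M * 2 powr (- real n * T)) < \<epsilon>"
    and msgs: "finite W" "W \<noteq> {}" "\<forall>ws\<in>W. length ws = B \<and> set ws \<subseteq> {..<M}"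
  shows "\<exists>\<alpha> \<xi> \<delta>2 \<delta>3.
      (\<forall>w<M. length (\<alpha> w) = n \<and> set (\<alpha> w) \<subseteq> snd ` set_pmf P) \<and>
      (\<forall>w<M. \<forall>w'<M. length (\<xi> w w') = n \<and> set (\<xi> w w') \<subseteq> fst ` set_pmf P) \<and>
      (\<forall>w ys. \<delta>2 w ys < M) \<and>
      measure_pmf.prob (pair_pmf (pmf_of_set W) (replicate_pmf B (replicate_pmf n Z)))
        {(ws, zss). \<not> all_decoded (\<lambda>w w' zs. \<delta>2 w (map_channel F2 (\<xi> w w', \<alpha> w) zs) = w' \<and>
                       \<delta>3 w' (map_channel F3 (\<xi> w w', \<alpha> w) zs) = w) 0 ws zss} < \<epsilon>"
proof -
  let ?C = "code_col M P"
  define \<alpha> where "\<alpha> cs w = map (\<lambda>c. fst (c w)) cs" for cs :: "(nat \<Rightarrow> 'a \<times> (nat \<Rightarrow> 'x)) list" and w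
  define \<xi> where "\<xi> cs w w' = map (\<lambda>c. snd (c w) w') cs" for cs :: "(nat \<Rightarrow> 'a \<times> (nat \<Rightarrow> 'x)) list" and w w'
  define \<delta>2 where "\<delta>2 cs w ys = pick M (\<lambda>i. 2 powr (real n * T) \<le>
      prod_list (map2 (\<lambda>c. dens snd K2 P (letter w i c)) cs ys))" for cs w ys
  define \<delta>3 where "\<delta>3 cs w' ys = pick M (\<lambda>i. 2 powr (real n * T) \<le>
      prod_list (map2 (\<lambda>c. dens (\<lambda>_. ()) K3 P (letter i w' c)) cs ys))" for cs w' ys
  define ok where "ok cs w w' zs \<longleftrightarrow> \<delta>2 cs w (map_channel F2 (\<xi> cs w w', \<alpha> cs w) zs) = w' \<and>
                       \<delta>3 cs w' (map_channel F3 (\<xi> cs w w', \<alpha> cs w) zs) = w" for cs w w' zs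
  define b where "b = \<rho> ^ n + real M * 2 powr (- real n * T)"
  have b0: "0 \<le> b" using \<rho> by (simp add: b_def)
  \<comment> \<open>With the codebook stored as columns, channel and test both act position by
    position, which brings the two error events into the form of
    \<open>random_decoding_error\<close>.\<close>
  have mc: "map_channel F (\<xi> cs w w', \<alpha> cs w) zs = map2 (\<lambda>c z. F (letter w w' c) z) cs zs"
    for F :: "'x \<times> 'a \<Rightarrow> 'z \<Rightarrow> 'q" and cs w w' zs
    by (simp add: map_channel_def \<xi>_def \<alpha>_def letter_def zip_map1 zip_map2 zip_same_conv_map split_def)
  have comp: "map2 f cs (map2 g cs zs) = map2 (\<lambda>c z. f c (g c z)) cs zs"
    for f :: "'c \<Rightarrow> 'q \<Rightarrow> real" and g :: "'c \<Rightarrow> 'z \<Rightarrow> 'q" and cs zs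
    by (rule nth_equalityI) auto
  have one: "(\<integral>\<^sup>+cs. \<integral>\<^sup>+zs. of_bool (\<not> ok cs w w' zs) \<partial>replicate_pmf n Z \<partial>replicate_pmf n ?C)
      \<le> ennreal (2 * b)" if w: "w < M" "w' < M" for w w'
  proof -
    have pos2: "0 < dens snd K2 P (letter w w' c) (F2 (letter w w' c) z)"
      and pos3: "0 < dens (\<lambda>_. ()) K3 P (letter w w' c) (F3 (letter w w' c) z)"
      if "c \<in> set_pmf ?C" "z \<in> set_pmf Z" for c z
      using that w by (auto intro!: dens_pos letter_in_set simp: K2_def K3_def)
    have "(\<integral>\<^sup>+cs. \<integral>\<^sup>+zs. of_bool (\<not> ok cs w w' zs) \<partial>replicate_pmf n Z \<partial>replicate_pmf n ?C)
       \<le> (\<integral>\<^sup>+cs. \<integral>\<^sup>+zs. (of_bool (\<delta>2 cs w (map_channel F2 (\<xi> cs w w', \<alpha> cs w) zs) \<noteq> w') +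
                       of_bool (\<delta>3 cs w' (map_channel F3 (\<xi> cs w w', \<alpha> cs w) zs) \<noteq> w))
             \<partial>replicate_pmf n Z \<partial>replicate_pmf n ?C)"
      unfolding ok_def by (intro nn_integral_mono) auto
    also have "\<dots> = (\<integral>\<^sup>+cs. \<integral>\<^sup>+zs. of_bool (\<delta>2 cs w (map_channel F2 (\<xi> cs w w', \<alpha> cs w) zs) \<noteq> w')
             \<partial>replicate_pmf n Z \<partial>replicate_pmf n ?C) +
        (\<integral>\<^sup>+cs. \<integral>\<^sup>+zs. of_bool (\<delta>3 cs w' (map_channel F3 (\<xi> cs w w', \<alpha> cs w) zs) \<noteq> w)
             \<partial>replicate_pmf n Z \<partial>replicate_pmf n ?C)"
      by (simp add: nn_integral_add)
    also have "\<dots> \<le> ennreal b + ennreal b"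
      unfolding \<delta>2_def \<delta>3_def mc comp b_def
    proof (intro add_mono)
      show "(\<integral>\<^sup>+cs. \<integral>\<^sup>+zs. of_bool (pick M (\<lambda>i. 2 powr (real n * T) \<le> prod_list
           (map2 (\<lambda>c z. dens snd K2 P (letter w i c) (F2 (letter w w' c) z)) cs zs)) \<noteq> w')
         \<partial>replicate_pmf n Z \<partial>replicate_pmf n ?C) \<le> ennreal (\<rho> ^ n + real M * 2 powr (- real n * T))"
        using w r2 pos2
        by (intro random_decoding_error[OF _ _ _ s \<rho>] dens_nonneg nn_integral_dens_same_row)
           (auto simp: nn_integral_letter[where f = "\<lambda>u. \<integral>\<^sup>+z. ennreal (2 powr (s * (T - log 2 (dens snd K2 P u (F2 u z))))) \<partial>measure_pmf Z"])
      show "(\<integral>\<^sup>+cs. \<integral>\<^sup>+zs. of_bool (pick M (\<lambda>i. 2 powr (real n * T) \<le> prod_list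
           (map2 (\<lambda>c z. dens (\<lambda>_. ()) K3 P (letter i w' c) (F3 (letter w w' c) z)) cs zs)) \<noteq> w)
         \<partial>replicate_pmf n Z \<partial>replicate_pmf n ?C) \<le> ennreal (\<rho> ^ n + real M * 2 powr (- real n * T))"
        using w r3 pos3
        by (intro random_decoding_error[OF _ _ _ s' \<rho>] dens_nonneg nn_integral_dens_other_row)
           (auto simp: nn_integral_letter[where f = "\<lambda>u. \<integral>\<^sup>+z. ennreal (2 powr (s' * (T - log 2 (dens (\<lambda>_. ()) K3 P u (F3 u z))))) \<partial>measure_pmf Z"])
    qed
    also have "\<dots> = ennreal (2 * b)" using b0 by (simp flip: ennreal_plus)
    finally show ?thesis .
  qed
  have "(\<integral>\<^sup>+cs. \<integral>\<^sup>+ws. \<integral>\<^sup>+zss. of_bool (\<not> all_decoded (ok cs) 0 ws zss)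
           \<partial>replicate_pmf B (replicate_pmf n Z) \<partial>pmf_of_set W \<partial>replicate_pmf n ?C)
      = (\<integral>\<^sup>+ws. \<integral>\<^sup>+cs. \<integral>\<^sup>+zss. of_bool (\<not> all_decoded (ok cs) 0 ws zss)
           \<partial>replicate_pmf B (replicate_pmf n Z) \<partial>replicate_pmf n ?C \<partial>pmf_of_set W)"
    by (rule nn_integral_pmf_swap)
  also have "\<dots> \<le> (\<integral>\<^sup>+ws. ennreal (real B * (2 * b)) \<partial>pmf_of_set W)"
  proof (rule nn_integral_mono_AE, rule AE_pmfI)
    fix ws assume "ws \<in> set_pmf (pmf_of_set W)"
    then have ws: "length ws = B" "set ws \<subseteq> {..<M}" using msgs by auto
    show "(\<integral>\<^sup>+cs. \<integral>\<^sup>+zss. of_bool (\<not> all_decoded (ok cs) 0 ws zss)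
           \<partial>replicate_pmf B (replicate_pmf n Z) \<partial>replicate_pmf n ?C) \<le> ennreal (real B * (2 * b))"
      using nn_integral_not_all_decoded[where ok = ok, OF one M ws(2)] b0
      by (simp add: ws(1) ennreal_mult ennreal_of_nat_eq_real_of_nat)
  qed
  also have "\<dots> < ennreal \<epsilon>"
    using small b0 by (simp add: b_def mult_ac ennreal_less_iff)
  \<comment> \<open>Some codebook is no worse than the average one. It can be fixed before the
    messages are drawn, since the average over messages is taken inside.\<close>
  finally obtain cs where cs: "cs \<in> set_pmf (replicate_pmf n ?C)"
    and less: "(\<integral>\<^sup>+ws. \<integral>\<^sup>+zss. of_bool (\<not> all_decoded (ok cs) 0 ws zss)
           \<partial>replicate_pmf B (replicate_pmf n Z) \<partial>pmf_of_set W) < ennreal \<epsilon>"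
    using nn_integral_pmf_less_imp_ex by blast
  have "(\<integral>\<^sup>+ws. \<integral>\<^sup>+zss. of_bool (\<not> all_decoded (ok cs) 0 ws zss)
           \<partial>replicate_pmf B (replicate_pmf n Z) \<partial>pmf_of_set W)
      = (\<integral>\<^sup>+\<omega>. indicator {(ws, zss). \<not> all_decoded (ok cs) 0 ws zss} \<omega>
          \<partial>pair_pmf (pmf_of_set W) (replicate_pmf B (replicate_pmf n Z)))"
    by (subst nn_integral_pair_pmf') (auto intro!: nn_integral_cong simp: indicator_def)
  also have "\<dots> = ennreal (measure_pmf.prob (pair_pmf (pmf_of_set W) (replicate_pmf B (replicate_pmf n Z)))
        {(ws, zss). \<not> all_decoded (ok cs) 0 ws zss})"
    by (simp add: measure_pmf.emeasure_eq_measure)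
  finally have err: "measure_pmf.prob (pair_pmf (pmf_of_set W) (replicate_pmf B (replicate_pmf n Z)))
        {(ws, zss). \<not> all_decoded (ok cs) 0 ws zss} < \<epsilon>"
    using less by (simp add: ennreal_less_iff)
  have len: "length cs = n" and csC: "set cs \<subseteq> set_pmf ?C"
    using cs by (auto simp: set_replicate_pmf)
  have 1: "length (\<alpha> cs w) = n \<and> set (\<alpha> cs w) \<subseteq> snd ` set_pmf P" if "w < M" for w
    using letter_in_set[OF that that] csC len by (force simp: \<alpha>_def letter_def)
  have 2: "length (\<xi> cs w w') = n \<and> set (\<xi> cs w w') \<subseteq> fst ` set_pmf P" if "w < M" "w' < M" for w w'
    using letter_in_set[OF that] csC len by (force simp: \<xi>_def letter_def)
  show ?thesis
    using 1 2 err unfolding ok_def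
    by (intro exI[of _ "\<alpha> cs"] exI[of _ "\<xi> cs"] exI[of _ "\<delta>2 cs"] exI[of _ "\<delta>3 cs"])
       (auto simp: \<delta>2_def pick_less M)
qed

lemma set_relay_run:
  "set (relay_run F r xs zs) \<subseteq> (set xs \<times> range r) \<times> set zs"
proof (induction F r xs zs rule: relay_run.induct)
  case (1 F r x xs z zs)
  then show ?case by fastforce
qed auto

lemma nn_integral_channel_expectation:
  fixes g :: "'u \<Rightarrow> 'y \<Rightarrow> real"
  assumes "finite (set_pmf P)" "finite (set_pmf Z)" "\<And>u y. 0 \<le> g u y"
  shows "(\<integral>\<^sup>+u. \<integral>\<^sup>+z. ennreal (g u (F u z)) \<partial>measure_pmf Z \<partial>measure_pmf P)
    = ennreal (measure_pmf.expectation (bind_pmf P (\<lambda>u. map_pmf (Pair u) (map_pmf (F u) Z))) (\<lambda>(u, y). g u y))"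
proof -
  let ?Q = "bind_pmf P (\<lambda>u. map_pmf (Pair u) (map_pmf (F u) Z))"
  have "finite (set_pmf ?Q)" using assms by auto
  then have "ennreal (measure_pmf.expectation ?Q (\<lambda>(u, y). g u y)) = (\<integral>\<^sup>+uy. ennreal (case uy of (u, y) \<Rightarrow> g u y) \<partial>?Q)"
    using assms(3) by (subst nn_integral_eq_integral) (auto intro: integrable_measure_pmf_finite)
  also have "\<dots> = (\<integral>\<^sup>+u. \<integral>\<^sup>+z. ennreal (g u (F u z)) \<partial>measure_pmf Z \<partial>measure_pmf P)"
    by simp
  finally show ?thesis by simp
qed

text \<open>Blocks of \<open>q * j\<close> letters with \<open>2 ^ (p * j)\<close> messages have
  rate exactly \<open>p / q\<close> for every \<open>j\<close>, so \<open>j\<close> can grow without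
  disturbing the rate. Of the \<open>Suc B\<close> blocks, \<open>B\<close> carry messages.\<close>

lemma ex_relay_code:
  fixes P :: "('x \<times> 'a) pmf" and Z :: "'z pmf"
    and F2 :: "'x \<times> 'a \<Rightarrow> 'z \<Rightarrow> 'y" and F3 :: "'x \<times> 'a \<Rightarrow> 'z \<Rightarrow> 'v"
  assumes fin: "finite (set_pmf P)" "finite (set_pmf Z)"
    and q: "0 < q" and \<epsilon>: "0 < \<epsilon>"
    and I2: "real p < real q * info snd (\<lambda>u. map_pmf (F2 u) Z) P"
    and I3: "real p < real q * info (\<lambda>_. ()) (\<lambda>u. map_pmf (F3 u) Z) P"
  shows "\<exists>j\<ge>1. \<exists>enc r dec.
      (\<forall>w<(2::nat) ^ (p * j * B). length (enc w) = Suc B * (q * j) \<and> set (enc w) \<subseteq> fst ` set_pmf P) \<and>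
      (\<forall>ys. r ys \<in> snd ` set_pmf P) \<and> (\<forall>vs. dec vs < (2::nat) ^ (p * j * B)) \<and>
      measure_pmf.prob (pair_pmf (pmf_of_set {..<2 ^ (p * j * B)}) (replicate_pmf (Suc B * (q * j)) Z))
        {(w, zs). dec (map (case_prod F3) (relay_run F2 r (enc w) zs)) \<noteq> w} \<le> \<epsilon>"
proof -
  let ?K2 = "\<lambda>u. map_pmf (F2 u) Z" and ?K3 = "\<lambda>u. map_pmf (F3 u) Z"
  let ?J = "\<lambda>K. bind_pmf P (\<lambda>u. map_pmf (Pair u) (K u))"
  \<comment> \<open>One threshold for both receivers: above the rate, so that false alarms vanish
    even when summed over all messages, and below both informations, so that the true codeword
    passes.\<close>
  obtain T where T: "real p / real q < T" "T < info snd ?K2 P" "T < info (\<lambda>_. ()) ?K3 P"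
    using dense[of "real p / real q" "min (info snd ?K2 P) (info (\<lambda>_. ()) ?K3 P)"] I2 I3 q
    by (auto simp: divide_less_eq mult.commute)
  obtain s2 where s2: "0 < s2"
    "measure_pmf.expectation (?J ?K2) (\<lambda>x. 2 powr (s2 * (T - (\<lambda>(u, y). log 2 (dens snd ?K2 P u y)) x))) < 1"
    using chernoff_exponent[of "?J ?K2" T "\<lambda>(u, y). log 2 (dens snd ?K2 P u y)"] T(2) fin
    by (auto simp: info_def)
  obtain s3 where s3: "0 < s3"
    "measure_pmf.expectation (?J ?K3) (\<lambda>x. 2 powr (s3 * (T - (\<lambda>(u, y). log 2 (dens (\<lambda>_. ()) ?K3 P u y)) x))) < 1"
    using chernoff_exponent[of "?J ?K3" T "\<lambda>(u, y). log 2 (dens (\<lambda>_. ()) ?K3 P u y)"] T(3) fin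
    by (auto simp: info_def)
  define e2 where "e2 = measure_pmf.expectation (?J ?K2) (\<lambda>(u, y). 2 powr (s2 * (T - log 2 (dens snd ?K2 P u y))))"
  define e3 where "e3 = measure_pmf.expectation (?J ?K3) (\<lambda>(u, y). 2 powr (s3 * (T - log 2 (dens (\<lambda>_. ()) ?K3 P u y))))"
  define \<rho> where "\<rho> = max e2 e3"
  have \<rho>1: "\<rho> < 1" using s2(2) s3(2) by (simp add: \<rho>_def e2_def e3_def split_def)
  have \<rho>0: "0 \<le> \<rho>"
    by (simp add: \<rho>_def e2_def e3_def split_def le_max_iff_disj Bochner_Integration.integral_nonneg)
  have r2: "(\<integral>\<^sup>+u. \<integral>\<^sup>+z. ennreal (2 powr (s2 * (T - log 2 (dens snd ?K2 P u (F2 u z))))) \<partial>measure_pmf Z \<partial>measure_pmf P) \<le> ennreal \<rho>"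
    by (subst nn_integral_channel_expectation[OF fin]) (auto simp: \<rho>_def e2_def intro!: ennreal_leI)
  have r3: "(\<integral>\<^sup>+u. \<integral>\<^sup>+z. ennreal (2 powr (s3 * (T - log 2 (dens (\<lambda>_. ()) ?K3 P u (F3 u z))))) \<partial>measure_pmf Z \<partial>measure_pmf P) \<le> ennreal \<rho>"
    by (subst nn_integral_channel_expectation[OF fin]) (auto simp: \<rho>_def e3_def intro!: ennreal_leI)
  \<comment> \<open>The bound of \<open>ex_block_code\<close> at block length \<open>q * j\<close>;
    both of its terms are geometric in \<open>j\<close>.\<close>
  define h where "h j = 2 * real (Suc B) * (\<rho> ^ (q * j) + real (2 ^ (p * j)) * 2 powr (- real (q * j) * T))" for j
  have "h \<longlonglongrightarrow> 2 * real (Suc B) * (0 + 0)"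
  proof -
    have "(\<lambda>j. (\<rho> ^ q) ^ j) \<longlonglongrightarrow> 0"
      using \<rho>0 \<rho>1 q by (intro LIMSEQ_realpow_zero) (auto simp: power_less_one_iff)
    moreover have "(\<lambda>j. (2 powr (real p - real q * T)) ^ j) \<longlonglongrightarrow> 0"
      using T(1) q by (intro LIMSEQ_realpow_zero) (auto simp: powr_less_one divide_less_eq mult.commute)
    moreover have "real (2 ^ (p * j)) * 2 powr (- real (q * j) * T) = (2 powr (real p - real q * T)) ^ j" for j
      by (simp add: powr_realpow[symmetric] powr_powr powr_add[symmetric] algebra_simps)
    ultimately show ?thesis
      unfolding h_def by (intro tendsto_intros) (auto simp: power_mult)
  qed
  then have "eventually (\<lambda>j. h j < \<epsilon>) sequentially"
    using \<epsilon> by (intro order_tendstoD) auto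
  then obtain j where j: "j \<ge> 1" "h j < \<epsilon>"
    by (metis (no_types, lifting) eventually_sequentially le_trans linorder_le_cases)
  define n M where "n = q * j" and "M = (2 ^ (p * j) :: nat)"
  have n: "0 < n" and M: "0 < M" using q j by (auto simp: n_def M_def)
  \<comment> \<open>The closing block carries the fixed message 0, the seed of backward
    decoding.\<close>
  define W where "W = (\<lambda>ms. ms @ [0]) ` {ms. set ms \<subseteq> {..<M} \<and> length ms = B}"
  have finW: "finite W" unfolding W_def by (intro finite_imageI finite_lists_length_eq) auto
  have cardW: "card W = 2 ^ (p * j * B)"
    unfolding W_def
    by (subst card_image) (auto simp: inj_on_def card_lists_length_eq M_def power_mult)
  then have neW: "W \<noteq> {}" by auto
  have W: "length ws = Suc B \<and> set ws \<subseteq> {..<M}" "last (0 # ws) = 0" if "ws \<in> W" for ws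
    using that M by (auto simp: W_def)
  then have Wb: "\<forall>ws\<in>W. length ws = Suc B \<and> set ws \<subseteq> {..<M}" by blast
  have small: "2 * real (Suc B) * (\<rho> ^ n + real M * 2 powr (- real n * T)) < \<epsilon>"
    using j(2) by (simp add: h_def n_def M_def)
  obtain \<alpha> \<xi> \<delta>2 \<delta>3 where
    A: "\<forall>w<M. length (\<alpha> w) = n \<and> set (\<alpha> w) \<subseteq> snd ` set_pmf P"
      "\<forall>w<M. \<forall>w'<M. length (\<xi> w w') = n \<and> set (\<xi> w w') \<subseteq> fst ` set_pmf P"
      "\<forall>w ys. \<delta>2 w ys < M" and
    err: "measure_pmf.prob (pair_pmf (pmf_of_set W) (replicate_pmf (Suc B) (replicate_pmf n Z)))
        {(ws, zss). \<not> all_decoded (\<lambda>w w' zs. \<delta>2 w (map_channel F2 (\<xi> w w', \<alpha> w) zs) = w' \<and>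
                       \<delta>3 w' (map_channel F3 (\<xi> w w', \<alpha> w) zs) = w) 0 ws zss} < \<epsilon>"
    using ex_block_code[OF M \<rho>0 s2(1) r2 s3(1) r3 small finW neW Wb]
    by (elim exE conjE) (rule that, assumption+)
  from A have
    \<alpha>: "\<And>w. w < M \<Longrightarrow> length (\<alpha> w) = n \<and> set (\<alpha> w) \<subseteq> snd ` set_pmf P" and
    \<xi>: "\<And>w w'. w < M \<Longrightarrow> w' < M \<Longrightarrow> length (\<xi> w w') = n \<and> set (\<xi> w w') \<subseteq> fst ` set_pmf P" and
    \<delta>2: "\<And>w ys. \<delta>2 w ys < M" by blast+
  obtain e where e: "bij_betw e W {..<(2::nat) ^ (p * j * B)}"
    using finite_same_card_bij[OF finW, of "{..<(2::nat) ^ (p * j * B)}"] cardW by auto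
  define R where "R yss = \<alpha> (foldl \<delta>2 0 yss)" for yss
  define r where "r ys = R (chunks n ys) ! (length ys mod n)" for ys
  define enc where "enc w = concat (markov_inputs \<xi> 0 (inv_into W e w))" for w
  \<comment> \<open>\<open>tl\<close> removes the initial message 0 that precedes the first block.
    The default 0 keeps the decision in the message range when decoding has gone wrong.\<close>
  define dec where "dec vs = (let ws = tl (backward_decode \<delta>3 0 (chunks n vs)) in
     if ws \<in> W then e ws else 0)" for vs
  have fold: "foldl \<delta>2 0 yss < M" for yss
    using M \<delta>2 by (induction yss rule: rev_induct) auto
  have R: "length (R yss) = n" "set (R yss) \<subseteq> snd ` set_pmf P" for yss
    using \<alpha>[OF fold] by (auto simp: R_def)
  have xin: "length xs = n \<and> set xs \<subseteq> fst ` set_pmf P"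
    if "xs \<in> set (markov_inputs \<xi> w ws)" "w < M" "set ws \<subseteq> {..<M}" for xs w ws
    using that
  proof (induction ws arbitrary: w)
    case (Cons w' ws)
    then show ?case using \<xi>[of w w'] by auto
  qed simp
  have enc: "length (enc w) = Suc B * n \<and> set (enc w) \<subseteq> fst ` set_pmf P" if "w < 2 ^ (p * j * B)" for w
  proof -
    have "inv_into W e w \<in> W" using e that by (metis bij_betw_def inv_into_into lessThan_iff)
    note ws = W(1)[OF this]
    have "length (concat xss) = length xss * n" if "\<And>xs. xs \<in> set xss \<Longrightarrow> length xs = n" for xss :: "'x list list"
      using that by (induction xss) auto
    then show ?thesis
      using xin[of _ 0 "inv_into W e w"] M ws by (fastforce simp: enc_def)
  qed
  have r: "r ys \<in> snd ` set_pmf P" for ys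
    using R[of "chunks n ys"] n nth_mem[of "length ys mod n" "R (chunks n ys)"] by (auto simp: r_def)
  have dec: "dec vs < 2 ^ (p * j * B)" for vs
    using e by (auto simp: dec_def Let_def bij_betw_def)
  have correct: "dec (map (case_prod F3) (relay_run F2 r (enc (e ws)) (concat zss))) = e ws"
    if ws: "ws \<in> W" and zss: "length zss = Suc B" "\<And>zs. zs \<in> set zss \<Longrightarrow> length zs = n"
      and ok: "all_decoded (\<lambda>w w' zs. \<delta>2 w (map_channel F2 (\<xi> w w', \<alpha> w) zs) = w' \<and>
                       \<delta>3 w' (map_channel F3 (\<xi> w w', \<alpha> w) zs) = w) 0 ws zss" for ws zss
  proof -
    let ?X = "markov_inputs \<xi> 0 ws"
    let ?run = "relay_run (map_channel F2) R ?X zss"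
    have "enc (e ws) = concat ?X"
      using e ws by (simp add: enc_def bij_betw_def)
    moreover have "relay_run F2 r (concat ?X) (concat zss) =
        concat (map (\<lambda>((xs, as), zs). zip (zip xs as) zs) ?run)"
    proof (rule relay_run_concat)
      fix yss :: "'y list list" and ys :: "'y list"
      assume "\<And>y. y \<in> set yss \<Longrightarrow> length y = n" "length ys < n"
      then show "r (concat yss @ ys) = R yss ! length ys"
        by (simp only: r_def chunks_append)
    qed (use zss W(1)[OF ws] xin[of _ 0 ws] M R in auto)
    moreover have "map (case_prod F3) (concat (map (\<lambda>((xs, as), zs). zip (zip xs as) zs) ?run))
        = concat (map (case_prod (map_channel F3)) ?run)"
      by (simp add: map_concat comp_def split_def map_channel_def)
    moreover have "chunks n (concat (map (case_prod (map_channel F3)) ?run) @ []) = map (case_prod (map_channel F3)) ?run"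
    proof (rule chunks_append)
      fix v assume "v \<in> set (map (case_prod (map_channel F3)) ?run)"
      then obtain xs as zs where "v = map_channel F3 (xs, as) zs" "((xs, as), zs) \<in> set ?run" by auto
      with set_relay_run[of "map_channel F2" R ?X zss] show "length v = n"
        using xin[of xs 0 ws] M W(1)[OF ws] zss(2)[of zs] R(1) by (auto simp: map_channel_def)
    qed (use n in simp)
    moreover have "backward_decode \<delta>3 0 (map (case_prod (map_channel F3)) ?run) = 0 # ws"
      using backward_decode_correct[OF _ ok] W[OF ws] zss(1) unfolding R_def by simp
    ultimately show ?thesis
      using ws by (simp add: dec_def)
  qed
  have "pair_pmf (pmf_of_set {..<2 ^ (p * j * B)}) (replicate_pmf (Suc B * n) Z)
     = map_pmf (map_prod e concat) (pair_pmf (pmf_of_set W) (replicate_pmf (Suc B) (replicate_pmf n Z)))"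
  proof -
    have "pmf_of_set {..<2 ^ (p * j * B)} = map_pmf e (pmf_of_set W)"
      using map_pmf_of_set_inj[OF _ neW finW, of e] e by (simp add: bij_betw_def)
    then show ?thesis
      by (simp only: replicate_pmf_mult pair_map_pmf1 pair_map_pmf2 map_pmf_comp)
         (simp add: map_prod_def split_def apfst_def)
  qed
  then have "measure_pmf.prob (pair_pmf (pmf_of_set {..<2 ^ (p * j * B)}) (replicate_pmf (Suc B * n) Z))
        {(w, zs). dec (map (case_prod F3) (relay_run F2 r (enc w) zs)) \<noteq> w}
     = measure_pmf.prob (pair_pmf (pmf_of_set W) (replicate_pmf (Suc B) (replicate_pmf n Z)))
         {(ws, zss). dec (map (case_prod F3) (relay_run F2 r (enc (e ws)) (concat zss))) \<noteq> e ws}"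
    by (simp only: measure_map_pmf) (simp add: vimage_def split_def)
  also have "\<dots> \<le> measure_pmf.prob (pair_pmf (pmf_of_set W) (replicate_pmf (Suc B) (replicate_pmf n Z)))
        {(ws, zss). \<not> all_decoded (\<lambda>w w' zs. \<delta>2 w (map_channel F2 (\<xi> w w', \<alpha> w) zs) = w' \<and>
                       \<delta>3 w' (map_channel F3 (\<xi> w w', \<alpha> w) zs) = w) 0 ws zss}"
    using correct finW neW
    by (intro measure_pmf.finite_measure_mono_AE AE_pmfI) (auto simp: set_replicate_pmf simp del: replicate_pmf.simps)
  also have "\<dots> \<le> \<epsilon>" using err by simp
  finally show ?thesis
    using enc r dec j(1) unfolding n_def by blast
qed

section \<open>Converse\<close>

lemma expectation_pmf_cong:
  fixes f g :: "'a \<Rightarrow> real"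
  shows "(\<And>x. x \<in> set_pmf p \<Longrightarrow> f x = g x) \<Longrightarrow> measure_pmf.expectation p f = measure_pmf.expectation p g"
  by (intro integral_cong_AE AE_pmfI) auto

lemma expectation_bind_pmf_finite:
  fixes h :: "'b \<Rightarrow> real"
  assumes "finite (set_pmf p)" "\<And>x. finite (set_pmf (f x))"
  shows "measure_pmf.expectation (bind_pmf p f) h = measure_pmf.expectation p (\<lambda>x. measure_pmf.expectation (f x) h)"
  by (subst pmf_expectation_bind[OF assms(1,2) order_refl], subst integral_measure_pmf[OF assms(1)]) auto

lemma expectation_pair_pmf_finite:
  fixes h :: "'a \<times> 'b \<Rightarrow> real"
  assumes "finite (set_pmf p)" "finite (set_pmf q)"
  shows "measure_pmf.expectation (pair_pmf p q) h = measure_pmf.expectation p (\<lambda>x. measure_pmf.expectation q (\<lambda>y. h (x, y)))"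
proof -
  have "pair_pmf p q = bind_pmf p (\<lambda>x. map_pmf (Pair x) q)"
    by (simp add: pair_pmf_def map_pmf_def)
  then show ?thesis using assms by (simp add: expectation_bind_pmf_finite)
qed

lemma finite_set_replicate_pmf: "finite (set_pmf p) \<Longrightarrow> finite (set_pmf (replicate_pmf n p))"
  using finite_lists_length_eq[of "set_pmf p" n] by (simp add: set_replicate_pmf lists_eq_set)

lemma info_eq_expectation:
  assumes "finite (set_pmf P)" "finite (set_pmf Z)"
  shows "info \<kappa> (\<lambda>u. map_pmf (F u) Z) P = measure_pmf.expectation P
    (\<lambda>u. measure_pmf.expectation Z (\<lambda>z. log 2 (dens \<kappa> (\<lambda>u. map_pmf (F u) Z) P u (F u z))))"
  using assms by (simp add: info_def expectation_bind_pmf_finite)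

text \<open>The letter used at a step depends on earlier noise only and is independent of the noise
  at that step. So each term can be replaced by its mean over a fresh noise value, whatever the
  relay does with its observations.\<close>

lemma expectation_relay_run:
  fixes f :: "'x \<times> 'a \<Rightarrow> 'z \<Rightarrow> real"
  assumes fin: "finite (set_pmf Z)"
  shows "measure_pmf.expectation (replicate_pmf (length xs) Z) (\<lambda>zs. \<Sum>(u, z)\<leftarrow>relay_run F r xs zs. f u z)
    = measure_pmf.expectation (replicate_pmf (length xs) Z)
        (\<lambda>zs. \<Sum>(u, _)\<leftarrow>relay_run F r xs zs. measure_pmf.expectation Z (f u))"
proof (induction xs arbitrary: r)
  case (Cons x xs)
  let ?R = "replicate_pmf (length xs) Z"
  have int: "integrable (measure_pmf p) g" if "finite (set_pmf p)" for p :: "'p pmf" and g :: "'p \<Rightarrow> real"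
    using that by (rule integrable_measure_pmf_finite)
  have finR: "finite (set_pmf ?R)" by (rule finite_set_replicate_pmf[OF fin])
  have step: "measure_pmf.expectation (replicate_pmf (length (x # xs)) Z) (\<lambda>zs. \<Sum>(u, z)\<leftarrow>relay_run F r (x # xs) zs. g u z)
     = measure_pmf.expectation Z (g (x, r [])) + measure_pmf.expectation Z (\<lambda>z. measure_pmf.expectation ?R
         (\<lambda>zs. \<Sum>(u, z)\<leftarrow>relay_run F (\<lambda>ys. r (F (x, r []) z # ys)) xs zs. g u z))"
    for g :: "'x \<times> 'a \<Rightarrow> 'z \<Rightarrow> real"
    using fin finR
    by (simp add: expectation_bind_pmf_finite Bochner_Integration.integral_add int)
  show ?case
    unfolding step using Cons.IH by (simp add: split_def)
qed simp

section \<open>Changes of measure for the two cuts\<close>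

text \<open>Dividing by the density of the first output replaces its law by the reference law. The
  induction hypothesis bounds the tail by the same quantity for every strategy, so what the relay
  learned from the first noise value drops out.\<close>

lemma change_of_measure_direct:
  fixes F3 :: "'x \<times> 'a \<Rightarrow> 'z \<Rightarrow> 'v" and Z :: "'z pmf" and k :: "'v list \<Rightarrow> ennreal"
  defines "K \<equiv> \<lambda>u. map_pmf (F3 u) Z"
  shows "(\<integral>\<^sup>+zs. k (map (case_prod F3) (relay_run F r xs zs)) *
       (\<Prod>(u, z)\<leftarrow>relay_run F r xs zs. ennreal (1 / dens (\<lambda>_. ()) K P u (F3 u z))) \<partial>replicate_pmf (length xs) Z)
     \<le> (\<integral>\<^sup>+vs. k vs \<partial>replicate_pmf (length xs) (ref_law (\<lambda>_. ()) K P ()))"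
proof (induction xs arbitrary: r k)
  case (Cons x xs)
  let ?q = "ref_law (\<lambda>_. ()) K P ()" and ?u = "(x, r [])"
  let ?i = "\<lambda>v. ennreal (1 / dens (\<lambda>_. ()) K P ?u v)"
  let ?run = "\<lambda>z zs. relay_run F (\<lambda>ys. r (F ?u z # ys)) xs zs"
  have "(\<integral>\<^sup>+zs. k (map (case_prod F3) (relay_run F r (x # xs) zs)) *
       (\<Prod>(u, z)\<leftarrow>relay_run F r (x # xs) zs. ennreal (1 / dens (\<lambda>_. ()) K P u (F3 u z))) \<partial>replicate_pmf (length (x # xs)) Z)
    = (\<integral>\<^sup>+z. (\<integral>\<^sup>+zs. k (F3 ?u z # map (case_prod F3) (?run z zs)) *
       (\<Prod>(u, z)\<leftarrow>?run z zs. ennreal (1 / dens (\<lambda>_. ()) K P u (F3 u z))) \<partial>replicate_pmf (length xs) Z) * ?i (F3 ?u z) \<partial>measure_pmf Z)"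
    by (simp add: nn_integral_cmult mult_ac)
  also have "\<dots> \<le> (\<integral>\<^sup>+z. (\<integral>\<^sup>+vs. k (F3 ?u z # vs) \<partial>replicate_pmf (length xs) ?q) * ?i (F3 ?u z) \<partial>measure_pmf Z)"
    by (intro nn_integral_mono mult_right_mono Cons.IH) auto
  also have "\<dots> = (\<integral>\<^sup>+v. (\<integral>\<^sup>+vs. k (v # vs) \<partial>replicate_pmf (length xs) ?q) * ?i v \<partial>measure_pmf (K ?u))"
    by (simp add: K_def)
  also have "\<dots> \<le> (\<integral>\<^sup>+v. (\<integral>\<^sup>+vs. k (v # vs) \<partial>replicate_pmf (length xs) ?q) \<partial>?q)"
    by (rule nn_integral_inverse_dens_le)
  finally show ?case by simp
qed simp

text \<open>What the destination sees in a fictitious system where the relay output is drawn from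
  \<open>q\<close> given the relay letter alone, and the destination output then from
  \<open>V\<close>. No source letter occurs, so this law cannot depend on the message.\<close>

primrec feedback_law :: "('a \<Rightarrow> 'y pmf) \<Rightarrow> ('a \<Rightarrow> 'y \<Rightarrow> 'v pmf) \<Rightarrow> nat \<Rightarrow> ('y list \<Rightarrow> 'a) \<Rightarrow> 'v list pmf" where
  "feedback_law q V 0 r = return_pmf []"
| "feedback_law q V (Suc n) r = bind_pmf (q (r [])) (\<lambda>y. bind_pmf (V (r []) y) (\<lambda>v.
     map_pmf ((#) v) (feedback_law q V n (\<lambda>ys. r (y # ys)))))"

text \<open>Degradedness enters here. The destination output arises from the relay letter and relay
  output through \<open>V\<close>; once the relay output has the reference law given its letter, the
  source letter has disappeared. The later relay letters are then driven by reference outputs too,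
  hence a law with feedback instead of a product.\<close>

lemma change_of_measure_relay:
  fixes F2 :: "'x \<times> 'a \<Rightarrow> 'z \<Rightarrow> 'y" and F3 :: "'x \<times> 'a \<Rightarrow> 'z \<Rightarrow> 'v" and Z :: "'z pmf"
    and k :: "'v list \<Rightarrow> ennreal"
  defines "K \<equiv> \<lambda>u. map_pmf (F2 u) Z"
  assumes degraded: "\<And>x a. x \<in> X \<Longrightarrow> a \<in> A \<Longrightarrow>
      map_pmf (\<lambda>z. (F2 (x, a) z, F3 (x, a) z)) Z = bind_pmf (K (x, a)) (\<lambda>y. map_pmf (Pair y) (V a y))"
    and "set xs \<subseteq> X" "range r \<subseteq> A"
  shows "(\<integral>\<^sup>+zs. k (map (case_prod F3) (relay_run F2 r xs zs)) *
       (\<Prod>(u, z)\<leftarrow>relay_run F2 r xs zs. ennreal (1 / dens snd K P u (F2 u z))) \<partial>replicate_pmf (length xs) Z)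
     \<le> (\<integral>\<^sup>+vs. k vs \<partial>feedback_law (ref_law snd K P) V (length xs) r)"
  using assms(3,4)
proof (induction xs arbitrary: r k)
  case (Cons x xs)
  let ?a = "r []" let ?u = "(x, ?a)"
  let ?i = "\<lambda>y. ennreal (1 / dens snd K P ?u y)"
  let ?L = "\<lambda>y. feedback_law (ref_law snd K P) V (length xs) (\<lambda>ys. r (y # ys))"
  let ?run = "\<lambda>z zs. relay_run F2 (\<lambda>ys. r (F2 ?u z # ys)) xs zs"
  have xa: "x \<in> X" "?a \<in> A" using Cons.prems by auto
  have "(\<integral>\<^sup>+zs. k (map (case_prod F3) (relay_run F2 r (x # xs) zs)) *
       (\<Prod>(u, z)\<leftarrow>relay_run F2 r (x # xs) zs. ennreal (1 / dens snd K P u (F2 u z))) \<partial>replicate_pmf (length (x # xs)) Z)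
    = (\<integral>\<^sup>+z. (\<integral>\<^sup>+zs. k (F3 ?u z # map (case_prod F3) (?run z zs)) *
       (\<Prod>(u, z)\<leftarrow>?run z zs. ennreal (1 / dens snd K P u (F2 u z))) \<partial>replicate_pmf (length xs) Z) * ?i (F2 ?u z) \<partial>measure_pmf Z)"
    by (simp add: nn_integral_cmult mult_ac)
  also have "\<dots> \<le> (\<integral>\<^sup>+z. (\<integral>\<^sup>+vs. k (F3 ?u z # vs) \<partial>?L (F2 ?u z)) * ?i (F2 ?u z) \<partial>measure_pmf Z)"
    using Cons.prems by (intro nn_integral_mono mult_right_mono Cons.IH) auto
  also have "\<dots> = (\<integral>\<^sup>+yv. (\<integral>\<^sup>+vs. k (snd yv # vs) \<partial>?L (fst yv)) * ?i (fst yv)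
        \<partial>map_pmf (\<lambda>z. (F2 ?u z, F3 ?u z)) Z)"
    by simp
  also have "\<dots> = (\<integral>\<^sup>+y. (\<integral>\<^sup>+v. \<integral>\<^sup>+vs. k (v # vs) \<partial>?L y \<partial>V ?a y) * ?i y \<partial>measure_pmf (K ?u))"
    unfolding degraded[OF xa] by (simp add: nn_integral_multc)
  also have "\<dots> \<le> (\<integral>\<^sup>+y. (\<integral>\<^sup>+v. \<integral>\<^sup>+vs. k (v # vs) \<partial>?L y \<partial>V ?a y) \<partial>ref_law snd K P (snd ?u))"
    by (rule nn_integral_inverse_dens_le)
  finally show ?case by simp
qed simp

text \<open>Gibbs' inequality with an explicit test function \<open>\<phi>\<close>. Under the
  reference law the output is independent of the uniform message, so \<open>\<phi>\<close> has mean
  at most 1; by \<open>bound\<close> so does \<open>t\<close>, and \<open>ln t \<le> t - 1\<close>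
  bounds the mean of \<open>ln \<phi>\<close> by that of \<open>ln D\<close>. The free parameter
  \<open>\<tau>\<close> stands in for the binary entropy of Fano's inequality.\<close>

lemma fano_change_of_measure:
  fixes out :: "nat \<Rightarrow> 'b \<Rightarrow> 'v" and D :: "nat \<Rightarrow> 'b \<Rightarrow> real" and T :: "'v pmf"
  assumes fin: "finite (set_pmf Q)" and M: "0 < M" and \<tau>: "0 < \<tau>" "\<tau> < 1"
    and pos: "\<And>w b. w < M \<Longrightarrow> b \<in> set_pmf Q \<Longrightarrow> 0 < D w b"
    and bound: "\<And>w k. w < M \<Longrightarrow> (\<integral>\<^sup>+b. k (out w b) * ennreal (1 / D w b) \<partial>measure_pmf Q) \<le> (\<integral>\<^sup>+v. k v \<partial>measure_pmf T)"
    and err: "measure_pmf.prob (pair_pmf (pmf_of_set {..<M}) Q) {(w, b). dec (out w b) \<noteq> w} \<le> \<epsilon>"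
  shows "(1 - \<epsilon>) * log 2 (real M) + log 2 (1 - \<tau>) + \<epsilon> * log 2 \<tau>
    \<le> measure_pmf.expectation (pair_pmf (pmf_of_set {..<M}) Q) (\<lambda>(w, b). log 2 (D w b))"
proof -
  let ?\<Omega> = "pair_pmf (pmf_of_set {..<M}) Q"
  \<comment> \<open>A correct decision is rewarded by nearly the factor \<open>M\<close>, its
    advantage over guessing. The value \<open>\<tau>\<close> on errors keeps the logarithm finite
    and is paid for by the factor \<open>1 - \<tau>\<close>.\<close>
  define \<phi> where "\<phi> w v = (if dec v = w then real M * (1 - \<tau>) else \<tau>)" for w v
  have ne: "{..<M} \<noteq> {}" using M by auto
  have set: "set_pmf ?\<Omega> = {..<M} \<times> set_pmf Q" using ne by simp
  have fin\<Omega>: "finite (set_pmf ?\<Omega>)" unfolding set using fin by simp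
  have int: "integrable (measure_pmf ?\<Omega>) g" for g :: "nat \<times> 'b \<Rightarrow> real"
    by (rule integrable_measure_pmf_finite[OF fin\<Omega>])
  have \<phi>pos: "0 < \<phi> w v" for w v using \<tau> M by (simp add: \<phi>_def)
  define t where "t = (\<lambda>(w, b). \<phi> w (out w b) / D w b)"
  have tpos: "0 < t wb" if "wb \<in> set_pmf ?\<Omega>" for wb
    using that pos \<phi>pos unfolding set by (auto simp: t_def)
  have avg: "(\<integral>\<^sup>+w. ennreal (\<phi> w v) \<partial>pmf_of_set {..<M}) \<le> 1" for v
  proof -
    have "(\<Sum>w<M. \<phi> w v) \<le> (\<Sum>w<M. \<tau> + (if dec v = w then real M * (1 - \<tau>) else 0))"
      using \<tau> by (intro sum_mono) (simp add: \<phi>_def)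
    also have "\<dots> \<le> real M * \<tau> + real M * (1 - \<tau>)"
      using \<tau> by (simp add: sum.distrib sum.delta)
    finally have "(\<Sum>w<M. \<phi> w v) / real M \<le> 1"
      using M by (simp add: field_simps)
    moreover have "(\<integral>\<^sup>+w. ennreal (\<phi> w v) \<partial>pmf_of_set {..<M}) = ennreal ((\<Sum>w<M. \<phi> w v) / real M)"
      using ne M less_imp_le[OF \<phi>pos]
      by (subst nn_integral_pmf_of_set)
         (auto simp: sum_ennreal ennreal_of_nat_eq_real_of_nat divide_ennreal sum_nonneg)
    ultimately show ?thesis by simp
  qed
  have "ennreal (measure_pmf.expectation ?\<Omega> t) = (\<integral>\<^sup>+wb. ennreal (t wb) \<partial>?\<Omega>)"
    using tpos by (subst nn_integral_eq_integral[OF int]) (auto simp: AE_measure_pmf_iff less_imp_le simp del: set_pair_pmf)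
  also have "\<dots> = (\<integral>\<^sup>+w. \<integral>\<^sup>+b. ennreal (t (w, b)) \<partial>measure_pmf Q \<partial>pmf_of_set {..<M})"
    by (rule nn_integral_pair_pmf')
  also have "\<dots> \<le> (\<integral>\<^sup>+w. \<integral>\<^sup>+v. ennreal (\<phi> w v) \<partial>measure_pmf T \<partial>pmf_of_set {..<M})"
  proof (rule nn_integral_mono_AE, rule AE_pmfI)
    fix w assume "w \<in> set_pmf (pmf_of_set {..<M})"
    then have w: "w < M" using ne by simp
    have "(\<integral>\<^sup>+b. ennreal (t (w, b)) \<partial>measure_pmf Q) = (\<integral>\<^sup>+b. ennreal (\<phi> w (out w b)) * ennreal (1 / D w b) \<partial>measure_pmf Q)"
      using less_imp_le[OF \<phi>pos] by (simp add: t_def ennreal_mult'[symmetric])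
    then show "(\<integral>\<^sup>+b. ennreal (t (w, b)) \<partial>measure_pmf Q) \<le> (\<integral>\<^sup>+v. ennreal (\<phi> w v) \<partial>measure_pmf T)"
      using bound[OF w, of "\<lambda>v. ennreal (\<phi> w v)"] by simp
  qed
  also have "\<dots> = (\<integral>\<^sup>+v. \<integral>\<^sup>+w. ennreal (\<phi> w v) \<partial>pmf_of_set {..<M} \<partial>measure_pmf T)"
    by (rule nn_integral_pmf_swap)
  also have "\<dots> \<le> (\<integral>\<^sup>+v. 1 \<partial>measure_pmf T)"
    by (intro nn_integral_mono avg)
  finally have Et: "measure_pmf.expectation ?\<Omega> t \<le> 1" by simp
  let ?E = "{(w, b). dec (out w b) \<noteq> w}"
  let ?p = "measure_pmf.prob ?\<Omega> ?E"
  have "ln (\<phi> w (out w b)) - ln (D w b) \<le> t (w, b) - 1" if "(w, b) \<in> set_pmf ?\<Omega>" for w b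
  proof -
    have "0 < D w b" using that pos unfolding set by auto
    then show ?thesis
      using ln_le_minus_one[OF tpos[OF that]] \<phi>pos[of w "out w b"] by (simp add: t_def ln_div)
  qed
  then have "measure_pmf.expectation ?\<Omega> (\<lambda>(w, b). ln (\<phi> w (out w b)) - ln (D w b)) \<le> measure_pmf.expectation ?\<Omega> (\<lambda>wb. t wb - 1)"
    by (intro integral_mono_AE int AE_pmfI) auto
  also have "\<dots> \<le> 0"
    using Et by (simp add: int)
  finally have "measure_pmf.expectation ?\<Omega> (\<lambda>(w, b). ln (\<phi> w (out w b))) \<le> measure_pmf.expectation ?\<Omega> (\<lambda>(w, b). ln (D w b))"
    by (simp add: split_def int)
  moreover have "measure_pmf.expectation ?\<Omega> (\<lambda>(w, b). ln (\<phi> w (out w b)))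
      = (1 - ?p) * ln (real M * (1 - \<tau>)) + ?p * ln \<tau>"
  proof -
    have "(\<lambda>(w, b). ln (\<phi> w (out w b))) = (\<lambda>wb. ln (real M * (1 - \<tau>)) + (ln \<tau> - ln (real M * (1 - \<tau>))) * indicator ?E wb)"
      by (auto simp: \<phi>_def indicator_def)
    then show ?thesis by (simp add: int algebra_simps)
  qed
  \<comment> \<open>The true error probability \<open>?p\<close> gives way to
    \<open>\<epsilon>\<close>. The signs of the logarithms decide each direction:
    \<open>ln (real M)\<close> is nonnegative, the other two are negative.\<close>
  moreover have "(1 - \<epsilon>) * ln (real M) + ln (1 - \<tau>) + \<epsilon> * ln \<tau> \<le> (1 - ?p) * ln (real M * (1 - \<tau>)) + ?p * ln \<tau>"
  proof -
    have "(1 - \<epsilon>) * ln (real M) \<le> (1 - ?p) * ln (real M)"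
      using err M by (intro mult_right_mono) auto
    moreover have "ln (1 - \<tau>) \<le> (1 - ?p) * ln (1 - \<tau>)"
      using \<tau> by (simp add: algebra_simps mult_nonpos_nonneg)
    moreover have "\<epsilon> * ln \<tau> \<le> ?p * ln \<tau>"
      using err \<tau> by (intro mult_right_mono_neg) auto
    moreover have "ln (real M * (1 - \<tau>)) = ln (real M) + ln (1 - \<tau>)"
      using M \<tau> by (simp add: ln_mult)
    ultimately show ?thesis
      by (simp only:) (simp add: algebra_simps)
  qed
  ultimately have "(1 - \<epsilon>) * ln (real M) + ln (1 - \<tau>) + \<epsilon> * ln \<tau> \<le> measure_pmf.expectation ?\<Omega> (\<lambda>(w, b). ln (D w b))"
    by linarith
  then have "((1 - \<epsilon>) * ln (real M) + ln (1 - \<tau>) + \<epsilon> * ln \<tau>) / ln 2 \<le> measure_pmf.expectation ?\<Omega> (\<lambda>(w, b). ln (D w b)) / ln 2"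
    by (rule divide_right_mono) simp
  then show ?thesis
    by (simp add: log_def split_def add_divide_distrib)
qed

text \<open>The input law is the time average of the laws of the letters used by the code; with it,
  the expected sum of information densities is the number of blocks times a single-letter
  information, so no concavity argument is needed.\<close>

lemma converse_bound:
  fixes Z :: "'z pmf" and F2 :: "'x \<times> 'a \<Rightarrow> 'z \<Rightarrow> 'y" and F3 :: "'x \<times> 'a \<Rightarrow> 'z \<Rightarrow> 'v"
  defines "K2 \<equiv> \<lambda>u. map_pmf (F2 u) Z" and "K3 \<equiv> \<lambda>u. map_pmf (F3 u) Z"
  assumes degraded: "\<And>x a. x \<in> X \<Longrightarrow> a \<in> A \<Longrightarrow>
      map_pmf (\<lambda>z. (F2 (x, a) z, F3 (x, a) z)) Z = bind_pmf (K2 (x, a)) (\<lambda>y. map_pmf (Pair y) (V a y))"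
    and fin: "finite (set_pmf Z)" and m: "0 < m" and M: "0 < M"
    and enc: "\<And>w. w < M \<Longrightarrow> length (enc w) = m \<and> set (enc w) \<subseteq> X" and r: "range r \<subseteq> A"
    and err: "measure_pmf.prob (pair_pmf (pmf_of_set {..<M}) (replicate_pmf m Z))
        {(w, zs). dec (map (case_prod F3) (relay_run F2 r (enc w) zs)) \<noteq> w} \<le> \<epsilon>"
    and \<tau>: "0 < \<tau>" "\<tau> < 1"
  shows "\<exists>P. set_pmf P \<subseteq> X \<times> A \<and>
     (1 - \<epsilon>) * log 2 (real M) + log 2 (1 - \<tau>) + \<epsilon> * log 2 \<tau> \<le> real m * min (info snd K2 P) (info (\<lambda>_. ()) K3 P)"
proof -
  let ?\<Omega> = "pair_pmf (pmf_of_set {..<M}) (replicate_pmf m Z)"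
  let ?run = "\<lambda>w zs. relay_run F2 r (enc w) zs"
  define P where "P = bind_pmf ?\<Omega> (\<lambda>(w, zs). map_pmf (\<lambda>i. fst (?run w zs ! i)) (pmf_of_set {..<m}))"
  have ne: "{..<M} \<noteq> {}" "{..<m} \<noteq> {}" using M m by auto
  have finR: "finite (set_pmf (replicate_pmf m Z))" by (rule finite_set_replicate_pmf[OF fin])
  have fin\<Omega>: "finite (set_pmf ?\<Omega>)" using finR ne by simp
  have len: "length (?run w zs) = m" if "w < M" "zs \<in> set_pmf (replicate_pmf m Z)" for w zs
    using that enc by (auto simp: set_replicate_pmf)
  \<comment> \<open>Every letter that occurs in a run lies in the support of \<open>P\<close>, which
    makes all densities along the run positive.\<close>
  have run_set: "fst (?run w zs ! i) \<in> set_pmf P" if "w < M" "zs \<in> set_pmf (replicate_pmf m Z)" "i < m" for w zs i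
    using that ne unfolding P_def by (auto simp del: set_pair_pmf intro!: bexI[of _ "(w, zs)"]) (auto simp: ne)
  have PXA: "set_pmf P \<subseteq> X \<times> A"
  proof
    fix u assume "u \<in> set_pmf P"
    then obtain w zs i where *: "w < M" "zs \<in> set_pmf (replicate_pmf m Z)" "i < m" "u = fst (?run w zs ! i)"
      using ne by (auto simp: P_def)
    then have "?run w zs ! i \<in> set (?run w zs)" using len by simp
    then have "?run w zs ! i \<in> (set (enc w) \<times> range r) \<times> set zs"
      using set_relay_run[of F2 r "enc w" zs] by blast
    then show "u \<in> X \<times> A"
      using enc[OF *(1)] r *(4) by (cases "?run w zs ! i") auto
  qed
  have finP: "finite (set_pmf P)"
    using fin\<Omega> ne by (auto simp: P_def split_def)
  have avg: "measure_pmf.expectation ?\<Omega> (\<lambda>(w, zs). \<Sum>(u, z)\<leftarrow>?run w zs. f u z)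
      = real m * measure_pmf.expectation P (\<lambda>u. measure_pmf.expectation Z (f u))" for f :: "'x \<times> 'a \<Rightarrow> 'z \<Rightarrow> real"
  proof -
    let ?g = "\<lambda>u. measure_pmf.expectation Z (f u)"
    have "measure_pmf.expectation ?\<Omega> (\<lambda>(w, zs). \<Sum>(u, z)\<leftarrow>?run w zs. f u z)
       = measure_pmf.expectation (pmf_of_set {..<M}) (\<lambda>w. measure_pmf.expectation (replicate_pmf m Z)
            (\<lambda>zs. \<Sum>(u, z)\<leftarrow>?run w zs. f u z))"
      using finR ne by (simp add: expectation_pair_pmf_finite)
    also have "\<dots> = measure_pmf.expectation (pmf_of_set {..<M}) (\<lambda>w. measure_pmf.expectation (replicate_pmf m Z)
            (\<lambda>zs. \<Sum>(u, z)\<leftarrow>?run w zs. ?g u))"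
    proof (rule expectation_pmf_cong)
      fix w assume "w \<in> set_pmf (pmf_of_set {..<M})"
      then have "length (enc w) = m" using ne enc by simp
      then show "measure_pmf.expectation (replicate_pmf m Z) (\<lambda>zs. \<Sum>(u, z)\<leftarrow>?run w zs. f u z)
        = measure_pmf.expectation (replicate_pmf m Z) (\<lambda>zs. \<Sum>(u, z)\<leftarrow>?run w zs. ?g u)"
        using expectation_relay_run[OF fin, where F = F2 and r = r and f = f and xs = "enc w"] by simp
    qed
    also have "\<dots> = measure_pmf.expectation ?\<Omega> (\<lambda>(w, zs). \<Sum>(u, z)\<leftarrow>?run w zs. ?g u)"
      using finR ne by (simp add: expectation_pair_pmf_finite)
    also have "\<dots> = measure_pmf.expectation ?\<Omega> (\<lambda>(w, zs). real m * measure_pmf.expectation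
         (map_pmf (\<lambda>i. fst (?run w zs ! i)) (pmf_of_set {..<m})) ?g)"
    proof (rule expectation_pmf_cong, clarify)
      fix w zs assume "(w, zs) \<in> set_pmf ?\<Omega>"
      then have "length (?run w zs) = m" using ne by (intro len) auto
      then show "(\<Sum>(u, z)\<leftarrow>?run w zs. ?g u) = real m * measure_pmf.expectation
         (map_pmf (\<lambda>i. fst (?run w zs ! i)) (pmf_of_set {..<m})) ?g"
        using ne m by (simp add: integral_pmf_of_set sum_list_sum_nth split_def atLeast0LessThan)
    qed
    also have "\<dots> = real m * measure_pmf.expectation P ?g"
      unfolding P_def using fin\<Omega> ne by (subst expectation_bind_pmf_finite) (auto simp: split_def)
    finally show ?thesis .
  qed
  \<comment> \<open>Shared by both cuts, which differ only in the density and in the reference law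
    \<open>T\<close> of the outputs.\<close>
  have one: "(1 - \<epsilon>) * log 2 (real M) + log 2 (1 - \<tau>) + \<epsilon> * log 2 \<tau> \<le> real m * info \<kappa> (\<lambda>u. map_pmf (G u) Z) P"
    if bound: "\<And>w k. w < M \<Longrightarrow> (\<integral>\<^sup>+zs. k (map (case_prod F3) (?run w zs)) *
       (\<Prod>(u, z)\<leftarrow>?run w zs. ennreal (1 / dens \<kappa> (\<lambda>u. map_pmf (G u) Z) P u (G u z))) \<partial>replicate_pmf m Z)
       \<le> (\<integral>\<^sup>+vs. k vs \<partial>measure_pmf T)"
    for \<kappa> :: "'x \<times> 'a \<Rightarrow> 'c" and G :: "'x \<times> 'a \<Rightarrow> 'z \<Rightarrow> 'o" and T :: "'v list pmf"
  proof -
    let ?d = "\<lambda>u z. dens \<kappa> (\<lambda>u. map_pmf (G u) Z) P u (G u z)"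
    let ?D = "\<lambda>w zs. \<Prod>(u, z)\<leftarrow>?run w zs. ?d u z"
    have dpos: "0 < ?d u z" if "(u, z) \<in> set (?run w zs)" "w < M" "zs \<in> set_pmf (replicate_pmf m Z)" for u z w zs
    proof -
      from that(1) obtain i where "i < length (?run w zs)" and i: "?run w zs ! i = (u, z)"
        unfolding in_set_conv_nth by blast
      then have "i < m" by (simp only: len[OF that(2,3)])
      from run_set[OF that(2,3) this] have "u \<in> set_pmf P" by (simp only: i fst_conv)
      moreover have "z \<in> set_pmf Z"
        using that set_relay_run[of F2 r "enc w" zs] by (auto simp: set_replicate_pmf)
      ultimately show ?thesis by (intro dens_pos) auto
    qed
    have prod_inv: "(\<Prod>(u, z)\<leftarrow>l. ennreal (1 / ?d u z)) = ennreal (1 / (\<Prod>(u, z)\<leftarrow>l. ?d u z))" for l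
      by (induction l) (auto simp: ennreal_mult'[symmetric] dens_nonneg)
    have Dpos: "0 < ?D w zs" "log 2 (?D w zs) = (\<Sum>(u, z)\<leftarrow>?run w zs. log 2 (?d u z))"
      if "w < M" "zs \<in> set_pmf (replicate_pmf m Z)" for w zs
    proof -
      have "0 < (\<Prod>(u, z)\<leftarrow>l. ?d u z) \<and> log 2 (\<Prod>(u, z)\<leftarrow>l. ?d u z) = (\<Sum>(u, z)\<leftarrow>l. log 2 (?d u z))"
        if "set l \<subseteq> set (?run w zs)" for l
        using that
      proof (induction l)
        case (Cons uz l)
        obtain u z where uz: "uz = (u, z)" by (cases uz)
        then have "0 < ?d u z" using Cons.prems dpos[OF _ \<open>w < M\<close> \<open>zs \<in> _\<close>] by auto
        then show ?case using Cons by (simp add: uz log_mult)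
      qed simp
      then show "0 < ?D w zs" "log 2 (?D w zs) = (\<Sum>(u, z)\<leftarrow>?run w zs. log 2 (?d u z))" by blast+
    qed
    have "(1 - \<epsilon>) * log 2 (real M) + log 2 (1 - \<tau>) + \<epsilon> * log 2 \<tau>
        \<le> measure_pmf.expectation ?\<Omega> (\<lambda>(w, zs). log 2 (?D w zs))"
      by (rule fano_change_of_measure[where T = T and out = "\<lambda>w zs. map (case_prod F3) (?run w zs)", OF finR M \<tau> Dpos(1) _ err])
         (use bound in \<open>auto simp: prod_inv\<close>)
    also have "\<dots> = measure_pmf.expectation ?\<Omega> (\<lambda>(w, zs). \<Sum>(u, z)\<leftarrow>?run w zs. log 2 (?d u z))"
      using Dpos(2) ne by (intro expectation_pmf_cong) auto
    also have "\<dots> = real m * info \<kappa> (\<lambda>u. map_pmf (G u) Z) P"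
      by (simp add: avg info_eq_expectation[OF finP fin])
    finally show ?thesis .
  qed
  have "(1 - \<epsilon>) * log 2 (real M) + log 2 (1 - \<tau>) + \<epsilon> * log 2 \<tau> \<le> real m * info snd K2 P"
    unfolding K2_def
  proof (rule one)
    fix w and k :: "'v list \<Rightarrow> ennreal" assume "w < M"
    then have "length (enc w) = m" "set (enc w) \<subseteq> X" using enc by auto
    then show "(\<integral>\<^sup>+zs. k (map (case_prod F3) (?run w zs)) *
       (\<Prod>(u, z)\<leftarrow>?run w zs. ennreal (1 / dens snd (\<lambda>u. map_pmf (F2 u) Z) P u (F2 u z))) \<partial>replicate_pmf m Z)
       \<le> (\<integral>\<^sup>+vs. k vs \<partial>feedback_law (ref_law snd (\<lambda>u. map_pmf (F2 u) Z) P) V m r)"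
      using change_of_measure_relay[where X = X and A = A and ?F2.0 = F2 and ?F3.0 = F3 and Z = Z and V = V
          and P = P and r = r and xs = "enc w" and k = k] degraded[unfolded K2_def] r by simp
  qed
  moreover have "(1 - \<epsilon>) * log 2 (real M) + log 2 (1 - \<tau>) + \<epsilon> * log 2 \<tau> \<le> real m * info (\<lambda>_. ()) K3 P"
    unfolding K3_def
  proof (rule one)
    fix w and k :: "'v list \<Rightarrow> ennreal" assume "w < M"
    then have "length (enc w) = m" using enc by auto
    then show "(\<integral>\<^sup>+zs. k (map (case_prod F3) (?run w zs)) *
       (\<Prod>(u, z)\<leftarrow>?run w zs. ennreal (1 / dens (\<lambda>_. ()) (\<lambda>u. map_pmf (F3 u) Z) P u (F3 u z))) \<partial>replicate_pmf m Z)
       \<le> (\<integral>\<^sup>+vs. k vs \<partial>replicate_pmf m (ref_law (\<lambda>_. ()) (\<lambda>u. map_pmf (F3 u) Z) P ()))"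
      using change_of_measure_direct[where xs = "enc w" and k = k and F = F2 and r = r and Z = Z and P = P and ?F3.0 = F3] by simp
  qed
  ultimately show ?thesis
    using PXA by (intro exI[of _ P]) (auto simp: min_def)
qed

section \<open>Information quantities of finite measures as expectations\<close>

lemma pmf_bind_map_Pair:
  "pmf (bind_pmf P (\<lambda>u. map_pmf (Pair u) (K u))) (u, y) = pmf P u * pmf (K u) y"
proof -
  have "pmf (map_pmf (Pair v) (K v)) (u, y) = indicator {u} v * pmf (K u) y" for v
    by (cases "v = u") (auto simp: pmf_map_inj' inj_on_def pmf_eq_0_set_pmf)
  then show ?thesis
    by (simp add: pmf_bind measure_pmf_single)
qed

text \<open>Grouping the inputs by fibre identifies \<open>ref_law\<close> as the conditional law of
  the output given \<open>\<kappa>\<close>.\<close>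

lemma map_bind_fibre:
  "bind_pmf P (\<lambda>u. map_pmf (Pair (\<kappa> u)) (K u)) = bind_pmf (map_pmf \<kappa> P) (\<lambda>c. map_pmf (Pair c) (ref_law \<kappa> K P c))"
proof -
  have "bind_pmf P (\<lambda>u. map_pmf (Pair (\<kappa> u)) (K u)) = bind_pmf (map_pmf \<kappa> P)
      (\<lambda>c. bind_pmf (cond_pmf P {u. \<kappa> u = c}) (\<lambda>u. map_pmf (Pair (\<kappa> u)) (K u)))"
    by (subst bind_pmf_cond_fibre[of \<kappa> P, symmetric]) (simp only: bind_assoc_pmf)
  also have "\<dots> = bind_pmf (map_pmf \<kappa> P) (\<lambda>c. map_pmf (Pair c) (ref_law \<kappa> K P c))"
  proof (rule bind_pmf_cong[OF refl])
    fix c assume "c \<in> set_pmf (map_pmf \<kappa> P)"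
    then have "set_pmf P \<inter> {u. \<kappa> u = c} \<noteq> {}" by auto
    then have "bind_pmf (cond_pmf P {u. \<kappa> u = c}) (\<lambda>u. map_pmf (Pair (\<kappa> u)) (K u))
        = bind_pmf (cond_pmf P {u. \<kappa> u = c}) (\<lambda>u. map_pmf (Pair c) (K u))"
      by (intro bind_pmf_cong) (auto simp: set_cond_pmf)
    then show "bind_pmf (cond_pmf P {u. \<kappa> u = c}) (\<lambda>u. map_pmf (Pair (\<kappa> u)) (K u)) = map_pmf (Pair c) (ref_law \<kappa> K P c)"
      by (simp add: ref_law_def map_bind_pmf)
  qed
  finally show ?thesis .
qed

context
  fixes S :: "'w set" and J :: "'w pmf"
  assumes finS: "finite S" and J: "set_pmf J \<subseteq> S"
begin

lemma measure_point_measure_pmf: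
  assumes "T \<subseteq> S"
  shows "measure (point_measure S (\<lambda>\<omega>. ennreal (pmf J \<omega>))) T = measure_pmf.prob J T"
proof -
  have "emeasure (point_measure S (\<lambda>\<omega>. ennreal (pmf J \<omega>))) T = (\<Sum>\<omega>\<in>T. ennreal (pmf J \<omega>))"
    using finS assms by (rule emeasure_point_measure_finite)
  also have "\<dots> = ennreal (measure_pmf.prob J T)"
    using finite_subset[OF assms finS] by (simp add: measure_measure_pmf_finite sum_ennreal)
  finally show ?thesis by (simp add: measure_def)
qed

lemma prob_space_point_measure_pmf: "prob_space (point_measure S (\<lambda>\<omega>. ennreal (pmf J \<omega>)))"
proof (rule prob_spaceI)
  have "emeasure (point_measure S (\<lambda>\<omega>. ennreal (pmf J \<omega>))) S = (\<Sum>\<omega>\<in>S. ennreal (pmf J \<omega>))"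
    using finS by (rule emeasure_point_measure_finite) simp
  also have "\<dots> = 1"
    using finS J by (simp add: sum_ennreal sum_pmf_eq_1)
  finally show "emeasure (point_measure S (\<lambda>\<omega>. ennreal (pmf J \<omega>))) (space (point_measure S (\<lambda>\<omega>. ennreal (pmf J \<omega>)))) = 1"
    by (simp add: space_point_measure)
qed

lemma simple_distributed_point_measure_pmf:
  "simple_distributed (point_measure S (\<lambda>\<omega>. ennreal (pmf J \<omega>))) f (pmf (map_pmf f J))"
proof -
  interpret prob_space "point_measure S (\<lambda>\<omega>. ennreal (pmf J \<omega>))"
    by (rule prob_space_point_measure_pmf)
  have "measure_pmf.prob J (f -` {v} \<inter> S) = measure_pmf.prob J (f -` {v})" for v
    using J by (intro measure_prob_cong_0) (auto simp: pmf_eq_0_set_pmf)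
  then show ?thesis
    using finS by (intro simple_distributedI) (auto simp: space_point_measure measure_point_measure_pmf pmf_map)
qed

lemma sum_image_pmf:
  "(\<Sum>v\<in>f ` S. pmf (map_pmf f J) v * g v) = measure_pmf.expectation J (\<lambda>\<omega>. g (f \<omega>))"
proof -
  have "measure_pmf.expectation (map_pmf f J) g = (\<Sum>v\<in>f ` S. pmf (map_pmf f J) v * g v)"
    using finS J by (subst integral_measure_pmf[of "f ` S"]) auto
  then show ?thesis by simp
qed

text \<open>In p(x,y,z) / (p(x,z) p(y|z)) the factor p(x,z) cancels on the support. What remains is
  the channel law over the output law given z, which is \<open>dens\<close>.\<close>

lemma cond_mutual_info_eq_info:
  assumes K: "map_pmf (\<lambda>\<omega>. ((X \<omega>, Z \<omega>), Y \<omega>)) J = bind_pmf P (\<lambda>u. map_pmf (Pair u) (K u))"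
  shows "cond_mutual_info (point_measure S (\<lambda>\<omega>. ennreal (pmf J \<omega>))) X Y Z = info snd K P"
proof -
  let ?M = "point_measure S (\<lambda>\<omega>. ennreal (pmf J \<omega>))"
  interpret information_space ?M 2
    by (intro information_space.intro prob_space_point_measure_pmf information_space_axioms.intro) simp
  let ?J' = "bind_pmf P (\<lambda>u. map_pmf (Pair u) (K u))"
  have P: "map_pmf (\<lambda>\<omega>. (X \<omega>, Z \<omega>)) J = P"
    using arg_cong[OF K, of "map_pmf fst"]
    by (simp add: map_pmf_comp map_bind_pmf bind_return_pmf' map_pmf_const)
  have PZ: "map_pmf Z J = map_pmf snd P"
    by (simp add: P[symmetric] map_pmf_comp)
  have PYZ: "map_pmf (\<lambda>\<omega>. (Z \<omega>, Y \<omega>)) J = bind_pmf (map_pmf snd P) (\<lambda>c. map_pmf (Pair c) (ref_law snd K P c))"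
    unfolding map_bind_fibre[symmetric] using arg_cong[OF K, of "map_pmf (\<lambda>(u, y). (snd u, y))"]
    by (simp add: map_pmf_comp map_bind_pmf)
  have "cond_mutual_info ?M X Y Z = measure_pmf.expectation J (\<lambda>\<omega>.
      log 2 (pmf (map_pmf (\<lambda>\<omega>. (X \<omega>, Y \<omega>, Z \<omega>)) J) (X \<omega>, Y \<omega>, Z \<omega>) /
        (pmf (map_pmf (\<lambda>\<omega>. (X \<omega>, Z \<omega>)) J) (X \<omega>, Z \<omega>) *
          (pmf (map_pmf (\<lambda>\<omega>. (Y \<omega>, Z \<omega>)) J) (Y \<omega>, Z \<omega>) / pmf (map_pmf Z J) (Z \<omega>)))))"
    unfolding cond_mutual_info_def
    by (subst conditional_mutual_information_eq[OF simple_distributed_point_measure_pmf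
          simple_distributed_point_measure_pmf simple_distributed_point_measure_pmf simple_distributed_point_measure_pmf])
       (use sum_image_pmf[of "\<lambda>\<omega>. (X \<omega>, Y \<omega>, Z \<omega>)" "\<lambda>(x, y, z).
          log 2 (pmf (map_pmf (\<lambda>\<omega>. (X \<omega>, Y \<omega>, Z \<omega>)) J) (x, y, z) /
        (pmf (map_pmf (\<lambda>\<omega>. (X \<omega>, Z \<omega>)) J) (x, z) *
          (pmf (map_pmf (\<lambda>\<omega>. (Y \<omega>, Z \<omega>)) J) (y, z) / pmf (map_pmf Z J) z)))"]
        in \<open>simp add: space_point_measure split_def\<close>)
  also have "\<dots> = measure_pmf.expectation J (\<lambda>\<omega>. log 2 (dens snd K P (X \<omega>, Z \<omega>) (Y \<omega>)))"
  proof (rule expectation_pmf_cong)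
    fix \<omega> assume \<omega>: "\<omega> \<in> set_pmf J"
    have "pmf (map_pmf (\<lambda>\<omega>. (X \<omega>, Y \<omega>, Z \<omega>)) J) (X \<omega>, Y \<omega>, Z \<omega>)
        = pmf (map_pmf (\<lambda>\<omega>. ((X \<omega>, Z \<omega>), Y \<omega>)) J) ((X \<omega>, Z \<omega>), Y \<omega>)"
      by (auto simp: pmf_map intro!: arg_cong[where f = "measure_pmf.prob J"])
    also have "\<dots> = pmf P (X \<omega>, Z \<omega>) * pmf (K (X \<omega>, Z \<omega>)) (Y \<omega>)"
      by (simp add: K pmf_bind_map_Pair)
    finally have 1: "pmf (map_pmf (\<lambda>\<omega>. (X \<omega>, Y \<omega>, Z \<omega>)) J) (X \<omega>, Y \<omega>, Z \<omega>)
        = pmf P (X \<omega>, Z \<omega>) * pmf (K (X \<omega>, Z \<omega>)) (Y \<omega>)" .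
    have "pmf (map_pmf (\<lambda>\<omega>. (Y \<omega>, Z \<omega>)) J) (Y \<omega>, Z \<omega>) = pmf (map_pmf (\<lambda>\<omega>. (Z \<omega>, Y \<omega>)) J) (Z \<omega>, Y \<omega>)"
      by (auto simp: pmf_map intro!: arg_cong[where f = "measure_pmf.prob J"])
    also have "\<dots> = pmf (map_pmf snd P) (Z \<omega>) * pmf (ref_law snd K P (Z \<omega>)) (Y \<omega>)"
      by (simp add: PYZ pmf_bind_map_Pair)
    finally have 2: "pmf (map_pmf (\<lambda>\<omega>. (Y \<omega>, Z \<omega>)) J) (Y \<omega>, Z \<omega>)
        = pmf (map_pmf snd P) (Z \<omega>) * pmf (ref_law snd K P (Z \<omega>)) (Y \<omega>)" .
    have "(X \<omega>, Z \<omega>) \<in> set_pmf P" unfolding P[symmetric] using \<omega> by auto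
    then have "pmf P (X \<omega>, Z \<omega>) \<noteq> 0" "pmf (map_pmf snd P) (Z \<omega>) \<noteq> 0"
      by (force simp: pmf_eq_0_set_pmf)+
    then show "log 2 (pmf (map_pmf (\<lambda>\<omega>. (X \<omega>, Y \<omega>, Z \<omega>)) J) (X \<omega>, Y \<omega>, Z \<omega>) /
        (pmf (map_pmf (\<lambda>\<omega>. (X \<omega>, Z \<omega>)) J) (X \<omega>, Z \<omega>) *
          (pmf (map_pmf (\<lambda>\<omega>. (Y \<omega>, Z \<omega>)) J) (Y \<omega>, Z \<omega>) / pmf (map_pmf Z J) (Z \<omega>))))
      = log 2 (dens snd K P (X \<omega>, Z \<omega>) (Y \<omega>))"
      unfolding 1 2 unfolding P PZ by (simp add: dens_def)
  qed
  also have "\<dots> = measure_pmf.expectation (map_pmf (\<lambda>\<omega>. ((X \<omega>, Z \<omega>), Y \<omega>)) J) (\<lambda>(u, y). log 2 (dens snd K P u y))"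
    by simp
  also have "\<dots> = info snd K P"
    unfolding K info_def ..
  finally show ?thesis .
qed

lemma mutual_info_eq_info:
  assumes K: "map_pmf (\<lambda>\<omega>. (X \<omega>, Y \<omega>)) J = bind_pmf P (\<lambda>u. map_pmf (Pair u) (K u))"
  shows "mutual_info (point_measure S (\<lambda>\<omega>. ennreal (pmf J \<omega>))) X Y = info (\<lambda>_. ()) K P"
proof -
  let ?M = "point_measure S (\<lambda>\<omega>. ennreal (pmf J \<omega>))"
  interpret information_space ?M 2
    by (intro information_space.intro prob_space_point_measure_pmf information_space_axioms.intro) simp
  have P: "map_pmf X J = P"
    using arg_cong[OF K, of "map_pmf fst"]
    by (simp add: map_pmf_comp map_bind_pmf bind_return_pmf' map_pmf_const)
  have cP: "cond_pmf P UNIV = P"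
    by (rule pmf_eqI) (simp add: pmf_cond set_pmf_not_empty)
  have PY: "map_pmf Y J = ref_law (\<lambda>_. ()) K P ()"
    using arg_cong[OF K, of "map_pmf snd"]
    by (simp add: map_pmf_comp map_bind_pmf ref_law_def cP)
  have "mutual_info ?M X Y = measure_pmf.expectation J (\<lambda>\<omega>.
      log 2 (pmf (map_pmf (\<lambda>\<omega>. (X \<omega>, Y \<omega>)) J) (X \<omega>, Y \<omega>) / (pmf (map_pmf X J) (X \<omega>) * pmf (map_pmf Y J) (Y \<omega>))))"
    unfolding mutual_info_def
    by (subst mutual_information_simple_distributed[OF simple_distributed_point_measure_pmf
          simple_distributed_point_measure_pmf simple_distributed_point_measure_pmf])
       (use sum_image_pmf[of "\<lambda>\<omega>. (X \<omega>, Y \<omega>)" "\<lambda>(x, y).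
          log 2 (pmf (map_pmf (\<lambda>\<omega>. (X \<omega>, Y \<omega>)) J) (x, y) / (pmf (map_pmf X J) x * pmf (map_pmf Y J) y))"]
        in \<open>simp add: space_point_measure split_def\<close>)
  also have "\<dots> = measure_pmf.expectation J (\<lambda>\<omega>. log 2 (dens (\<lambda>_. ()) K P (X \<omega>) (Y \<omega>)))"
  proof (rule expectation_pmf_cong)
    fix \<omega> assume \<omega>: "\<omega> \<in> set_pmf J"
    then have "X \<omega> \<in> set_pmf P" unfolding P[symmetric] by auto
    then have "pmf P (X \<omega>) \<noteq> 0" by (simp add: pmf_eq_0_set_pmf)
    then show "log 2 (pmf (map_pmf (\<lambda>\<omega>. (X \<omega>, Y \<omega>)) J) (X \<omega>, Y \<omega>) / (pmf (map_pmf X J) (X \<omega>) * pmf (map_pmf Y J) (Y \<omega>)))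
        = log 2 (dens (\<lambda>_. ()) K P (X \<omega>) (Y \<omega>))"
      unfolding K pmf_bind_map_Pair unfolding P PY by (simp add: dens_def)
  qed
  also have "\<dots> = measure_pmf.expectation (map_pmf (\<lambda>\<omega>. (X \<omega>, Y \<omega>)) J) (\<lambda>(u, y). log 2 (dens (\<lambda>_. ()) K P u y))"
    by simp
  also have "\<dots> = info (\<lambda>_. ()) K P"
    unfolding K info_def ..
  finally show ?thesis .
qed

end

section \<open>One block\<close>

text \<open>A block as a single letter: the channel's own recursion is run on one block with one
  noise value. A code function becomes a strategy by reading the position off the length of the
  list.\<close>

definition block_Y2 :: "('x1, 'x2, 'y2, 'y3, 'z) relay_channel \<Rightarrow> 'x1 list \<times> (nat \<Rightarrow> 'y2 list \<Rightarrow> 'x2) \<Rightarrow> 'z \<Rightarrow> 'y2 list" where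
  "block_Y2 ch u z = relay_outputs ch (fst u) (\<lambda>ys. snd u (length ys) ys) [z] (block_len ch)"

definition block_Y3 :: "('x1, 'x2, 'y2, 'y3, 'z) relay_channel \<Rightarrow> 'x1 list \<times> (nat \<Rightarrow> 'y2 list \<Rightarrow> 'x2) \<Rightarrow> 'z \<Rightarrow> 'y3 list" where
  "block_Y3 ch u z = dest_outputs ch (fst u) (\<lambda>ys. snd u (length ys) ys) [z] (block_len ch)"

lemma length_relay_outputs [simp]: "length (relay_outputs ch x g zs t) = t"
  by (induction t) (auto simp: Let_def)

lemma length_dest_outputs [simp]: "length (dest_outputs ch x g zs t) = t"
  by (simp add: dest_outputs_def)

lemma dest_outputs_Suc:
  "dest_outputs ch x g zs (Suc t) = dest_outputs ch x g zs t @
     [Y3_fun ch (t mod block_len ch) (block_history (block_len ch) t x)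
       (block_history (block_len ch) t (relay_inputs g (relay_outputs ch x g zs t) (Suc t))) (zs ! (t div block_len ch))]"
  by (simp add: dest_outputs_def Let_def)

lemma relay_inputs_code_function:
  assumes "length ys = t"
  shows "relay_inputs (\<lambda>ys. a (length ys) ys) ys (Suc t) = map (\<lambda>s. a s (take s ys)) [0..<Suc t]"
  using assms by (auto simp: relay_inputs_def)

lemma words_take: "xs \<in> words A n \<Longrightarrow> k \<le> n \<Longrightarrow> take k xs \<in> words A k"
  by (auto simp: words_def)

lemma words_snoc: "xs \<in> words A t \<Longrightarrow> y \<in> A t \<Longrightarrow> xs @ [y] \<in> words A (Suc t)"
  by (auto simp: words_def nth_append less_Suc_eq)

lemma finite_words: "(\<And>i. i < k \<Longrightarrow> finite (A i)) \<Longrightarrow> finite (words A k)"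
proof (induction k)
  case 0
  then show ?case by (simp add: words_def)
next
  case (Suc k)
  have "words A (Suc k) \<subseteq> (\<lambda>(xs, y). xs @ [y]) ` (words A k \<times> A k)"
  proof
    fix xs assume xs: "xs \<in> words A (Suc k)"
    then have "xs = take k xs @ [xs ! k]" "take k xs \<in> words A k" "xs ! k \<in> A k"
      by (auto simp: words_def take_Suc_conv_app_nth[symmetric])
    then show "xs \<in> (\<lambda>(xs, y). xs @ [y]) ` (words A k \<times> A k)" by force
  qed
  then show ?case
    by (rule finite_subset) (use Suc in auto)
qed

lemma words_nonempty: "(\<And>i. i < k \<Longrightarrow> A i \<noteq> {}) \<Longrightarrow> words A k \<noteq> {}"
proof -
  assume "\<And>i. i < k \<Longrightarrow> A i \<noteq> {}"
  then have "map (\<lambda>i. SOME x. x \<in> A i) [0..<k] \<in> words A k"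
    by (auto simp: words_def some_in_eq)
  then show ?thesis by blast
qed

lemma block_outputs_words:
  assumes ch: "valid_channel ch" and x: "x \<in> words (X1_alph ch) (block_len ch)"
    and a: "a \<in> code_functions ch" and z: "z \<in> set_pmf (noise ch)"
    and t: "t \<le> block_len ch"
  shows "relay_outputs ch x (\<lambda>ys. a (length ys) ys) [z] t \<in> words (Y2_alph ch) t \<and>
         dest_outputs ch x (\<lambda>ys. a (length ys) ys) [z] t \<in> words (Y3_alph ch) t"
  using t
proof (induction t)
  case 0
  then show ?case by (simp add: words_def dest_outputs_def)
next
  case (Suc t)
  let ?ys = "relay_outputs ch x (\<lambda>ys. a (length ys) ys) [z] t"
  have IH: "?ys \<in> words (Y2_alph ch) t" "dest_outputs ch x (\<lambda>ys. a (length ys) ys) [z] t \<in> words (Y3_alph ch) t"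
    using Suc by auto
  have tL: "t < block_len ch" using Suc.prems by simp
  have "a s (take s ?ys) \<in> X2_alph ch s" if "s < Suc t" for s
    using a that tL words_take[OF IH(1), of s] by (auto simp: code_functions_def PiE_iff)
  then have in2: "relay_inputs (\<lambda>ys. a (length ys) ys) ?ys (Suc t) \<in> words (X2_alph ch) (Suc t)"
    by (simp add: relay_inputs_code_function words_def del: upt_Suc)
  have hist: "block_history (block_len ch) t w = take (Suc t) w" for w :: "'q list"
    using tL by (simp add: block_history_def)
  have l: "take (Suc t) (relay_inputs (\<lambda>ys. a (length ys) ys) ?ys (Suc t)) = relay_inputs (\<lambda>ys. a (length ys) ys) ?ys (Suc t)"
    by (simp add: relay_inputs_def)
  have "take (Suc t) x \<in> words (X1_alph ch) (Suc t)"
    using x tL by (intro words_take) auto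
  then have "Y2_fun ch t (take (Suc t) x) (relay_inputs (\<lambda>ys. a (length ys) ys) ?ys (Suc t)) z \<in> Y2_alph ch t"
    "Y3_fun ch t (take (Suc t) x) (relay_inputs (\<lambda>ys. a (length ys) ys) ?ys (Suc t)) z \<in> Y3_alph ch t"
    using ch in2 z tL by (auto simp: valid_channel_def)
  then show ?case
    using IH tL by (simp add: Let_def dest_outputs_Suc hist l words_snoc)
qed

text \<open>\<open>outputs_agree\<close> uses relay inputs computed from the candidate
  \<open>y2\<close>, the run uses those computed from its own outputs. They coincide as long as the
  earlier outputs agree, which is what the induction on \<open>t\<close> exploits.\<close>

lemma outputs_agree_iff:
  assumes len: "length x2 = block_len ch" "length y2 = block_len ch" "length y3 = block_len ch"
    and x2: "\<And>i. i < block_len ch \<Longrightarrow> x2 ! i = a i (take i y2)"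
    and t: "t \<le> block_len ch"
  shows "(\<forall>j<t. outputs_agree ch x1 x2 y2 y3 j z) \<longleftrightarrow>
     relay_outputs ch x1 (\<lambda>ys. a (length ys) ys) [z] t = take t y2 \<and>
     dest_outputs ch x1 (\<lambda>ys. a (length ys) ys) [z] t = take t y3"
  using t
proof (induction t)
  case 0
  then show ?case by (simp add: dest_outputs_def)
next
  case (Suc t)
  let ?ys = "relay_outputs ch x1 (\<lambda>ys. a (length ys) ys) [z] t"
  have tL: "t < block_len ch" using Suc.prems by simp
  have hist: "block_history (block_len ch) t w = take (Suc t) w" for w :: "'q list"
    using tL by (simp add: block_history_def)
  have inp: "take (Suc t) (relay_inputs (\<lambda>ys. a (length ys) ys) ?ys (Suc t)) = take (Suc t) x2" if "?ys = take t y2"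
  proof -
    have "relay_inputs (\<lambda>ys. a (length ys) ys) ?ys (Suc t) = map (\<lambda>s. a s (take s ?ys)) [0..<Suc t]"
      by (rule relay_inputs_code_function) simp
    also have "\<dots> = take (Suc t) x2"
      using tL len by (intro nth_equalityI) (auto simp: that x2 simp del: upt_Suc)
    finally show ?thesis by simp
  qed
  have "(\<forall>j<Suc t. outputs_agree ch x1 x2 y2 y3 j z) \<longleftrightarrow>
      (?ys = take t y2 \<and> dest_outputs ch x1 (\<lambda>ys. a (length ys) ys) [z] t = take t y3) \<and> outputs_agree ch x1 x2 y2 y3 t z"
    using Suc by (auto simp: less_Suc_eq)
  also have "\<dots> \<longleftrightarrow> relay_outputs ch x1 (\<lambda>ys. a (length ys) ys) [z] (Suc t) = take (Suc t) y2 \<and>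
     dest_outputs ch x1 (\<lambda>ys. a (length ys) ys) [z] (Suc t) = take (Suc t) y3"
    using tL len inp by (auto simp: Let_def dest_outputs_Suc hist take_Suc_conv_app_nth outputs_agree_def)
  finally show ?case .
qed

section \<open>The block law as the law of a simulated block\<close>

text \<open>The conditional probabilities telescope. If the past has probability 0, the factor is 0
  by the convention for division, and so is the probability of the smaller event.\<close>

lemma block_law_eq:
  "block_law ch x1 x2 y2 y3 = measure_pmf.prob (noise ch) {z. \<forall>i<block_len ch. outputs_agree ch x1 x2 y2 y3 i z}"
proof -
  let ?A = "\<lambda>n. {z. \<forall>i<n. outputs_agree ch x1 x2 y2 y3 i z}"
  have "(\<Prod>i<n. \<P>(z in measure_pmf (noise ch). outputs_agree ch x1 x2 y2 y3 i z \<bar> \<forall>j<i. outputs_agree ch x1 x2 y2 y3 j z))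
     = measure_pmf.prob (noise ch) (?A n)" for n
  proof (induction n)
    case (Suc n)
    have "?A (Suc n) = {z. outputs_agree ch x1 x2 y2 y3 n z \<and> (\<forall>j<n. outputs_agree ch x1 x2 y2 y3 j z)}"
      by (auto simp: less_Suc_eq)
    moreover have "measure_pmf.prob (noise ch) (?A (Suc n)) \<le> measure_pmf.prob (noise ch) (?A n)"
      by (intro measure_pmf.finite_measure_mono) auto
    ultimately show ?case
      using Suc by (auto simp: cond_prob_def measure_le_0_iff)
  qed simp
  then show ?thesis by (simp add: block_law_def)
qed

definition block_sample :: "('x1, 'x2, 'y2, 'y3, 'z) relay_channel \<Rightarrow> 'x1 list \<times> (nat \<Rightarrow> 'y2 list \<Rightarrow> 'x2) \<Rightarrow> 'z \<Rightarrow>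
    'x2 list \<times> 'y2 list \<times> 'y3 list" where
  "block_sample ch u z =
     (map (\<lambda>i. snd u i (take i (block_Y2 ch u z))) [0..<block_len ch], block_Y2 ch u z, block_Y3 ch u z)"

definition block_pmf :: "('x1, 'x2, 'y2, 'y3, 'z) relay_channel \<Rightarrow> ('x1 list \<times> (nat \<Rightarrow> 'y2 list \<Rightarrow> 'x2)) pmf \<Rightarrow>
    ('x1 list \<times> (nat \<Rightarrow> 'y2 list \<Rightarrow> 'x2) \<times> 'x2 list \<times> 'y2 list \<times> 'y3 list) pmf" where
  "block_pmf ch P = map_pmf (\<lambda>((x1, a), s). (x1, a, s))
     (bind_pmf P (\<lambda>u. map_pmf (Pair u) (map_pmf (block_sample ch u) (noise ch))))"

text \<open>If \<open>x2\<close> is consistent with \<open>y2\<close>, the noise values that produce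
  the triple are those for which all outputs agree; otherwise indicator and probability both
  vanish.\<close>

lemma pmf_block_pmf:
  assumes "length x2 = block_len ch" "length y2 = block_len ch" "length y3 = block_len ch"
  shows "pmf (block_pmf ch P) (x1, a, x2, y2, y3) = pmf P (x1, a) * relay_indicator (block_len ch) x2 a y2 * block_law ch x1 x2 y2 y3"
proof -
  have inj: "inj (\<lambda>((x1, a), s). (x1, a, s))" by (auto simp: inj_on_def)
  have "pmf (block_pmf ch P) (x1, a, x2, y2, y3)
      = pmf (bind_pmf P (\<lambda>u. map_pmf (Pair u) (map_pmf (block_sample ch u) (noise ch)))) ((x1, a), (x2, y2, y3))"
    unfolding block_pmf_def by (subst pmf_map_inj'[OF inj, symmetric]) simp
  also have "\<dots> = pmf P (x1, a) * measure_pmf.prob (noise ch) {z. block_sample ch (x1, a) z = (x2, y2, y3)}"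
    by (simp add: pmf_bind_map_Pair pmf_map vimage_def)
  also have "measure_pmf.prob (noise ch) {z. block_sample ch (x1, a) z = (x2, y2, y3)}
      = relay_indicator (block_len ch) x2 a y2 * block_law ch x1 x2 y2 y3"
  proof (cases "\<forall>i<block_len ch. x2 ! i = a i (take i y2)")
    case True
    then have x2: "x2 = map (\<lambda>i. a i (take i y2)) [0..<block_len ch]"
      using assms(1) by (intro nth_equalityI) auto
    have "block_sample ch (x1, a) z = (x2, y2, y3) \<longleftrightarrow> (\<forall>j<block_len ch. outputs_agree ch x1 x2 y2 y3 j z)" for z
      using outputs_agree_iff[OF assms, of a "block_len ch" x1 z] True assms x2
      by (auto simp: block_sample_def block_Y2_def block_Y3_def)
    then show ?thesis using True by (simp add: block_law_eq relay_indicator_def)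
  next
    case False
    then have "block_sample ch (x1, a) z \<noteq> (x2, y2, y3)" for z
      by (auto simp: block_sample_def)
    then show ?thesis using False by (simp add: relay_indicator_def)
  qed
  finally show ?thesis by simp
qed

lemma finite_code_functions: "valid_channel ch \<Longrightarrow> finite (code_functions ch)"
  unfolding code_functions_def valid_channel_def
  by (intro finite_PiE finite_words) auto

lemma finite_input_set:
  "valid_channel ch \<Longrightarrow> finite (words (X1_alph ch) (block_len ch) \<times> code_functions ch)"
  by (intro finite_cartesian_product finite_words finite_code_functions) (auto simp: valid_channel_def)

lemma input_set_nonempty:
  assumes "valid_channel ch"
  shows "words (X1_alph ch) (block_len ch) \<times> code_functions ch \<noteq> {}"
proof -
  have "words (X1_alph ch) (block_len ch) \<noteq> {}"
    using assms by (intro words_nonempty) (auto simp: valid_channel_def)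
  moreover have "code_functions ch \<noteq> {}"
    using assms by (simp add: code_functions_def PiE_eq_empty_iff valid_channel_def)
  ultimately show ?thesis by simp
qed

lemma block_words:
  assumes "valid_channel ch" "u \<in> words (X1_alph ch) (block_len ch) \<times> code_functions ch" "z \<in> set_pmf (noise ch)"
  shows "block_Y2 ch u z \<in> words (Y2_alph ch) (block_len ch)" "block_Y3 ch u z \<in> words (Y3_alph ch) (block_len ch)"
  using block_outputs_words[OF assms(1) _ _ assms(3), of "fst u" "snd u" "block_len ch"] assms(2)
  by (auto simp: block_Y2_def block_Y3_def)

definition block_set :: "('x1, 'x2, 'y2, 'y3, 'z) relay_channel \<Rightarrow>
    ('x1 list \<times> (nat \<Rightarrow> 'y2 list \<Rightarrow> 'x2) \<times> 'x2 list \<times> 'y2 list \<times> 'y3 list) set" where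
  "block_set ch = words (X1_alph ch) (block_len ch) \<times> code_functions ch \<times> words (X2_alph ch) (block_len ch) \<times>
         words (Y2_alph ch) (block_len ch) \<times> words (Y3_alph ch) (block_len ch)"

lemma finite_block_set: "valid_channel ch \<Longrightarrow> finite (block_set ch)"
  unfolding block_set_def
  by (intro finite_cartesian_product finite_words finite_code_functions) (auto simp: valid_channel_def)

lemma set_block_pmf:
  assumes ch: "valid_channel ch" and P: "P \<in> input_dists ch"
  shows "set_pmf (block_pmf ch P) \<subseteq> block_set ch"
proof
  fix \<omega> assume "\<omega> \<in> set_pmf (block_pmf ch P)"
  then obtain x a z where u: "(x, a) \<in> set_pmf P" and z: "z \<in> set_pmf (noise ch)"
    and \<omega>: "\<omega> = (x, a, block_sample ch (x, a) z)"
    by (auto simp: block_pmf_def)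
  have u': "(x, a) \<in> words (X1_alph ch) (block_len ch) \<times> code_functions ch"
    using u P by (auto simp: input_dists_def)
  note w = block_words[OF ch u' z]
  have "a i (take i (block_Y2 ch (x, a) z)) \<in> X2_alph ch i" if "i < block_len ch" for i
    using u' that words_take[OF w(1), of i] by (auto simp: code_functions_def PiE_iff)
  then have "map (\<lambda>i. a i (take i (block_Y2 ch (x, a) z))) [0..<block_len ch] \<in> words (X2_alph ch) (block_len ch)"
    by (auto simp: words_def)
  then show "\<omega> \<in> block_set ch"
    using u' w by (simp add: \<omega> block_set_def block_sample_def)
qed

lemma block_space_eq:
  "block_space ch P = point_measure (block_set ch) (\<lambda>\<omega>. ennreal (pmf (block_pmf ch P) \<omega>))"
  unfolding block_space_def Let_def block_set_def[symmetric] point_measure_def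
proof (rule density_cong)
  show "AE \<omega> in count_space (block_set ch).
      (case \<omega> of (x1, a, x2, y2, y3) \<Rightarrow> ennreal (pmf P (x1, a) * relay_indicator (block_len ch) x2 a y2 * block_law ch x1 x2 y2 y3))
      = ennreal (pmf (block_pmf ch P) \<omega>)"
    by (auto simp: AE_count_space block_set_def words_def pmf_block_pmf)
qed auto

lemma block_marginal:
  "map_pmf (\<lambda>\<omega>. ((rv_X1 \<omega>, rv_A2 \<omega>), f (rv_Y2 \<omega>) (rv_Y3 \<omega>))) (block_pmf ch P)
     = bind_pmf P (\<lambda>u. map_pmf (Pair u) (map_pmf (\<lambda>z. f (block_Y2 ch u z) (block_Y3 ch u z)) (noise ch)))"
  by (simp add: block_pmf_def map_pmf_comp map_bind_pmf split_def rv_X1_def rv_A2_def rv_Y2_def rv_Y3_def block_sample_def)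

lemma degraded_objective_eq:
  assumes "valid_channel ch" "P \<in> input_dists ch"
  shows "degraded_objective ch P = min (info snd (\<lambda>u. map_pmf (block_Y2 ch u) (noise ch)) P)
      (info (\<lambda>_. ()) (\<lambda>u. map_pmf (block_Y3 ch u) (noise ch)) P)"
  unfolding degraded_objective_def block_space_eq
  using cond_mutual_info_eq_info[OF finite_block_set set_block_pmf block_marginal[of "\<lambda>y v. y" ch P]]
    mutual_info_eq_info[OF finite_block_set set_block_pmf block_marginal[of "\<lambda>y v. v" ch P]] assms
  by simp

lemma measure_cond_pmf:
  assumes "set_pmf p \<inter> s \<noteq> {}"
  shows "measure_pmf.prob (cond_pmf p s) T = measure_pmf.prob p (s \<inter> T) / measure_pmf.prob p s"
  by (simp add: cond_pmf.rep_eq[OF assms] emeasure_measure_pmf_not_zero[OF assms])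

text \<open>The Markov property is applied to the uniform input law, which gives every pair
  \<open>(x, a)\<close> positive probability. The conditional law of the destination output given
  \<open>(a, y)\<close> under it is then one kernel that serves all \<open>x\<close>.\<close>

lemma degraded_kernel:
  assumes ch: "valid_channel ch" and deg: "physically_degraded ch"
  obtains V where "\<And>x a. x \<in> words (X1_alph ch) (block_len ch) \<Longrightarrow> a \<in> code_functions ch \<Longrightarrow>
      map_pmf (\<lambda>z. (block_Y2 ch (x, a) z, block_Y3 ch (x, a) z)) (noise ch)
        = bind_pmf (map_pmf (block_Y2 ch (x, a)) (noise ch)) (\<lambda>y. map_pmf (Pair y) (V a y))"
proof -
  let ?D = "words (X1_alph ch) (block_len ch) \<times> code_functions ch"
  define P where "P = pmf_of_set ?D"
  have setP: "set_pmf P = ?D"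
    unfolding P_def by (rule set_pmf_of_set[OF input_set_nonempty[OF ch] finite_input_set[OF ch]])
  then have Pin: "P \<in> input_dists ch" by (simp add: input_dists_def)
  let ?J = "block_pmf ch P"
  have prob: "\<P>(\<omega> in block_space ch P. Q \<omega>) = measure_pmf.prob ?J {\<omega>. Q \<omega>}" for Q
  proof -
    have "\<P>(\<omega> in block_space ch P. Q \<omega>) = measure_pmf.prob ?J {\<omega> \<in> block_set ch. Q \<omega>}"
      unfolding block_space_eq
      by (subst measure_point_measure_pmf[OF finite_block_set[OF ch] set_block_pmf[OF ch Pin]]) (auto simp: space_point_measure)
    also have "\<dots> = measure_pmf.prob ?J {\<omega>. Q \<omega>}"
      using set_block_pmf[OF ch Pin] by (intro measure_prob_cong_0) (auto simp: pmf_eq_0_set_pmf)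
    finally show ?thesis .
  qed
  define V where "V a y = map_pmf rv_Y3 (cond_pmf ?J {\<omega>. (rv_A2 \<omega>, rv_Y2 \<omega>) = (a, y)})" for a y
  show ?thesis
  proof (rule that, rule pmf_eqI, clarify)
    fix x a y v assume xa: "x \<in> words (X1_alph ch) (block_len ch)" "a \<in> code_functions ch"
    let ?K2 = "map_pmf (block_Y2 ch (x, a)) (noise ch)"
    let ?K23 = "map_pmf (\<lambda>z. (block_Y2 ch (x, a) z, block_Y3 ch (x, a) z)) (noise ch)"
    have P0: "pmf P (x, a) \<noteq> 0" using xa by (simp add: pmf_eq_0_set_pmf setP)
    have K2: "pmf P (x, a) * pmf ?K2 y = measure_pmf.prob ?J {\<omega>. rv_X1 \<omega> = x \<and> (rv_A2 \<omega>, rv_Y2 \<omega>) = (a, y)}"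
      using arg_cong[OF block_marginal[of "\<lambda>y v. y" ch P], of "\<lambda>p. pmf p ((x, a), y)"]
      unfolding pmf_bind_map_Pair by (simp add: pmf_map vimage_def conj_assoc)
    have K23: "pmf P (x, a) * pmf ?K23 (y, v)
        = measure_pmf.prob ?J {\<omega>. rv_Y3 \<omega> = v \<and> rv_X1 \<omega> = x \<and> (rv_A2 \<omega>, rv_Y2 \<omega>) = (a, y)}"
      using arg_cong[OF block_marginal[of "\<lambda>y v. (y, v)" ch P], of "\<lambda>p. pmf p ((x, a), (y, v))"]
      unfolding pmf_bind_map_Pair by (simp add: pmf_map vimage_def conj_ac)
    show "pmf ?K23 (y, v) = pmf (bind_pmf ?K2 (\<lambda>y. map_pmf (Pair y) (V a y))) (y, v)"
    proof (cases "pmf ?K2 y = 0")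
      \<comment> \<open>The Markov condition is silent about outputs of probability 0; here both
        sides are 0.\<close>
      case True
      have "pmf ?K23 (y, v) \<le> pmf ?K2 y"
        by (auto simp: pmf_map intro!: measure_pmf.finite_measure_mono)
      then show ?thesis using True by (simp add: pmf_bind_map_Pair)
    next
      case False
      have pos: "measure_pmf.prob ?J {\<omega>. rv_X1 \<omega> = x \<and> (rv_A2 \<omega>, rv_Y2 \<omega>) = (a, y)} > 0"
        unfolding K2[symmetric] using P0 False by (simp add: zero_less_mult_iff less_le)
      have ne: "set_pmf ?J \<inter> {\<omega>. (rv_A2 \<omega>, rv_Y2 \<omega>) = (a, y)} \<noteq> {}"
      proof
        assume "set_pmf ?J \<inter> {\<omega>. (rv_A2 \<omega>, rv_Y2 \<omega>) = (a, y)} = {}"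
        then have "measure_pmf.prob ?J {\<omega>. rv_X1 \<omega> = x \<and> (rv_A2 \<omega>, rv_Y2 \<omega>) = (a, y)} = 0"
          by (auto simp: measure_pmf_zero_iff)
        then show False using pos by simp
      qed
      have "markov_chain (block_space ch P) rv_X1 (\<lambda>\<omega>. (rv_A2 \<omega>, rv_Y2 \<omega>)) rv_Y3"
        using deg Pin by (simp add: physically_degraded_def)
      then have "measure_pmf.prob ?J {\<omega>. rv_Y3 \<omega> = v \<and> rv_X1 \<omega> = x \<and> (rv_A2 \<omega>, rv_Y2 \<omega>) = (a, y)} /
            measure_pmf.prob ?J {\<omega>. rv_X1 \<omega> = x \<and> (rv_A2 \<omega>, rv_Y2 \<omega>) = (a, y)}
          = measure_pmf.prob ?J {\<omega>. rv_Y3 \<omega> = v \<and> (rv_A2 \<omega>, rv_Y2 \<omega>) = (a, y)} /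
            measure_pmf.prob ?J {\<omega>. (rv_A2 \<omega>, rv_Y2 \<omega>) = (a, y)}"
        using pos unfolding markov_chain_def cond_prob_def prob by blast
      also have "\<dots> = pmf (V a y) v"
        unfolding V_def pmf_map measure_cond_pmf[OF ne]
        by (simp add: vimage_def Collect_conj_eq[symmetric] Int_def conj_ac)
      finally have "pmf (V a y) v = pmf ?K23 (y, v) / pmf ?K2 y"
        using P0 by (simp only: K2[symmetric] K23[symmetric]) simp
      then show ?thesis using False by (simp add: pmf_bind_map_Pair)
    qed
  qed
qed

section \<open>Existence of an optimal input distribution\<close>

definition xlogx :: "real \<Rightarrow> real" where
  "xlogx t = t * log 2 t"

lemma continuous_on_xlogx: "continuous_on {0..} xlogx"
  unfolding continuous_on_eq_continuous_within
proof
  fix t :: real assume "t \<in> {0..}"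
  then consider "t = 0" | "t > 0" by fastforce
  then show "continuous (at t within {0..}) xlogx"
  proof cases
    case 1
    have "((\<lambda>t::real. t * ln t) \<longlongrightarrow> 0) (at_right 0)" by real_asymp
    then have "((\<lambda>t::real. t * ln t / ln 2) \<longlongrightarrow> 0 / ln 2) (at_right 0)" by (intro tendsto_intros) auto
    then have "(xlogx \<longlongrightarrow> 0) (at_right 0)" by (simp add: xlogx_def[abs_def] log_def)
    moreover have "at 0 within {0..} = at_right (0::real)"
      by (rule at_within_Ici_at_right)
    ultimately show ?thesis using 1 by (simp add: continuous_within xlogx_def)
  next
    case 2
    then have "isCont (\<lambda>t. t * log 2 t) t"
      by (intro continuous_intros) auto
    then show ?thesis
      unfolding xlogx_def[abs_def] by (rule continuous_at_imp_continuous_at_within)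
  qed
qed

text \<open>With C for the value of \<open>\<kappa>\<close> at the input U and Y for the output, the
  three terms are -H(Y|U), -H(C) and H(C,Y), so the sum is H(Y|C) - H(Y|U). No conditional law given
  C appears, and \<open>xlogx\<close> is continuous at 0, so fibres of mass 0 do no harm.\<close>

definition simplex_info :: "('u \<Rightarrow> 'c) \<Rightarrow> ('u \<Rightarrow> 'y pmf) \<Rightarrow> 'u set \<Rightarrow> ('u \<Rightarrow> real) \<Rightarrow> real" where
  "simplex_info \<kappa> K D f =
     (\<Sum>u\<in>D. f u * (\<Sum>y\<in>(\<Union>u\<in>D. set_pmf (K u)). xlogx (pmf (K u) y)))
     + (\<Sum>c\<in>\<kappa> ` D. xlogx (\<Sum>u\<in>{u\<in>D. \<kappa> u = c}. f u))
     - (\<Sum>y\<in>(\<Union>u\<in>D. set_pmf (K u)). \<Sum>c\<in>\<kappa> ` D. xlogx (\<Sum>u\<in>{u\<in>D. \<kappa> u = c}. f u * pmf (K u) y))"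

lemma info_eq_simplex_info:
  assumes D: "finite D" "set_pmf P \<subseteq> D" and finK: "\<And>u. finite (set_pmf (K u))"
  shows "info \<kappa> K P = simplex_info \<kappa> K D (pmf P)"
proof -
  let ?Y = "\<Union>u\<in>D. set_pmf (K u)"
  have finY: "finite ?Y" using D finK by auto
  let ?m = "\<lambda>c. \<Sum>u\<in>{u\<in>D. \<kappa> u = c}. pmf P u"
  let ?j = "\<lambda>c y. \<Sum>u\<in>{u\<in>D. \<kappa> u = c}. pmf P u * pmf (K u) y"
  have finP: "finite (set_pmf P)" using D finite_subset by blast
  have m: "pmf (map_pmf \<kappa> P) c = ?m c" for c
  proof -
    have "pmf (map_pmf \<kappa> P) c = measure_pmf.prob P {u\<in>D. \<kappa> u = c}"
      unfolding pmf_map using D by (intro measure_prob_cong_0) (auto simp: pmf_eq_0_set_pmf)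
    then show ?thesis using D by (simp add: measure_measure_pmf_finite)
  qed
  \<comment> \<open>Times the mass of its fibre, the reference law becomes a joint mass that is
    linear in \<open>P\<close>; the conditioning is gone.\<close>
  have j: "?j (\<kappa> u) y = ?m (\<kappa> u) * pmf (ref_law \<kappa> K P (\<kappa> u)) y" if "u \<in> set_pmf P" for u y
  proof -
    have ne: "set_pmf P \<inter> {v. \<kappa> v = \<kappa> u} \<noteq> {}" using that by (rule fibre_ne)
    define \<mu> where "\<mu> = measure_pmf.prob P {v. \<kappa> v = \<kappa> u}"
    have m\<mu>: "?m (\<kappa> u) = \<mu>"
      using m[of "\<kappa> u"] by (simp only: pmf_map vimage_def \<mu>_def) simp
    have \<mu>: "\<mu> \<noteq> 0"
      unfolding \<mu>_def by (rule measure_measure_pmf_not_zero[OF ne])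
    have "pmf (ref_law \<kappa> K P (\<kappa> u)) y = (\<Sum>v\<in>D. pmf (cond_pmf P {v. \<kappa> v = \<kappa> u}) v * pmf (K v) y)"
      unfolding ref_law_def pmf_bind using D
      by (subst integral_measure_pmf[of D]) (auto simp: set_cond_pmf[OF ne])
    also have "\<dots> = (\<Sum>v\<in>D. if \<kappa> v = \<kappa> u then pmf P v / \<mu> * pmf (K v) y else 0)"
      by (intro sum.cong) (auto simp: pmf_cond[OF ne] \<mu>_def)
    also have "\<dots> = (\<Sum>v\<in>{v\<in>D. \<kappa> v = \<kappa> u}. pmf P v / \<mu> * pmf (K v) y)"
      by (rule sum.inter_filter[OF D(1), symmetric])
    finally have ref: "pmf (ref_law \<kappa> K P (\<kappa> u)) y = (\<Sum>v\<in>{v\<in>D. \<kappa> v = \<kappa> u}. pmf P v / \<mu> * pmf (K v) y)" .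
    show ?thesis
      unfolding m\<mu> ref sum_distrib_left using \<mu> by (intro sum.cong refl) simp
  qed
  \<comment> \<open>The quotient in \<open>dens\<close> splits into logarithms only where the joint
    mass is positive. Elsewhere every term carries a factor 0.\<close>
  have summand: "pmf P u * pmf (K u) y * log 2 (dens \<kappa> K P u y)
      = pmf P u * xlogx (pmf (K u) y) + pmf P u * pmf (K u) y * log 2 (?m (\<kappa> u))
        - pmf P u * pmf (K u) y * log 2 (?j (\<kappa> u) y)" for u y
  proof (cases "pmf P u = 0 \<or> pmf (K u) y = 0")
    case False
    then have u: "u \<in> set_pmf P" and y: "y \<in> set_pmf (K u)" by (auto simp: set_pmf_iff)
    have q: "0 < pmf (ref_law \<kappa> K P (\<kappa> u)) y"
      using dens_pos[where \<kappa> = \<kappa> and K = K, OF u y] by (simp add: dens_def zero_less_divide_iff)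
    have mp: "0 < ?m (\<kappa> u)" unfolding m[symmetric] using u by (intro pmf_positive) auto
    have "log 2 (dens \<kappa> K P u y) = log 2 (pmf (K u) y) + log 2 (?m (\<kappa> u)) - log 2 (?j (\<kappa> u) y)"
      unfolding j[OF u] using q mp pmf_positive[OF y] by (simp add: dens_def log_divide log_mult)
    then show ?thesis
      by (simp only: xlogx_def right_diff_distrib distrib_left mult.assoc)
  next
    case True
    then show ?thesis
      by (elim disjE) (simp_all only: xlogx_def mult_zero_left mult_zero_right add_0 diff_self)
  qed
  have fibre_sum: "(\<Sum>u\<in>D. b u * log 2 (\<Sum>v\<in>{v\<in>D. \<kappa> v = \<kappa> u}. b v))
      = (\<Sum>c\<in>\<kappa> ` D. xlogx (\<Sum>u\<in>{u\<in>D. \<kappa> u = c}. b u))" for b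
  proof -
    define B where "B c = (\<Sum>u\<in>{u\<in>D. \<kappa> u = c}. b u)" for c
    have "(\<Sum>u\<in>D. b u * log 2 (B (\<kappa> u))) = (\<Sum>c\<in>\<kappa> ` D. \<Sum>u\<in>{u\<in>D. \<kappa> u = c}. b u * log 2 (B (\<kappa> u)))"
      by (rule sum.image_gen[OF D(1)])
    also have "\<dots> = (\<Sum>c\<in>\<kappa> ` D. \<Sum>u\<in>{u\<in>D. \<kappa> u = c}. b u * log 2 (B c))"
      by (intro sum.cong refl) auto
    also have "\<dots> = (\<Sum>c\<in>\<kappa> ` D. xlogx (B c))"
      by (simp only: xlogx_def sum_distrib_right[symmetric] B_def[symmetric])
    finally show ?thesis by (simp only: B_def)
  qed
  have "info \<kappa> K P = (\<Sum>u\<in>D. \<Sum>y\<in>?Y. pmf P u * pmf (K u) y * log 2 (dens \<kappa> K P u y))"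
  proof -
    have "info \<kappa> K P = measure_pmf.expectation P (\<lambda>u. measure_pmf.expectation (K u) (\<lambda>y. log 2 (dens \<kappa> K P u y)))"
      unfolding info_def using finP finK by (simp add: expectation_bind_pmf_finite)
    also have "\<dots> = (\<Sum>u\<in>D. pmf P u * measure_pmf.expectation (K u) (\<lambda>y. log 2 (dens \<kappa> K P u y)))"
      using D by (subst integral_measure_pmf[of D]) auto
    also have "\<dots> = (\<Sum>u\<in>D. pmf P u * (\<Sum>y\<in>?Y. pmf (K u) y * log 2 (dens \<kappa> K P u y)))"
    proof (intro sum.cong refl arg_cong2[where f = "(*)"])
      fix u assume "u \<in> D"
      then show "measure_pmf.expectation (K u) (\<lambda>y. log 2 (dens \<kappa> K P u y)) = (\<Sum>y\<in>?Y. pmf (K u) y * log 2 (dens \<kappa> K P u y))"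
        using finY by (subst integral_measure_pmf[of ?Y]) auto
    qed
    finally show ?thesis by (simp only: sum_distrib_left mult.assoc)
  qed
  also have "\<dots> = (\<Sum>u\<in>D. pmf P u * (\<Sum>y\<in>?Y. xlogx (pmf (K u) y)))
      + (\<Sum>u\<in>D. \<Sum>y\<in>?Y. pmf P u * pmf (K u) y * log 2 (?m (\<kappa> u)))
      - (\<Sum>u\<in>D. \<Sum>y\<in>?Y. pmf P u * pmf (K u) y * log 2 (?j (\<kappa> u) y))"
    unfolding summand sum.distrib sum_subtractf sum_distrib_left ..
  also have "(\<Sum>u\<in>D. \<Sum>y\<in>?Y. pmf P u * pmf (K u) y * log 2 (?m (\<kappa> u))) = (\<Sum>c\<in>\<kappa> ` D. xlogx (?m c))"
  proof -
    have "(\<Sum>y\<in>?Y. pmf P u * pmf (K u) y * b) = pmf P u * b" if "u \<in> D" for u b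
    proof -
      have "(\<Sum>y\<in>?Y. pmf (K u) y) = 1" using that finY by (intro sum_pmf_eq_1) auto
      then show ?thesis
        by (simp only: sum_distrib_left[symmetric] sum_distrib_right[symmetric] mult_1_right)
    qed
    then have "(\<Sum>u\<in>D. \<Sum>y\<in>?Y. pmf P u * pmf (K u) y * log 2 (?m (\<kappa> u))) = (\<Sum>u\<in>D. pmf P u * log 2 (?m (\<kappa> u)))"
      by (rule sum.cong[OF refl])
    also have "\<dots> = (\<Sum>c\<in>\<kappa> ` D. xlogx (?m c))"
      by (rule fibre_sum)
    finally show ?thesis .
  qed
  also have "(\<Sum>u\<in>D. \<Sum>y\<in>?Y. pmf P u * pmf (K u) y * log 2 (?j (\<kappa> u) y)) = (\<Sum>y\<in>?Y. \<Sum>c\<in>\<kappa> ` D. xlogx (?j c y))"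
    by (subst sum.swap, rule sum.cong[OF refl], rule fibre_sum)
  finally show ?thesis by (simp add: simplex_info_def)
qed

lemma continuous_on_simplex_info:
  "continuous_on {f. \<forall>u. 0 \<le> f u} (simplex_info \<kappa> K D)"
proof -
  have c: "continuous_on {f. \<forall>u. 0 \<le> f u} (\<lambda>f. xlogx (\<Sum>u\<in>E. f u * b u))" if "\<And>u. 0 \<le> b u" for E and b :: "'a \<Rightarrow> real"
    using that
    by (intro continuous_on_compose2[OF continuous_on_xlogx] continuous_intros continuous_on_subset[OF continuous_on_product_coordinates])
       (auto intro!: sum_nonneg)
  have c1: "continuous_on {f. \<forall>u. 0 \<le> f u} (\<lambda>f. xlogx (\<Sum>u\<in>E. f u))" for E :: "'a set"
    using c[of "\<lambda>_. 1" E] by simp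
  show ?thesis
    unfolding simplex_info_def
    by (intro continuous_intros c c1 continuous_on_subset[OF continuous_on_product_coordinates]) auto
qed

text \<open>Tychonoff: coordinates range over the unit interval on \<open>D\<close> and over
  \<open>{0}\<close> elsewhere, and the total mass is a continuous function of finitely many of
  them.\<close>

lemma compact_simplex:
  assumes "finite D"
  shows "compact {f :: 'u \<Rightarrow> real. (\<forall>u. 0 \<le> f u) \<and> (\<forall>u. u \<notin> D \<longrightarrow> f u = 0) \<and> sum f D = 1}" (is "compact ?\<Delta>")
proof -
  let ?S = "\<lambda>u::'u. if u \<in> D then {0..1::real} else {0}"
  have "compactin (product_topology (\<lambda>_. euclidean) UNIV) (PiE UNIV ?S)"
    unfolding compactin_PiE by auto
  then have "compact (PiE UNIV ?S)" by (simp add: euclidean_product_topology)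
  moreover have "closed {f :: 'u \<Rightarrow> real. sum f D = 1}"
    by (intro closed_Collect_eq continuous_on_sum continuous_on_const continuous_on_product_coordinates)
  moreover have "?\<Delta> = PiE UNIV ?S \<inter> {f. sum f D = 1}"
  proof (intro equalityI subsetI)
    fix f assume f: "f \<in> ?\<Delta>"
    then have "f u \<le> 1" if "u \<in> D" for u
      using member_le_sum[of u D f] that assms by auto
    then show "f \<in> PiE UNIV ?S \<inter> {f. sum f D = 1}"
      using f by auto
  next
    fix f assume "f \<in> PiE UNIV ?S \<inter> {f. sum f D = 1}"
    then have f: "f u \<in> ?S u" "sum f D = 1" for u using PiE_mem[of f UNIV ?S u] by blast+
    then have "0 \<le> f u" "u \<notin> D \<Longrightarrow> f u = 0" for u
      using f(1)[of u] by (cases "u \<in> D"; simp)+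
    then show "f \<in> ?\<Delta>" using f(2) by blast
  qed
  ultimately show ?thesis by (simp add: compact_Int_closed)
qed

lemma ex_optimal_pmf:
  fixes g :: "('u \<Rightarrow> real) \<Rightarrow> real"
  assumes D: "finite D" "D \<noteq> {}" and g: "continuous_on {f. \<forall>u. 0 \<le> f u} g"
  shows "\<exists>P. set_pmf P \<subseteq> D \<and> (\<forall>Q. set_pmf Q \<subseteq> D \<longrightarrow> g (pmf Q) \<le> g (pmf P))"
proof -
  let ?\<Delta> = "{f :: 'u \<Rightarrow> real. (\<forall>u. 0 \<le> f u) \<and> (\<forall>u. u \<notin> D \<longrightarrow> f u = 0) \<and> sum f D = 1}"
  have pmf_in: "pmf Q \<in> ?\<Delta>" if "set_pmf Q \<subseteq> D" for Q
    using that D by (auto simp: sum_pmf_eq_1 pmf_eq_0_set_pmf)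
  have "pmf (pmf_of_set D) \<in> ?\<Delta>" using D by (intro pmf_in) simp
  then have "?\<Delta> \<noteq> {}" by blast
  then obtain f where f: "f \<in> ?\<Delta>" "\<And>h. h \<in> ?\<Delta> \<Longrightarrow> g h \<le> g f"
    using continuous_attains_sup[OF compact_simplex[OF D(1)] _ continuous_on_subset[OF g]] by (smt (verit) Collect_mono)
  have "(\<integral>\<^sup>+u. ennreal (f u) \<partial>count_space UNIV) = (\<Sum>u\<in>D. ennreal (f u))"
    using f(1) D by (intro nn_integral_count_space'[where A = D]) auto
  also have "\<dots> = 1" using f(1) by (simp add: sum_ennreal)
  finally have P: "pmf (embed_pmf f) = f"
    using f(1) by (intro ext pmf_embed_pmf) auto
  have "set_pmf (embed_pmf f) \<subseteq> D" using f(1) by (auto simp: set_pmf_iff P)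
  then show ?thesis using f(2) pmf_in by (intro exI[of _ "embed_pmf f"]) (auto simp: P)
qed

lemma ex_optimal_input:
  assumes ch: "valid_channel ch"
  shows "\<exists>P\<in>input_dists ch. \<forall>Q\<in>input_dists ch. degraded_objective ch Q \<le> degraded_objective ch P"
proof -
  let ?D = "words (X1_alph ch) (block_len ch) \<times> code_functions ch"
  let ?K2 = "\<lambda>u. map_pmf (block_Y2 ch u) (noise ch)" and ?K3 = "\<lambda>u. map_pmf (block_Y3 ch u) (noise ch)"
  let ?g = "\<lambda>f. min (simplex_info snd ?K2 ?D f) (simplex_info (\<lambda>_. ()) ?K3 ?D f)"
  have fin: "finite (set_pmf (noise ch))" using ch by (simp add: valid_channel_def)
  have "degraded_objective ch P = ?g (pmf P)" if "P \<in> input_dists ch" for P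
  proof -
    have "set_pmf P \<subseteq> ?D" using that by (simp add: input_dists_def)
    then have "info snd ?K2 P = simplex_info snd ?K2 ?D (pmf P)"
      "info (\<lambda>_. ()) ?K3 P = simplex_info (\<lambda>_. ()) ?K3 ?D (pmf P)"
      using fin by (intro info_eq_simplex_info finite_input_set[OF ch]; simp)+
    then show ?thesis by (simp only: degraded_objective_eq[OF ch that])
  qed
  moreover have "\<exists>P. set_pmf P \<subseteq> ?D \<and> (\<forall>Q. set_pmf Q \<subseteq> ?D \<longrightarrow> ?g (pmf Q) \<le> ?g (pmf P))"
    by (intro ex_optimal_pmf finite_input_set[OF ch] input_set_nonempty[OF ch] continuous_on_min continuous_on_simplex_info)
  ultimately show ?thesis by (auto simp: input_dists_def)
qed

section \<open>Codes for the channel and codes for the memoryless relay\<close>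

lemma block_history_first:
  "t < L \<Longrightarrow> length x = L \<Longrightarrow> block_history L t (x @ xs) = take (Suc t) x"
  by (simp add: block_history_def)

lemma block_history_next:
  assumes "length x = L" "0 < L"
  shows "block_history L (L + k) (x @ xs) = block_history L k xs"
proof -
  have "L * ((L + k) div L) = L + L * (k div L)" using assms by simp
  then show ?thesis using assms by (simp add: block_history_def)
qed

lemma relay_inputs_append:
  "length y = L \<Longrightarrow>
     relay_inputs g (y @ ys) (L + n) = map (\<lambda>s. g (take s y)) [0..<L] @ relay_inputs (\<lambda>ys. g (y @ ys)) ys n"
  by (rule nth_equalityI) (auto simp: relay_inputs_def nth_append)

text \<open>Code functions are extensional, so \<open>g\<close> and \<open>a\<close> can be compared
  only on words over the relay's output alphabets. By \<open>block_outputs_words\<close> the run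
  never leaves these words.\<close>

lemma outputs_first_block:
  assumes ch: "valid_channel ch" and x: "x \<in> words (X1_alph ch) (block_len ch)" and z: "z \<in> set_pmf (noise ch)"
    and a: "a \<in> code_functions ch"
    and g: "\<And>ys. ys \<in> words (Y2_alph ch) (length ys) \<Longrightarrow> length ys < block_len ch \<Longrightarrow> g ys = a (length ys) ys"
    and t: "t \<le> block_len ch"
  shows "relay_outputs ch (x @ xs) g (z # zs) t = relay_outputs ch x (\<lambda>ys. a (length ys) ys) [z] t \<and>
         dest_outputs ch (x @ xs) g (z # zs) t = dest_outputs ch x (\<lambda>ys. a (length ys) ys) [z] t"
  using t
proof (induction t)
  case 0
  then show ?case by (simp add: dest_outputs_def)
next
  case (Suc t)
  let ?ys = "relay_outputs ch x (\<lambda>ys. a (length ys) ys) [z] t"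
  have tL: "t < block_len ch" using Suc.prems by simp
  have lx: "length x = block_len ch" using x by (simp add: words_def)
  have ys: "?ys \<in> words (Y2_alph ch) t"
    using block_outputs_words[OF ch x a z] tL by simp
  have "g (take s ?ys) = a s (take s ?ys)" if "s \<le> t" for s
    using g[of "take s ?ys"] words_take[OF ys that] that tL by simp
  then have inp: "relay_inputs g ?ys (Suc t) = relay_inputs (\<lambda>ys. a (length ys) ys) ?ys (Suc t)"
    by (auto simp: relay_inputs_def simp del: upt_Suc)
  have hist: "block_history (block_len ch) t x = take (Suc t) x"
    using block_history_first[OF tL lx, of "[]"] by simp
  show ?case
    using Suc tL by (simp add: Let_def dest_outputs_Suc inp hist block_history_first[OF tL lx])
qed

text \<open>The channel has no memory across blocks. After the first one it starts afresh on the
  remaining inputs and noise, with the strategy that has already received the first block of relay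
  outputs.\<close>

lemma outputs_next_block:
  fixes xs :: "'x1 list" and ch :: "('x1, 'x2, 'y2, 'y3, 'z) relay_channel"
  defines "y \<equiv> \<lambda>x g z zs xs. relay_outputs ch (x @ xs) g (z # zs) (block_len ch)"
  assumes L: "0 < block_len ch" and x: "length x = block_len ch"
  shows "relay_outputs ch (x @ xs) g (z # zs) (block_len ch + k)
           = y x g z zs xs @ relay_outputs ch xs (\<lambda>ys. g (y x g z zs xs @ ys)) zs k \<and>
         dest_outputs ch (x @ xs) g (z # zs) (block_len ch + k)
           = dest_outputs ch (x @ xs) g (z # zs) (block_len ch) @ dest_outputs ch xs (\<lambda>ys. g (y x g z zs xs @ ys)) zs k"
proof (induction k)
  case 0
  then show ?case by (simp add: y_def dest_outputs_def)
next
  case (Suc k)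
  let ?L = "block_len ch" let ?y = "y x g z zs xs" let ?g = "\<lambda>ys. g (?y @ ys)"
  let ?ys = "relay_outputs ch xs ?g zs k"
  have ly: "length ?y = ?L" by (simp add: y_def)
  have inp: "block_history ?L (?L + k) (relay_inputs g (?y @ ?ys) (Suc (?L + k)))
      = block_history ?L k (relay_inputs ?g ?ys (Suc k))"
    using relay_inputs_append[OF ly, of g ?ys "Suc k"] L
    by (simp add: block_history_next)
  have z: "(z # zs) ! ((?L + k) div ?L) = zs ! (k div ?L)" using L by simp
  show ?case
    using Suc L by (simp add: Let_def dest_outputs_Suc inp z block_history_next[OF x L])
qed

text \<open>The bridge from channel time to runs over blocks: \<open>R\<close> turns the outputs of
  earlier blocks into the code function of the current one. The condition
  \<open>length yss < length xss\<close> reflects that \<open>is_code\<close> constrains a strategy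
  only before the final time.\<close>

lemma dest_outputs_concat:
  assumes ch: "valid_channel ch"
    and "length zs = length xss" "set zs \<subseteq> set_pmf (noise ch)" "set xss \<subseteq> words (X1_alph ch) (block_len ch)"
    and "\<And>yss. R yss \<in> code_functions ch"
    and "\<And>yss ys. set yss \<subseteq> words (Y2_alph ch) (block_len ch) \<Longrightarrow> length yss < length xss \<Longrightarrow>
          ys \<in> words (Y2_alph ch) (length ys) \<Longrightarrow> length ys < block_len ch \<Longrightarrow>
          g (concat yss @ ys) = R yss (length ys) ys"
  shows "dest_outputs ch (concat xss) g zs (length xss * block_len ch)
       = concat (map (case_prod (block_Y3 ch)) (relay_run (block_Y2 ch) R xss zs))"
  using assms(2-)
proof (induction xss arbitrary: zs g R)
  case Nil
  then show ?case by (simp add: dest_outputs_def)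
next
  case (Cons x xss)
  then obtain z zs' where zs: "zs = z # zs'" by (cases zs) auto
  let ?L = "block_len ch"
  have L: "0 < ?L" using ch by (simp add: valid_channel_def)
  have x: "x \<in> words (X1_alph ch) ?L" and z: "z \<in> set_pmf (noise ch)" using Cons.prems zs by auto
  have lx: "length x = ?L" using x by (simp add: words_def)
  have g0: "g ys = R [] (length ys) ys" if "ys \<in> words (Y2_alph ch) (length ys)" "length ys < ?L" for ys
    using Cons.prems(5)[of "[]" ys] that by simp
  note first = outputs_first_block[OF ch x z Cons.prems(4)[of "[]"] g0 order_refl, of "concat xss" zs']
  let ?y = "block_Y2 ch (x, R []) z"
  have y: "relay_outputs ch (x @ concat xss) g (z # zs') ?L = ?y"
    "dest_outputs ch (x @ concat xss) g (z # zs') ?L = block_Y3 ch (x, R []) z"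
    using first by (auto simp: block_Y2_def block_Y3_def)
  have yw: "?y \<in> words (Y2_alph ch) ?L"
    using Cons.prems(4) x by (intro block_words[OF ch _ z]) auto
  have "dest_outputs ch (concat xss) (\<lambda>ys. g (?y @ ys)) zs' (length xss * ?L)
      = concat (map (case_prod (block_Y3 ch)) (relay_run (block_Y2 ch) (\<lambda>yss. R (?y # yss)) xss zs'))"
  proof (rule Cons.IH)
    fix yss ys
    assume "set yss \<subseteq> words (Y2_alph ch) ?L" "length yss < length xss"
      "ys \<in> words (Y2_alph ch) (length ys)" "length ys < ?L"
    then show "g (?y @ concat yss @ ys) = R (?y # yss) (length ys) ys"
      using Cons.prems(5)[of "?y # yss" ys] yw by simp
  qed (use Cons.prems zs in auto)
  then show ?case
    using outputs_next_block[OF L lx, of "concat xss" g z zs' "length xss * ?L"] by (simp add: zs y)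
qed

lemma words_append:
  assumes "xs \<in> words A m" "ys \<in> words (\<lambda>t. A (m + t)) k"
  shows "xs @ ys \<in> words A (m + k)"
proof -
  have "(xs @ ys) ! i \<in> A i" if "i < m + k" for i
  proof (cases "i < m")
    case True
    then show ?thesis using assms(1) by (simp add: words_def nth_append)
  next
    case False
    then have "i - m < k" using that by simp
    then have "ys ! (i - m) \<in> A (m + (i - m))" using assms(2) unfolding words_def by blast
    then show ?thesis using assms(1) False by (simp add: words_def nth_append)
  qed
  then show ?thesis using assms by (simp add: words_def)
qed

lemma words_mod: "i \<le> L \<Longrightarrow> words (\<lambda>t. A (t mod L)) i = words A i"
  by (auto simp: words_def)

lemma words_concat_append:
  assumes "set xss \<subseteq> words A L" "ys \<in> words A r" "r \<le> L"
  shows "concat xss @ ys \<in> words (\<lambda>t. A (t mod L)) (length xss * L + r)"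
  using assms(1)
proof (induction xss)
  case Nil
  then show ?case using assms(2,3) by (simp add: words_mod)
next
  case (Cons x xss)
  have "x \<in> words (\<lambda>t. A (t mod L)) L" using Cons.prems by (simp add: words_mod)
  from words_append[OF this, of "concat xss @ ys"] show ?case using Cons by (simp add: add.assoc)
qed

lemma words_concat:
  "set xss \<subseteq> words A L \<Longrightarrow> concat xss \<in> words (\<lambda>t. A (t mod L)) (length xss * L)"
  using words_concat_append[of xss A L "[]" 0] by (simp add: words_def)

lemma words_split:
  assumes "xs \<in> words (\<lambda>t. A (t mod L)) (m * L + r)" "r < L"
  shows "set (chunks L xs) \<subseteq> words A L" "length (chunks L xs) = m" "drop (m * L) xs \<in> words A r"
    "xs = concat (chunks L xs) @ drop (m * L) xs"
proof -
  have "\<exists>yss ys. set yss \<subseteq> words A L \<and> length yss = m \<and> ys \<in> words A r \<and> xs = concat yss @ ys"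
    using assms(1)
  proof (induction m arbitrary: xs)
    case 0
    then have "xs \<in> words A r" using assms(2) by (auto simp: words_def)
    then show ?case by (intro exI[of _ "[]"] exI[of _ xs]) simp
  next
    case (Suc m)
    have "take L xs \<in> words (\<lambda>t. A (t mod L)) L" by (rule words_take[OF Suc.prems]) simp
    then have "take L xs \<in> words A L" by (simp add: words_mod)
    moreover have "drop L xs \<in> words (\<lambda>t. A (t mod L)) (m * L + r)"
    proof -
      have "xs ! (L + i) \<in> A (i mod L)" if "i < m * L + r" for i
      proof -
        have "L + i < Suc m * L + r" using that by simp
        then have "xs ! (L + i) \<in> A ((L + i) mod L)" using Suc.prems unfolding words_def by blast
        then show ?thesis by simp
      qed
      then show ?thesis using Suc.prems by (auto simp: words_def)
    qed
    then obtain yss ys where "set yss \<subseteq> words A L" "length yss = m" "ys \<in> words A r" "drop L xs = concat yss @ ys"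
      using Suc.IH by blast
    moreover have "xs = take L xs @ drop L xs" by simp
    ultimately show ?case
      by (intro exI[of _ "take L xs # yss"] exI[of _ ys]) auto
  qed
  then obtain yss ys where y: "set yss \<subseteq> words A L" "length yss = m" "ys \<in> words A r" "xs = concat yss @ ys"
    by blast
  have "length y = L" if "y \<in> set yss" for y using that y(1) by (auto simp: words_def)
  note c = chunks_append[OF this, of yss ys]
  have "chunks L xs = yss" "drop (m * L) xs = ys"
    using c y assms(2) by (auto simp: words_def mult.commute)
  then show "set (chunks L xs) \<subseteq> words A L" "length (chunks L xs) = m" "drop (m * L) xs \<in> words A r"
    "xs = concat (chunks L xs) @ drop (m * L) xs"
    using y by auto
qed

text \<open>With the outputs of earlier blocks held fixed, \<open>g\<close> is a code function of
  the outputs within the current block. So an unrestricted relay is already a relay whose letters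
  are code functions.\<close>

lemma relay_code_of_code:
  assumes ch: "valid_channel ch" and code: "is_code ch m M enc g dec" and M: "0 < M"
  obtains enc' R dec' where
    "\<And>w. w < M \<Longrightarrow> length (enc' w) = m \<and> set (enc' w) \<subseteq> words (X1_alph ch) (block_len ch)"
    "range R \<subseteq> code_functions ch"
    "measure_pmf.prob (pair_pmf (pmf_of_set {..<M}) (replicate_pmf m (noise ch)))
        {(w, zs). dec' (map (case_prod (block_Y3 ch)) (relay_run (block_Y2 ch) R (enc' w) zs)) \<noteq> w}
      = error_prob ch m M enc g dec"
proof -
  let ?L = "block_len ch"
  have L: "0 < ?L" using ch by (simp add: valid_channel_def)
  obtain a0 where a0: "a0 \<in> code_functions ch" using input_set_nonempty[OF ch] by auto
  \<comment> \<open>On impossible words and after the last block nothing is known about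
    \<open>g\<close>; the code function \<open>a0\<close> keeps the whole range of \<open>R\<close>
    inside \<open>code_functions\<close>.\<close>
  define R where "R yss = (if set yss \<subseteq> words (Y2_alph ch) ?L \<and> length yss < m
      then (\<lambda>i\<in>{..<?L}. \<lambda>ys\<in>words (Y2_alph ch) i. g (concat yss @ ys)) else a0)" for yss
  define enc' where "enc' w = chunks ?L (enc w)" for w
  define dec' where "dec' vss = dec (concat vss)" for vss
  have R: "R yss \<in> code_functions ch" for yss
  proof (cases "set yss \<subseteq> words (Y2_alph ch) ?L \<and> length yss < m")
    case True
    have "g (concat yss @ ys) \<in> X2_alph ch i" if i: "i < ?L" and ys: "ys \<in> words (Y2_alph ch) i" for i ys
    proof -
      have w: "concat yss @ ys \<in> words (\<lambda>t. Y2_alph ch (t mod ?L)) (length yss * ?L + i)"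
        using True i ys by (intro words_concat_append) auto
      have "length yss * ?L + i < m * ?L"
      proof -
        have "length yss * ?L + i < Suc (length yss) * ?L" using i by simp
        also have "\<dots> \<le> m * ?L" using True by (intro mult_le_mono1) auto
        finally show ?thesis .
      qed
      then have "g (concat yss @ ys) \<in> X2_alph ch ((length yss * ?L + i) mod ?L)"
        using code w unfolding is_code_def Let_def by blast
      then show ?thesis using i by simp
    qed
    then show ?thesis using True by (auto simp: R_def code_functions_def)
  qed (use a0 in \<open>simp add: R_def if_not_P\<close>)
  have enc: "length (enc' w) = m" "set (enc' w) \<subseteq> words (X1_alph ch) ?L" "concat (enc' w) = enc w" if "w < M" for w
  proof -
    have w: "enc w \<in> words (\<lambda>t. X1_alph ch (t mod ?L)) (m * ?L + 0)"
      using code that by (simp add: is_code_def Let_def)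
    show "length (enc' w) = m" "set (enc' w) \<subseteq> words (X1_alph ch) ?L"
      using words_split[OF w L] by (auto simp: enc'_def)
    show "concat (enc' w) = enc w"
      using words_split(3,4)[OF w L] by (simp add: enc'_def words_def)
  qed
  have "measure_pmf.prob (pair_pmf (pmf_of_set {..<M}) (replicate_pmf m (noise ch)))
        {(w, zs). dec' (map (case_prod (block_Y3 ch)) (relay_run (block_Y2 ch) R (enc' w) zs)) \<noteq> w}
      = error_prob ch m M enc g dec"
    unfolding error_prob_def
  proof (rule measure_pmf.finite_measure_eq_AE; (simp; fail)?)
    have "dest_outputs ch (enc w) g zs (m * ?L) = concat (map (case_prod (block_Y3 ch)) (relay_run (block_Y2 ch) R (enc' w) zs))"
      if w: "w < M" and zs: "zs \<in> set_pmf (replicate_pmf m (noise ch))" for w zs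
    proof -
      have "dest_outputs ch (concat (enc' w)) g zs (length (enc' w) * ?L)
        = concat (map (case_prod (block_Y3 ch)) (relay_run (block_Y2 ch) R (enc' w) zs))"
      proof (rule dest_outputs_concat[OF ch])
        fix yss ys
        assume "set yss \<subseteq> words (Y2_alph ch) ?L" "length yss < length (enc' w)"
          "ys \<in> words (Y2_alph ch) (length ys)" "length ys < ?L"
        then show "g (concat yss @ ys) = R yss (length ys) ys"
          using enc(1)[OF w] by (simp add: R_def)
      qed (use enc[OF w] R zs in \<open>auto simp: set_replicate_pmf\<close>)
      then show ?thesis by (simp add: enc[OF w])
    qed
    then show "AE \<omega> in pair_pmf (pmf_of_set {..<M}) (replicate_pmf m (noise ch)).
        \<omega> \<in> {(w, zs). dec' (map (case_prod (block_Y3 ch)) (relay_run (block_Y2 ch) R (enc' w) zs)) \<noteq> w} \<longleftrightarrow>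
        \<omega> \<in> {(w, zs). dec (dest_outputs ch (enc w) g zs (m * ?L)) \<noteq> w}"
      using M lessThan_empty_iff[of M] by (intro AE_pmfI) (auto simp: dec'_def)
  qed
  then show ?thesis using that enc(1,2) R by blast
qed

lemma code_of_relay_code:
  assumes ch: "valid_channel ch" and M: "0 < M"
    and enc: "\<And>w. w < M \<Longrightarrow> length (enc w) = m \<and> set (enc w) \<subseteq> words (X1_alph ch) (block_len ch)"
    and R: "\<And>yss. R yss \<in> code_functions ch" and dec: "\<And>vss. dec vss < M"
  obtains enc' g dec' where "is_code ch m M enc' g dec'"
    "error_prob ch m M enc' g dec' =
       measure_pmf.prob (pair_pmf (pmf_of_set {..<M}) (replicate_pmf m (noise ch)))
        {(w, zs). dec (map (case_prod (block_Y3 ch)) (relay_run (block_Y2 ch) R (enc w) zs)) \<noteq> w}"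
proof -
  let ?L = "block_len ch"
  have L: "0 < ?L" using ch by (simp add: valid_channel_def)
  define enc' where "enc' w = concat (enc w)" for w
  \<comment> \<open>The completed blocks select a code function, which is then evaluated at the
    current position on the outputs of the unfinished block.\<close>
  define g where "g ys = R (chunks ?L ys) (length ys mod ?L) (drop (length ys div ?L * ?L) ys)" for ys
  define dec' where "dec' vs = dec (chunks ?L vs)" for vs
  have code: "is_code ch m M enc' g dec'"
    unfolding is_code_def Let_def
  proof (intro conjI allI impI ballI)
    fix w assume "w < M"
    then show "enc' w \<in> words (\<lambda>t. X1_alph ch (t mod ?L)) (m * ?L)"
      using words_concat[of "enc w" "X1_alph ch" ?L] enc by (simp add: enc'_def)
  next
    fix t ys assume "t < m * ?L" and ys: "ys \<in> words (\<lambda>s. Y2_alph ch (s mod ?L)) t"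
    have lys: "length ys = t" using ys by (simp add: words_def)
    have "ys \<in> words (\<lambda>s. Y2_alph ch (s mod ?L)) (t div ?L * ?L + t mod ?L)" using ys by simp
    from words_split(3)[OF this] have "drop (t div ?L * ?L) ys \<in> words (Y2_alph ch) (t mod ?L)"
      using L by simp
    then show "g ys \<in> X2_alph ch (t mod ?L)"
      using R[of "chunks ?L ys"] L by (auto simp: g_def lys code_functions_def PiE_iff)
  qed (simp add: dec'_def dec)
  have "error_prob ch m M enc' g dec' =
       measure_pmf.prob (pair_pmf (pmf_of_set {..<M}) (replicate_pmf m (noise ch)))
        {(w, zs). dec (map (case_prod (block_Y3 ch)) (relay_run (block_Y2 ch) R (enc w) zs)) \<noteq> w}"
    unfolding error_prob_def
  proof (rule measure_pmf.finite_measure_eq_AE; (simp; fail)?)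
    have "dec' (dest_outputs ch (enc' w) g zs (m * ?L)) = dec (map (case_prod (block_Y3 ch)) (relay_run (block_Y2 ch) R (enc w) zs))"
      if w: "w < M" and zs: "zs \<in> set_pmf (replicate_pmf m (noise ch))" for w zs
    proof -
      have "dest_outputs ch (concat (enc w)) g zs (length (enc w) * ?L)
        = concat (map (case_prod (block_Y3 ch)) (relay_run (block_Y2 ch) R (enc w) zs))"
      proof (rule dest_outputs_concat[OF ch])
        fix yss ys
        assume *: "set yss \<subseteq> words (Y2_alph ch) ?L" "length ys < ?L" "ys \<in> words (Y2_alph ch) (length ys)"
        then have "length y = ?L" if "y \<in> set yss" for y using that by (auto simp: words_def)
        then have c: "chunks ?L (concat yss @ ys) = yss" "length (concat yss @ ys) mod ?L = length ys"
          "drop (?L * length yss) (concat yss @ ys) = ys"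
          using *(2) by (intro chunks_append; blast)+
        have "length (concat yss @ ys) = length yss * ?L + length ys"
          using \<open>\<And>y. y \<in> set yss \<Longrightarrow> length y = ?L\<close>
          by (induction yss) auto
        then have d: "length (concat yss @ ys) div ?L = length yss" using *(2) by simp
        show "g (concat yss @ ys) = R yss (length ys) ys"
          unfolding g_def d c(1,2) using c(3) by (simp add: mult.commute)
      qed (use enc[OF w] R zs in \<open>auto simp: set_replicate_pmf\<close>)
      moreover have "chunks ?L (concat (map (case_prod (block_Y3 ch)) (relay_run (block_Y2 ch) R (enc w) zs)) @ [])
          = map (case_prod (block_Y3 ch)) (relay_run (block_Y2 ch) R (enc w) zs)"
        by (rule chunks_append) (use L in \<open>auto simp: block_Y3_def\<close>)
      ultimately show ?thesis using enc[OF w] by (simp add: enc'_def dec'_def)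
    qed
    then show "AE \<omega> in pair_pmf (pmf_of_set {..<M}) (replicate_pmf m (noise ch)).
        \<omega> \<in> {(w, zs). dec' (dest_outputs ch (enc' w) g zs (m * ?L)) \<noteq> w} \<longleftrightarrow>
        \<omega> \<in> {(w, zs). dec (map (case_prod (block_Y3 ch)) (relay_run (block_Y2 ch) R (enc w) zs)) \<noteq> w}"
      using M lessThan_empty_iff[of M] by (intro AE_pmfI) auto
  qed
  with code show ?thesis using that by blast
qed

section \<open>The capacity\<close>

text \<open>The order of limits matters: with \<open>\<tau>\<close> fixed, letting
  \<open>\<epsilon>\<close> tend to 0 removes \<open>\<epsilon> * log 2 \<tau>\<close>; only then
  may \<open>\<tau>\<close> tend to 0.\<close>

lemma achievable_imp_rate_le:
  assumes ch: "valid_channel ch" and deg: "physically_degraded ch" and R: "achievable ch R"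
    and opt: "\<And>Q. Q \<in> input_dists ch \<Longrightarrow> degraded_objective ch Q \<le> C"
  shows "real (block_len ch) * R \<le> C"
proof -
  let ?L = "real (block_len ch)"
  obtain V where V: "\<And>x a. x \<in> words (X1_alph ch) (block_len ch) \<Longrightarrow> a \<in> code_functions ch \<Longrightarrow>
      map_pmf (\<lambda>z. (block_Y2 ch (x, a) z, block_Y3 ch (x, a) z)) (noise ch)
        = bind_pmf (map_pmf (block_Y2 ch (x, a)) (noise ch)) (\<lambda>y. map_pmf (Pair y) (V a y))"
    using degraded_kernel[OF ch deg] by blast
  have main: "(1 - \<epsilon>) * (?L * R) + log 2 (1 - \<tau>) + \<epsilon> * log 2 \<tau> \<le> C"
    if \<epsilon>: "0 < \<epsilon>" "\<epsilon> < 1" and \<tau>: "0 < \<tau>" "\<tau> < 1" for \<epsilon> \<tau> :: real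
  proof -
    obtain m M enc g dec where m: "m \<ge> 1" and M: "M \<ge> 1"
      and rate: "log 2 (real M) = real (m * block_len ch) * R"
      and code: "is_code ch m M enc g dec" and err: "error_prob ch m M enc g dec \<le> \<epsilon>"
      using R \<epsilon>(1) unfolding achievable_def by blast
    have M0: "0 < M" and m0: "0 < m" using m M by auto
    obtain enc' Rl dec' where c: "\<And>w. w < M \<Longrightarrow> length (enc' w) = m \<and> set (enc' w) \<subseteq> words (X1_alph ch) (block_len ch)"
      "range Rl \<subseteq> code_functions ch"
      "measure_pmf.prob (pair_pmf (pmf_of_set {..<M}) (replicate_pmf m (noise ch)))
        {(w, zs). dec' (map (case_prod (block_Y3 ch)) (relay_run (block_Y2 ch) Rl (enc' w) zs)) \<noteq> w}
      = error_prob ch m M enc g dec"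
      using relay_code_of_code[OF ch code M0] by blast
    have fin: "finite (set_pmf (noise ch))" using ch by (simp add: valid_channel_def)
    obtain P where P: "set_pmf P \<subseteq> words (X1_alph ch) (block_len ch) \<times> code_functions ch"
      and bound: "(1 - \<epsilon>) * log 2 (real M) + log 2 (1 - \<tau>) + \<epsilon> * log 2 \<tau>
        \<le> real m * min (info snd (\<lambda>u. map_pmf (block_Y2 ch u) (noise ch)) P)
            (info (\<lambda>_. ()) (\<lambda>u. map_pmf (block_Y3 ch u) (noise ch)) P)"
    proof -
      have "\<exists>P. set_pmf P \<subseteq> words (X1_alph ch) (block_len ch) \<times> code_functions ch \<and>
        (1 - \<epsilon>) * log 2 (real M) + log 2 (1 - \<tau>) + \<epsilon> * log 2 \<tau>
        \<le> real m * min (info snd (\<lambda>u. map_pmf (block_Y2 ch u) (noise ch)) P)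
            (info (\<lambda>_. ()) (\<lambda>u. map_pmf (block_Y3 ch u) (noise ch)) P)"
        by (rule converse_bound[where V = V and dec = dec' and enc = enc', OF _ fin m0 M0 _ c(2) _ \<tau>])
           (rule V, assumption+, rule c(1), assumption, simp only: c(3) err)
      then show ?thesis using that by blast
    qed
    have Pin: "P \<in> input_dists ch" using P by (simp add: input_dists_def)
    have "real m * ((1 - \<epsilon>) * (?L * R)) + log 2 (1 - \<tau>) + \<epsilon> * log 2 \<tau> \<le> real m * C"
    proof -
      have "real m * degraded_objective ch P \<le> real m * C" using opt[OF Pin] by (intro mult_left_mono) auto
      then show ?thesis using bound by (simp add: degraded_objective_eq[OF ch Pin] rate algebra_simps)
    qed
    \<comment> \<open>The number \<open>m\<close> of blocks comes with the code and may be small, so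
      the constants cannot be divided away. They are nonpositive and \<open>m\<close> is at least 1,
      so multiplying them by \<open>m\<close> only weakens the bound, and \<open>m\<close> then
      cancels.\<close>
    moreover have "real m * (log 2 (1 - \<tau>) + \<epsilon> * log 2 \<tau>) \<le> 1 * (log 2 (1 - \<tau>) + \<epsilon> * log 2 \<tau>)"
    proof (rule mult_right_mono_neg)
      have "log 2 (1 - \<tau>) < 0" "log 2 \<tau> < 0" using \<tau> by auto
      then show "log 2 (1 - \<tau>) + \<epsilon> * log 2 \<tau> \<le> 0" using \<epsilon> by (simp add: add_nonpos_nonpos mult_nonneg_nonpos)
    qed (use m in simp)
    ultimately have "real m * ((1 - \<epsilon>) * (?L * R) + (log 2 (1 - \<tau>) + \<epsilon> * log 2 \<tau>)) \<le> real m * C"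
      by (simp only: distrib_left)
    then show ?thesis using m0 by simp
  qed
  have "?L * R + log 2 (1 - \<tau>) \<le> C" if \<tau>: "0 < \<tau>" "\<tau> < 1" for \<tau> :: real
  proof (rule tendsto_upperbound)
    show "((\<lambda>\<epsilon>. (1 - \<epsilon>) * (?L * R) + log 2 (1 - \<tau>) + \<epsilon> * log 2 \<tau>) \<longlongrightarrow> ?L * R + log 2 (1 - \<tau>)) (at_right 0)"
      by (rule tendsto_eq_intros refl | simp)+
    show "\<forall>\<^sub>F \<epsilon> in at_right 0. (1 - \<epsilon>) * (?L * R) + log 2 (1 - \<tau>) + \<epsilon> * log 2 \<tau> \<le> C"
      using main \<tau> by (auto simp: eventually_at_right_field intro!: exI[of _ 1])
  qed simp
  moreover have "((\<lambda>\<tau>. ?L * R + log 2 (1 - \<tau>)) \<longlongrightarrow> ?L * R) (at_right 0)"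
    by (rule tendsto_eq_intros refl | simp)+
  ultimately show ?thesis
    by (intro tendsto_upperbound[where F = "at_right 0" and f = "\<lambda>\<tau>. ?L * R + log 2 (1 - \<tau>)"])
       (auto simp: eventually_at_right_field intro!: exI[of _ 1])
qed

text \<open>The code carries \<open>p * j * B\<close> bits in \<open>Suc B * (q * j)\<close> channel
  blocks. The \<open>j\<close> chosen for the error level cancels, so one rate serves every
  \<open>\<epsilon>\<close>.\<close>

lemma achievable_block_markov:
  assumes ch: "valid_channel ch" and P: "P \<in> input_dists ch" and q: "0 < q"
    and rate: "real p < real q * degraded_objective ch P"
  shows "achievable ch (real (p * B) / real (q * Suc B * block_len ch))"
  unfolding achievable_def
proof (intro allI impI)
  fix \<epsilon> :: real assume \<epsilon>: "0 < \<epsilon>"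
  let ?L = "block_len ch"
  have L: "0 < ?L" using ch by (simp add: valid_channel_def)
  have sub: "set_pmf P \<subseteq> words (X1_alph ch) ?L \<times> code_functions ch" using P by (simp add: input_dists_def)
  have fin: "finite (set_pmf P)" "finite (set_pmf (noise ch))"
    using finite_subset[OF sub finite_input_set[OF ch]] ch by (auto simp: valid_channel_def)
  have "real q * degraded_objective ch P \<le> real q * info snd (\<lambda>u. map_pmf (block_Y2 ch u) (noise ch)) P"
    "real q * degraded_objective ch P \<le> real q * info (\<lambda>_. ()) (\<lambda>u. map_pmf (block_Y3 ch u) (noise ch)) P"
    by (intro mult_left_mono; simp add: degraded_objective_eq[OF ch P])+
  then have "real p < real q * info snd (\<lambda>u. map_pmf (block_Y2 ch u) (noise ch)) P"
    "real p < real q * info (\<lambda>_. ()) (\<lambda>u. map_pmf (block_Y3 ch u) (noise ch)) P"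
    using rate by linarith+
  from ex_relay_code[OF fin q \<epsilon> this, of B] obtain j enc R dec where j: "j \<ge> 1"
    and enc: "\<forall>w<(2::nat) ^ (p * j * B). length (enc w) = Suc B * (q * j) \<and> set (enc w) \<subseteq> fst ` set_pmf P"
    and R: "\<forall>ys. R ys \<in> snd ` set_pmf P" and dec: "\<forall>vs. dec vs < (2::nat) ^ (p * j * B)"
    and err: "measure_pmf.prob (pair_pmf (pmf_of_set {..<2 ^ (p * j * B)}) (replicate_pmf (Suc B * (q * j)) (noise ch)))
        {(w, zs). dec (map (case_prod (block_Y3 ch)) (relay_run (block_Y2 ch) R (enc w) zs)) \<noteq> w} \<le> \<epsilon>"
    by (elim exE conjE) (rule that; assumption)
  let ?M = "(2::nat) ^ (p * j * B)" and ?m = "Suc B * (q * j)"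
  have enc': "length (enc w) = ?m \<and> set (enc w) \<subseteq> words (X1_alph ch) ?L" if "w < ?M" for w
    using enc that sub by fastforce
  have R': "R yss \<in> code_functions ch" for yss using R[rule_format, of yss] sub by auto
  have dec': "dec vss < ?M" for vss using dec by (rule spec)
  have M0: "0 < ?M" by simp
  obtain enc'' g dec'' where c: "is_code ch ?m ?M enc'' g dec''"
    "error_prob ch ?m ?M enc'' g dec'' = measure_pmf.prob (pair_pmf (pmf_of_set {..<?M}) (replicate_pmf ?m (noise ch)))
        {(w, zs). dec (map (case_prod (block_Y3 ch)) (relay_run (block_Y2 ch) R (enc w) zs)) \<noteq> w}"
    by (rule code_of_relay_code[where R = R and dec = dec and enc = enc, OF ch M0 _ R' dec'])
       (rule enc', assumption, rule that)
  have "log 2 (real ?M) = real (?m * ?L) * (real (p * B) / real (q * Suc B * ?L))"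
    using j q L by (simp add: log_nat_power field_simps del: of_nat_Suc mult_Suc mult_Suc_right)
  moreover have "?m \<ge> 1" "?M \<ge> 1" using j q by (simp_all add: Suc_le_eq)
  moreover have "error_prob ch ?m ?M enc'' g dec'' \<le> \<epsilon>" unfolding c(2) by (rule err)
  ultimately show "\<exists>m M enc g dec. m \<ge> 1 \<and> M \<ge> 1 \<and> log 2 (real M) = real (m * ?L) * (real (p * B) / real (q * Suc B * ?L)) \<and>
        is_code ch m M enc g dec \<and> error_prob ch m M enc g dec \<le> \<epsilon>"
    using c(1) by blast
qed

text \<open>A single message. This keeps the supremum from being minus infinity and covers an
  optimum of 0, where block Markov coding yields no rate at all.\<close>

lemma achievable_zero:
  assumes ch: "valid_channel ch"
  shows "achievable ch 0"
  unfolding achievable_def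
proof (intro allI impI)
  fix \<epsilon> :: real assume \<epsilon>: "0 < \<epsilon>"
  obtain x a where xa: "x \<in> words (X1_alph ch) (block_len ch)" "a \<in> code_functions ch"
    using input_set_nonempty[OF ch] by auto
  have one: "(0::nat) < 1" by simp
  have len: "length [x] = 1 \<and> set [x] \<subseteq> words (X1_alph ch) (block_len ch)" using xa by simp
  obtain enc' g dec' where c: "is_code ch 1 1 enc' g dec'"
    "error_prob ch 1 1 enc' g dec' = measure_pmf.prob (pair_pmf (pmf_of_set {..<1 :: nat}) (replicate_pmf 1 (noise ch))) {(w, zs). 0 \<noteq> w}"
    by (rule code_of_relay_code[where R = "\<lambda>_. a" and dec = "\<lambda>_. 0" and enc = "\<lambda>_. [x]", OF ch one len xa(2) one])
       (rule that)
  have "error_prob ch 1 1 enc' g dec' = 0"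
    unfolding c(2) by (auto simp: measure_pmf_zero_iff lessThan_Suc simp del: replicate_pmf.simps)
  then show "\<exists>m M enc g dec. m \<ge> 1 \<and> M \<ge> 1 \<and> log 2 (real M) = real (m * block_len ch) * 0 \<and>
        is_code ch m M enc g dec \<and> error_prob ch m M enc g dec \<le> \<epsilon>"
    using c(1) \<epsilon> by (intro exI[of _ 1] exI[of _ enc'] exI[of _ g] exI[of _ dec']) auto
qed

text \<open>A positive rational \<open>p / q\<close> strictly between \<open>y\<close> and
  \<open>C\<close> leaves room for the loss factor B / (B + 1) of the closing block once
  \<open>B\<close> is large.\<close>

lemma ex_block_markov_rate:
  fixes C y :: real
  assumes "max 0 y < C"
  obtains p q B :: nat where "0 < q" "real p < real q * C" "y < real (p * B) / real (q * Suc B)"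
proof -
  obtain r where r: "r \<in> \<rat>" "max 0 y < r" "r < C"
    using Rats_dense_in_real[OF assms] by blast
  obtain p q :: nat where q: "q \<noteq> 0" and pq: "\<bar>r\<bar> = real p / real q"
    using Rats_abs_nat_div_natE[OF r(1)] by metis
  have rpq: "r = real p / real q" using r pq by simp
  have "(\<lambda>B. r * (real B / real (Suc B))) \<longlonglongrightarrow> r * 1"
    by (intro tendsto_intros LIMSEQ_n_over_Suc_n)
  then have "eventually (\<lambda>B. y < r * (real B / real (Suc B))) sequentially"
    using r by (intro order_tendstoD) auto
  then obtain B where "y < r * (real B / real (Suc B))"
    by (auto simp: eventually_sequentially)
  then have "y < real (p * B) / real (q * Suc B)" by (simp only: rpq of_nat_mult times_divide_times_eq)
  moreover have "real p < real q * C" using r(3) q by (simp add: rpq divide_less_eq mult.commute)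
  ultimately show ?thesis using that q by blast
qed

theorem mainTheorem10:
  fixes ch :: "('x1, 'x2, 'y2, 'y3, 'z) relay_channel"
  assumes "valid_channel ch"
    and "physically_degraded ch"
  shows "\<exists>P\<in>input_dists ch.
           (\<forall>Q\<in>input_dists ch. degraded_objective ch Q \<le> degraded_objective ch P) \<and>
           capacity ch = ereal (1 / real (block_len ch) * degraded_objective ch P)"
proof -
  obtain P where P: "P \<in> input_dists ch"
    and opt: "\<And>Q. Q \<in> input_dists ch \<Longrightarrow> degraded_objective ch Q \<le> degraded_objective ch P"
    using ex_optimal_input[OF assms(1)] by blast
  let ?L = "real (block_len ch)" and ?C = "degraded_objective ch P"
  have L: "0 < ?L" using assms(1) by (simp add: valid_channel_def)
  have "capacity ch \<le> ereal (1 / ?L * ?C)"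
    unfolding capacity_def
  proof (rule SUP_least)
    fix R assume "R \<in> {R. achievable ch R}"
    then have "?L * R \<le> ?C" using achievable_imp_rate_le[OF assms _ opt] by blast
    then show "ereal R \<le> ereal (1 / ?L * ?C)" using L by (simp add: field_simps)
  qed
  moreover have "ereal (1 / ?L * ?C) \<le> capacity ch"
  proof (rule ccontr)
    assume "\<not> ?thesis"
    then have less: "capacity ch < ereal (1 / ?L * ?C)" by simp
    have ge: "ereal R \<le> capacity ch" if "achievable ch R" for R
      unfolding capacity_def using that by (intro SUP_upper) auto
    have "0 \<le> capacity ch" using ge[OF achievable_zero[OF assms(1)]] by (simp add: zero_ereal_def)
    \<comment> \<open>Nonnegative and below a real number, the capacity is itself real, so a real
      rate can be placed above it.\<close>
    then obtain c where c: "capacity ch = ereal c" "0 \<le> c"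
      using less by (cases "capacity ch") auto
    have "max 0 (?L * c) < ?C" using less L c by (simp add: field_simps)
    then obtain p q B :: nat where pq: "0 < q" "real p < real q * ?C" "?L * c < real (p * B) / real (q * Suc B)"
      by (rule ex_block_markov_rate)
    have "ereal (real (p * B) / real (q * Suc B * block_len ch)) \<le> ereal c"
      using ge[OF achievable_block_markov[OF assms(1) P pq(1,2)]] c(1) by simp
    then have "real (p * B) / real (q * Suc B) / ?L \<le> c" by simp
    then have "real (p * B) / real (q * Suc B) \<le> c * ?L" by (simp only: pos_divide_le_eq[OF L])
    from less_le_trans[OF pq(3) this] show False by (simp add: mult.commute)
  qed
  ultimately show ?thesis using P opt by (intro bexI[of _ P]) auto
qed

end
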